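(* Let $k=\mathbb{C}$. Let $r$ and $s$ be nonnegative integers and let $V$ be a superspace of dimension $m|n$ with a homogeneous, nondegenerate, symmetric bilinear form $b$. Set $\varepsilon=(-1)^{\bar b}$, $\delta=m-n$, $\mathfrak g=\mathfrak g(V,b)$, and consider the linear map $$F:B_{r,s}(\delta,\varepsilon)\to\mathrm{Hom}_{\mathfrak g}(V^{\otimes r},V^{\otimes s}).$$ Then: 1. If the bilinear form is even, then $F$ is injective whenever $r+s\le m+n/2$. 2. If the bilinear form is odd, then $F$ is injective whenever $r+s\le m+n$.
   Context: Superspaces and $\mathfrak g$. A superspace is a finite-dimensional $\mathbb{Z}_2$-graded $k$-vector space $V=V_{\bar0}\oplus V_{\bar1}$, of dimension $m|n$ if $\dim V_{\bar0}=m$, $\dim V_{\bar1}=n$; $\bar v$ denotes the degree of homogeneous $v$. A bilinear form is homogeneous of degree $\bar b$ (even or odd) if the map $V\otimes V\to k$ is homogeneous of degree $\bar b$; it is symmetric if $(x,y)=(-1)^{\bar x\bar y}(y,x)$ for homogeneous $x,y$; nondegenerate if for every $x\ne0$ there is $y$ with $(x,y)\neq0$. (If $b$ is odd then $m=n$, so $\delta=0$.) $\mathfrak g(V,b)$ is the Lie superalgebra of all $A\in\mathfrak{gl}(V)=\mathrm{End}_k(V)$ with $(Ax,y)+(-1)^{\bar A\bar x}(x,Ay)=0$ (for homogeneous elements, extended linearly). Homomorphisms are written on the right: $\mathrm{Hom}_{\mathfrak g}(W,U)=\{f\in\mathrm{Hom}_k(W,U):(x.w)f=x.(w)f\ \forall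 x\in\mathfrak g, w\in W\}$ (including odd maps); composition is read left to right, and $(v\otimes w)(f\otimes g)=(-1)^{\bar f\,\bar w}(v)f\otimes(w)g$. The marked Brauer category. A Brauer diagram for $(r,s)$ is a partition of $\{1,\dots,r,1',\dots,s'\}$ into two-element subsets (edges), drawn with vertices $1,\dots,r$ in a top row and $1',\dots,s'$ in a bottom row. An edge joining two top vertices is a cup, two bottom vertices a cap, any other edge is a through string. A marked Brauer diagram is a Brauer diagram in which each cup carries one bead and each cap one arrow (pointing along the edge, toward its left or right endpoint), with no two markings (beads or arrows) at the same height; up to equivalence it is the data of the Brauer diagram, the total order of the markings from top to bottom, and a direction for each arrow. Two markings are adjacent if no other marking has height strictly between them. $B_{r,s}(\delta,\varepsilon)$ is the $k$-vector space spanned by marked Brauer diagrams for $(r,s)$ modulo: (i) interchanging the heights of two adjacent markings multiplies the diagram by $\varepsilon$; (ii) reversing the direction of one arrow multiplies it by $\varepsilon$. If $r+s$ is odd, $B_{r,s}(\delta,\varepsilon)=0$. Tensor product: $D_1\otimes D_2$ places $D_1$ to the left of $D_2$ with all markings of $D_1$ above those of $D_2$. Composition $B_{r,s}\times B_{s,t}\to B_{r,t}$: $D_1\circ D_2$ stacks $D_1$ above $D_2$, identifying the bottom vertices of $D_1$ with the top vertices of $D_2$ (markings of $D_1$ above those of $D_2$), then simplifies: (1) $m$ closed loops are deleted with factor $\delta^m$; (2) whenever a bead and an arrow are consecutive along the same edge and adjacent in height (which can be arranged using (i)), remove both and multiply by $1$ if the arrow is above the bead and points along the edge toward the bead, or the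 bead is above the arrow and the arrow points away from the bead, and by $\varepsilon$ otherwise; repeat until each cup carries one bead, each cap one arrow, through strings none. The map $F$. Let $v_1,\dots,v_{m+n}$ be a homogeneous basis of $V$ and $v_1^*,\dots,v_{m+n}^*$ the homogeneous basis with $(v_i,v_j^* )=\delta_{i,j}$. Let $c:k\to V\otimes V$, $(1)c=\sum_i(-1)^{\bar v_i}v_i\otimes v_i^*$, and let $\tau:V\otimes V\to V\otimes V$, $(v\otimes w)\tau=(-1)^{\bar v\bar w}w\otimes v$. The maps $F:B_{r,s}(\delta,\varepsilon)\to\mathrm{Hom}_{\mathfrak g}(V^{\otimes r},V^{\otimes s})$, for all $r,s\geq 0$, are the unique family of $k$-linear maps compatible with composition (left to right) and tensor products, preserving identities, with $F(I)=\mathrm{Id}_V$, $F(X)=\tau$, $F(\cup)=b$ (as a map $V\otimes V\to k$), $F(\cap)=c$; here $I\in B_{1,1}$ is the through string $\{1,1'\}$, $X\in B_{2,2}$ has through strings $\{1,2'\},\{2,1'\}$, $\cup\in B_{2,0}$ is a single cup with a bead, $\cap\in B_{0,2}$ is a single cap with a right-pointing arrow. *)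

theory Defs
  imports Complex_Main "HOL-Library.Z2" "HOL-Library.Function_Algebras"
    "HOL-Library.Multiset" "HOL-Library.Disjoint_Sets"
begin

text \<open>Complex vector spaces of functions.  Addition of functions is the pointwise one of
  \<^theory>\<open>HOL-Library.Function_Algebras\<close>.\<close>

definition fscale :: "complex \<Rightarrow> ('a \<Rightarrow> complex) \<Rightarrow> 'a \<Rightarrow> complex" where
  "fscale c f = (\<lambda>x. c * f x)"

global_interpretation cfun: vector_space fscale
  by standard (auto simp: fscale_def fun_eq_iff algebra_simps)


section \<open>Superspaces\<close>

text \<open>Degrees are elements of the field \<^typ>\<open>bit\<close> with two elements.  A graded space is given by
  the family of its homogeneous components, indexed by the degree.\<close>

definition psgn :: "bit \<Rightarrow> complex" where
  "psgn p = (if p = 1 then - 1 else 1)"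

locale superspace = vector_space scale
  for scale :: "complex \<Rightarrow> 'v::ab_group_add \<Rightarrow> 'v" +
  fixes V :: "bit \<Rightarrow> 'v set" and m n :: nat
  assumes component_subspace: "subspace (V p)"
    and components_disjoint: "V 0 \<inter> V 1 = {0}"
    and components_sum: "\<exists>x\<in>V 0. \<exists>y\<in>V 1. v = x + y"
    and finite_dim: "\<exists>B. finite B \<and> span B = UNIV"
    and dim_even: "dim (V 0) = m"
    and dim_odd: "dim (V 1) = n"

locale super_form = superspace scale V m n
  for scale :: "complex \<Rightarrow> 'v::ab_group_add \<Rightarrow> 'v" and V m n +
  fixes b :: "'v \<Rightarrow> 'v \<Rightarrow> complex" and \<beta> :: bit
  assumes linear_left: "Vector_Spaces.linear scale (*) (\<lambda>x. b x y)"
    and linear_right: "Vector_Spaces.linear scale (*) (\<lambda>y. b x y)"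
    \<comment> \<open>\<open>k\<close> is concentrated in degree 0, so degree \<open>\<beta>\<close> means that \<open>b\<close> vanishes in all other
      total degrees\<close>
    and homogeneous: "x \<in> V p \<Longrightarrow> y \<in> V q \<Longrightarrow> p + q \<noteq> \<beta> \<Longrightarrow> b x y = 0"
    and symmetric: "x \<in> V p \<Longrightarrow> y \<in> V q \<Longrightarrow> b x y = psgn (p * q) * b y x"
    and nondegenerate: "x \<noteq> 0 \<Longrightarrow> \<exists>y. b x y \<noteq> 0"

definition homogeneous_basis ::
    "(complex \<Rightarrow> 'v::ab_group_add \<Rightarrow> 'v) \<Rightarrow> (bit \<Rightarrow> 'v set) \<Rightarrow> nat \<Rightarrow> (nat \<Rightarrow> 'v) \<Rightarrow> bool" where
  "homogeneous_basis scale V d e \<longleftrightarrow>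
     inj_on e {..<d} \<and> \<not> module.dependent scale (e ` {..<d}) \<and>
     module.span scale (e ` {..<d}) = UNIV \<and> (\<forall>i<d. \<exists>p. e i \<in> V p)"

text \<open>The degree of a nonzero homogeneous element.\<close>

definition degree_of :: "(bit \<Rightarrow> 'x set) \<Rightarrow> 'x \<Rightarrow> bit" where
  "degree_of G x = (THE p. x \<in> G p)"

definition grade_proj :: "(bit \<Rightarrow> 'x::ab_group_add set) \<Rightarrow> bit \<Rightarrow> 'x \<Rightarrow> 'x" where
  "grade_proj G p x = (THE u. u \<in> G p \<and> x - u \<in> G (p + 1))"

text \<open>\<open>sign_twist G p\<close> is the linear map sending a homogeneous \<open>x\<close> of degree \<open>q\<close> to
  \<open>(-1)^(p q) x\<close>; it carries the signs \<open>(-1)^(p q)\<close> of the sign rule to arguments that are not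
  homogeneous.\<close>

definition sign_twist :: "(complex \<Rightarrow> 'x \<Rightarrow> 'x) \<Rightarrow> (bit \<Rightarrow> 'x::ab_group_add set) \<Rightarrow> bit \<Rightarrow> 'x \<Rightarrow> 'x" where
  "sign_twist sc G p x = (\<Sum>q\<in>{0, 1}. sc (psgn (p * q)) (grade_proj G q x))"

text \<open>The homogeneous component of degree \<open>p\<close> of a linear map from \<open>G\<close> to \<open>H\<close>.\<close>

definition degree_part ::
    "(bit \<Rightarrow> 'x::ab_group_add set) \<Rightarrow> (bit \<Rightarrow> 'y::ab_group_add set) \<Rightarrow> bit \<Rightarrow> ('x \<Rightarrow> 'y) \<Rightarrow> 'x \<Rightarrow> 'y" where
  "degree_part G H p f x = (\<Sum>q\<in>{0, 1}. grade_proj H (p + q) (f (grade_proj G q x)))"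

text \<open>The Lie superalgebra of the form; an endomorphism belongs to it iff both of its homogeneous
  components satisfy the defining condition.\<close>

definition form_lie_algebra ::
    "(complex \<Rightarrow> 'v::ab_group_add \<Rightarrow> 'v) \<Rightarrow> (bit \<Rightarrow> 'v set) \<Rightarrow> ('v \<Rightarrow> 'v \<Rightarrow> complex) \<Rightarrow> ('v \<Rightarrow> 'v) set" where
  "form_lie_algebra scale V b =
     {A. Vector_Spaces.linear scale scale A \<and>
         (\<forall>p q. \<forall>x\<in>V q. \<forall>y.
            b (degree_part V V p A x) y + psgn (p * q) * b x (degree_part V V p A y) = 0)}"


section \<open>Tensor powers\<close>

text \<open>The tensor \<open>v\<^sub>1 \<otimes> \<dots> \<otimes> v\<^sub>r\<close> is realised as evaluation of \<open>r\<close>-linear forms at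
  \<open>(v\<^sub>1, \<dots>, v\<^sub>r)\<close>, and the tensor power as the span of these evaluations.  This is the tensor power
  because multilinear forms separate its points.  The value on functions that are not \<open>r\<close>-linear
  is fixed to be 0.  The scalars of the zeroth power are the multiples of \<open>pure scale []\<close>.\<close>

type_synonym 'v tensor = "('v list \<Rightarrow> complex) \<Rightarrow> complex"

definition multilinear_form ::
    "(complex \<Rightarrow> 'v::ab_group_add \<Rightarrow> 'v) \<Rightarrow> nat \<Rightarrow> ('v list \<Rightarrow> complex) \<Rightarrow> bool" where
  "multilinear_form scale r \<phi> \<longleftrightarrow>
     (\<forall>vs. length vs = r \<longrightarrow> (\<forall>i<r. Vector_Spaces.linear scale (*) (\<lambda>x. \<phi> (vs[i := x]))))"

definition pure :: "(complex \<Rightarrow> 'v::ab_group_add \<Rightarrow> 'v) \<Rightarrow> 'v list \<Rightarrow> 'v tensor" where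
  "pure scale vs = (\<lambda>\<phi>. if multilinear_form scale (length vs) \<phi> then \<phi> vs else 0)"

definition tensor_power :: "(complex \<Rightarrow> 'v::ab_group_add \<Rightarrow> 'v) \<Rightarrow> nat \<Rightarrow> 'v tensor set" where
  "tensor_power scale r = cfun.span {pure scale vs | vs. length vs = r}"

definition tensor_grade ::
    "(complex \<Rightarrow> 'v::ab_group_add \<Rightarrow> 'v) \<Rightarrow> (bit \<Rightarrow> 'v set) \<Rightarrow> nat \<Rightarrow> bit \<Rightarrow> 'v tensor set" where
  "tensor_grade scale V r p =
     cfun.span {pure scale vs | vs ps. length vs = r \<and> list_all2 (\<lambda>v q. v \<in> V q) vs ps \<and> sum_list ps = p}"

text \<open>If \<open>h\<close> is a multilinear map on lists of length \<open>r\<close> with tensors as values, then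
  \<open>tensor_lift h\<close> is on the \<open>r\<close>-th tensor power the linear map with
  \<open>tensor_lift h (pure scale vs) = h vs\<close>.\<close>

definition tensor_lift :: "('v list \<Rightarrow> 'v tensor) \<Rightarrow> 'v tensor \<Rightarrow> 'v tensor" where
  "tensor_lift h t = (\<lambda>\<phi>. t (\<lambda>vs. h vs \<phi>))"

definition tensor_mult ::
    "(complex \<Rightarrow> 'v::ab_group_add \<Rightarrow> 'v) \<Rightarrow> 'v tensor \<Rightarrow> 'v tensor \<Rightarrow> 'v tensor" where
  "tensor_mult scale t u = tensor_lift (\<lambda>vs. tensor_lift (\<lambda>ws. pure scale (vs @ ws)) u) t"

text \<open>The left action of an endomorphism \<open>A\<close> of \<open>V\<close>, by superderivations: for \<open>A\<close> homogeneous,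
  \<open>A. (v\<^sub>1 \<otimes> \<dots> \<otimes> v\<^sub>r)\<close> is the sum over \<open>i\<close> of
  \<open>(-1)^(deg A (deg v\<^sub>1 + \<dots> + deg v\<^sub>i\<^sub>-\<^sub>1)) v\<^sub>1 \<otimes> \<dots> \<otimes> A v\<^sub>i \<otimes> \<dots> \<otimes> v\<^sub>r\<close>.\<close>

definition tensor_action ::
    "(complex \<Rightarrow> 'v::ab_group_add \<Rightarrow> 'v) \<Rightarrow> (bit \<Rightarrow> 'v set) \<Rightarrow> nat \<Rightarrow> ('v \<Rightarrow> 'v) \<Rightarrow> 'v tensor \<Rightarrow> 'v tensor" where
  "tensor_action scale V r A =
     tensor_lift (\<lambda>vs. \<Sum>p\<in>{0, 1}. \<Sum>i<r.
       pure scale (map (sign_twist scale V p) (take i vs) @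
                   degree_part V V p A (vs ! i) # drop (Suc i) vs))"

text \<open>Linear maps between tensor powers are total functions, made unique by the value 0 outside
  their domain, so that equality of maps is equality of functions.\<close>

definition tensor_Hom ::
    "(complex \<Rightarrow> 'v::ab_group_add \<Rightarrow> 'v) \<Rightarrow> nat \<Rightarrow> nat \<Rightarrow> ('v tensor \<Rightarrow> 'v tensor) set" where
  "tensor_Hom scale r s =
     {f. (\<forall>t\<in>tensor_power scale r. f t \<in> tensor_power scale s) \<and>
         (\<forall>t. t \<notin> tensor_power scale r \<longrightarrow> f t = 0) \<and>
         (\<forall>t\<in>tensor_power scale r. \<forall>u\<in>tensor_power scale r. f (t + u) = f t + f u) \<and>
         (\<forall>c. \<forall>t\<in>tensor_power scale r. f (fscale c t) = fscale c (f t))}"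

definition equivariant_Hom ::
    "(complex \<Rightarrow> 'v::ab_group_add \<Rightarrow> 'v) \<Rightarrow> (bit \<Rightarrow> 'v set) \<Rightarrow> ('v \<Rightarrow> 'v \<Rightarrow> complex) \<Rightarrow> nat \<Rightarrow> nat
       \<Rightarrow> ('v tensor \<Rightarrow> 'v tensor) set" where
  "equivariant_Hom scale V b r s =
     {f \<in> tensor_Hom scale r s.
        \<forall>A\<in>form_lie_algebra scale V b. \<forall>t\<in>tensor_power scale r.
          f (tensor_action scale V r A t) = tensor_action scale V s A (f t)}"

text \<open>\<open>f \<otimes> g\<close> for \<open>f\<close> from \<open>V\<^sup>\<otimes>\<^sup>r\<close> to \<open>V\<^sup>\<otimes>\<^sup>s\<close> and \<open>g\<close> defined on \<open>V\<^sup>\<otimes>\<^sup>r\<^sup>'\<close>: it sends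
  \<open>v \<otimes> w\<close> to \<open>(-1)^(deg f deg w) (v)f \<otimes> (w)g\<close>.\<close>

definition tensor_map ::
    "(complex \<Rightarrow> 'v::ab_group_add \<Rightarrow> 'v) \<Rightarrow> (bit \<Rightarrow> 'v set) \<Rightarrow> nat \<Rightarrow> nat \<Rightarrow> nat
       \<Rightarrow> ('v tensor \<Rightarrow> 'v tensor) \<Rightarrow> ('v tensor \<Rightarrow> 'v tensor) \<Rightarrow> 'v tensor \<Rightarrow> 'v tensor" where
  "tensor_map scale V r s r' f g t =
     (if t \<in> tensor_power scale (r + r') then
        tensor_lift (\<lambda>us. \<Sum>p\<in>{0, 1}.
          tensor_mult scale
            (degree_part (tensor_grade scale V r) (tensor_grade scale V s) p f (pure scale (take r us)))
            (g (sign_twist fscale (tensor_grade scale V r') p (pure scale (drop r us))))) t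
      else 0)"


section \<open>Marked Brauer diagrams\<close>

text \<open>Vertices are numbered from 0, from left to right.  The row \<open>Mid\<close> occurs only while two
  diagrams are being composed.\<close>

datatype vertex = Top nat | Mid nat | Bot nat

definition vertices :: "nat \<Rightarrow> nat \<Rightarrow> vertex set" where
  "vertices r s = Top ` {..<r} \<union> Bot ` {..<s}"

definition brauer_diagram :: "nat \<Rightarrow> nat \<Rightarrow> vertex set set \<Rightarrow> bool" where
  "brauer_diagram r s E \<longleftrightarrow> partition_on (vertices r s) E \<and> (\<forall>e\<in>E. card e = 2)"

definition cups :: "vertex set set \<Rightarrow> vertex set set" where
  "cups E = {e \<in> E. e \<subseteq> range Top}"

definition caps :: "vertex set set \<Rightarrow> vertex set set" where
  "caps E = {e \<in> E. e \<subseteq> range Bot}"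

text \<open>\<open>ArrowOn u w\<close> is an arrow on the edge \<open>{u, w}\<close> pointing toward \<open>w\<close>.\<close>

datatype marking = BeadOn "vertex set" | ArrowOn vertex vertex

fun marked_edge :: "marking \<Rightarrow> vertex set" where
  "marked_edge (BeadOn e) = e"
| "marked_edge (ArrowOn u w) = {u, w}"

text \<open>A marked diagram is a set of edges with the list of all its markings from top to bottom.\<close>

type_synonym mdiagram = "vertex set set \<times> marking list"

definition marked_diagrams :: "nat \<Rightarrow> nat \<Rightarrow> mdiagram set" where
  "marked_diagrams r s =
     {(E, ms). brauer_diagram r s E \<and>
        distinct (map marked_edge ms) \<and>
        {e. BeadOn e \<in> set ms} = cups E \<and>
        {{u, w} | u w. ArrowOn u w \<in> set ms} = caps E}"

definition single :: "'a \<Rightarrow> 'a \<Rightarrow> complex" where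
  "single D = (\<lambda>D'. if D' = D then 1 else 0)"

definition diagram_span :: "nat \<Rightarrow> nat \<Rightarrow> (mdiagram \<Rightarrow> complex) set" where
  "diagram_span r s = cfun.span (single ` marked_diagrams r s)"

definition diagram_relations :: "complex \<Rightarrow> nat \<Rightarrow> nat \<Rightarrow> (mdiagram \<Rightarrow> complex) set" where
  "diagram_relations \<epsilon> r s = cfun.span
     ({single (E, xs @ [y, x] @ ys) - fscale \<epsilon> (single (E, xs @ [x, y] @ ys)) | E xs x y ys.
         (E, xs @ [x, y] @ ys) \<in> marked_diagrams r s} \<union>
      {single (E, xs @ [ArrowOn w u] @ ys) - fscale \<epsilon> (single (E, xs @ [ArrowOn u w] @ ys)) | E xs u w ys.
         (E, xs @ [ArrowOn u w] @ ys) \<in> marked_diagrams r s})"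

text \<open>The space \<open>B\<^sub>r\<^sub>,\<^sub>s(\<delta>, \<epsilon>)\<close> is the quotient of \<open>diagram_span r s\<close> by \<open>diagram_relations \<epsilon> r s\<close>,
  as a set of cosets.  The parameter \<open>\<delta>\<close> enters only into the composition.\<close>

definition brauer_class :: "complex \<Rightarrow> nat \<Rightarrow> nat \<Rightarrow> (mdiagram \<Rightarrow> complex) \<Rightarrow> (mdiagram \<Rightarrow> complex) set" where
  "brauer_class \<epsilon> r s x = {y \<in> diagram_span r s. y - x \<in> diagram_relations \<epsilon> r s}"

definition brauer_space :: "complex \<Rightarrow> nat \<Rightarrow> nat \<Rightarrow> (mdiagram \<Rightarrow> complex) set set" where
  "brauer_space \<epsilon> r s = brauer_class \<epsilon> r s ` diagram_span r s"

definition diagram_class :: "complex \<Rightarrow> nat \<Rightarrow> nat \<Rightarrow> mdiagram \<Rightarrow> (mdiagram \<Rightarrow> complex) set" where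
  "diagram_class \<epsilon> r s D = brauer_class \<epsilon> r s (single D)"

definition id_diagram :: "nat \<Rightarrow> mdiagram" where
  "id_diagram r = ((\<lambda>i. {Top i, Bot i}) ` {..<r}, [])"

definition cross_diagram :: mdiagram where
  "cross_diagram = ({{Top 0, Bot 1}, {Top 1, Bot 0}}, [])"

definition cup_diagram :: mdiagram where
  "cup_diagram = ({{Top 0, Top 1}}, [BeadOn {Top 0, Top 1}])"

definition cap_diagram :: mdiagram where
  "cap_diagram = ({{Bot 0, Bot 1}}, [ArrowOn (Bot 0) (Bot 1)])"

fun shift_vertex :: "nat \<Rightarrow> nat \<Rightarrow> vertex \<Rightarrow> vertex" where
  "shift_vertex r s (Top i) = Top (r + i)"
| "shift_vertex r s (Mid i) = Mid i"
| "shift_vertex r s (Bot i) = Bot (s + i)"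

fun shift_marking :: "nat \<Rightarrow> nat \<Rightarrow> marking \<Rightarrow> marking" where
  "shift_marking r s (BeadOn e) = BeadOn (shift_vertex r s ` e)"
| "shift_marking r s (ArrowOn u w) = ArrowOn (shift_vertex r s u) (shift_vertex r s w)"

definition tensor_diagram :: "nat \<Rightarrow> nat \<Rightarrow> mdiagram \<Rightarrow> mdiagram \<Rightarrow> mdiagram" where
  "tensor_diagram r s D\<^sub>1 D\<^sub>2 =
     (fst D\<^sub>1 \<union> (`) (shift_vertex r s) ` fst D\<^sub>2, snd D\<^sub>1 @ map (shift_marking r s) (snd D\<^sub>2))"


subsection \<open>Composition\<close>

text \<open>Stacked diagrams are described by strands: a strand \<open>(u, xs, w)\<close> runs from \<open>u\<close> to \<open>w\<close> and
  meets the marks \<open>xs\<close> in this order.  Each mark has a height, and heights increase from top to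
  bottom: a mark is above another one iff its height is the smaller number.  \<open>Arrow h True\<close> points
  in the direction of travel from \<open>u\<close> to \<open>w\<close>, \<open>Arrow h False\<close> points against it.\<close>

datatype 'h mark = Bead 'h | Arrow 'h bool

type_synonym strand = "vertex \<times> nat mark list \<times> vertex"

fun flip_mark :: "'h mark \<Rightarrow> 'h mark" where
  "flip_mark (Bead h) = Bead h"
| "flip_mark (Arrow h d) = Arrow h (\<not> d)"

definition heights :: "strand multiset \<Rightarrow> nat set" where
  "heights P = (\<Union>(u, xs, w)\<in>set_mset P. \<Union>x\<in>set xs. set_mark x)"

definition adjacent_heights :: "strand multiset \<Rightarrow> nat \<Rightarrow> nat \<Rightarrow> bool" where
  "adjacent_heights P h k \<longleftrightarrow>
     h \<in> heights P \<and> k \<in> heights P \<and> h \<noteq> k \<and>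
     (\<forall>j\<in>heights P. \<not> (min h k < j \<and> j < max h k))"

definition relabel_heights :: "(nat \<Rightarrow> nat) \<Rightarrow> strand multiset \<Rightarrow> strand multiset" where
  "relabel_heights f P = image_mset (\<lambda>(u, xs, w). (u, map (map_mark f) xs, w)) P"

text \<open>\<open>simplify_step \<delta> \<epsilon> P c Q\<close>: the picture \<open>P\<close> equals \<open>c\<close> times the picture \<open>Q\<close>.  The rules
  \<open>reverse\<close> and \<open>join\<close> only change the description: a strand may be read from either end, and two
  strands meeting at a middle vertex form one strand.  In the cancellation rules the coefficient is
  1 if the upper one of the two marks is an arrow pointing toward the bead, or is a bead and the
  arrow points away from it.\<close>

inductive simplify_step ::
    "complex \<Rightarrow> complex \<Rightarrow> strand multiset \<Rightarrow> complex \<Rightarrow> strand multiset \<Rightarrow> bool" for \<delta> \<epsilon> where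
  reverse: "simplify_step \<delta> \<epsilon> (add_mset (u, xs, w) P) 1 (add_mset (w, rev (map flip_mark xs), u) P)"
| join: "simplify_step \<delta> \<epsilon> (add_mset (u, xs, Mid i) (add_mset (Mid i, ys, w) P)) 1
           (add_mset (u, xs @ ys, w) P)"
| loop: "simplify_step \<delta> \<epsilon> (add_mset (Mid i, xs, Mid i) P) \<delta> P"
| swap: "adjacent_heights P h k \<Longrightarrow> simplify_step \<delta> \<epsilon> P \<epsilon> (relabel_heights (id(h := k, k := h)) P)"
| cancel_arrow_bead:
    "adjacent_heights (add_mset (u, xs @ [Arrow h d, Bead k] @ ys, w) P) h k \<Longrightarrow>
     simplify_step \<delta> \<epsilon> (add_mset (u, xs @ [Arrow h d, Bead k] @ ys, w) P)
       (if h < k \<and> d \<or> k < h \<and> \<not> d then 1 else \<epsilon>) (add_mset (u, xs @ ys, w) P)"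
| cancel_bead_arrow:
    "adjacent_heights (add_mset (u, xs @ [Bead k, Arrow h d] @ ys, w) P) h k \<Longrightarrow>
     simplify_step \<delta> \<epsilon> (add_mset (u, xs @ [Bead k, Arrow h d] @ ys, w) P)
       (if h < k \<and> \<not> d \<or> k < h \<and> d then 1 else \<epsilon>) (add_mset (u, xs @ ys, w) P)"

inductive simplifies ::
    "complex \<Rightarrow> complex \<Rightarrow> strand multiset \<Rightarrow> complex \<Rightarrow> strand multiset \<Rightarrow> bool" for \<delta> \<epsilon> where
  refl: "simplifies \<delta> \<epsilon> P 1 P"
| step: "simplify_step \<delta> \<epsilon> P c Q \<Longrightarrow> simplifies \<delta> \<epsilon> Q c' R \<Longrightarrow> simplifies \<delta> \<epsilon> P (c * c') R"

text \<open>The marks on the edge \<open>{u, w}\<close> when it is read from \<open>u\<close> to \<open>w\<close>, where \<open>h\<close> is the height of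
  the given marking.\<close>

fun edge_marks :: "vertex \<Rightarrow> vertex \<Rightarrow> nat \<Rightarrow> marking \<Rightarrow> nat mark list" where
  "edge_marks u w h (BeadOn e) = (if e = {u, w} then [Bead h] else [])"
| "edge_marks u w h (ArrowOn x y) =
     (if x = u \<and> y = w then [Arrow h True] else if x = w \<and> y = u then [Arrow h False] else [])"

text \<open>\<open>P\<close> consists of the edges of the marked diagram \<open>(E, ms)\<close>, each read in some direction, with
  the \<open>i\<close>-th marking at height \<open>ht i\<close>.\<close>

definition depicts :: "(nat \<Rightarrow> nat) \<Rightarrow> mdiagram \<Rightarrow> strand multiset \<Rightarrow> bool" where
  "depicts ht D P \<longleftrightarrow> strict_mono ht \<and>
     image_mset (\<lambda>(u, xs, w). {u, w}) P = mset_set (fst D) \<and>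
     (\<forall>(u, xs, w)\<in>set_mset P.
        xs = concat (map (\<lambda>i. edge_marks u w (ht i) (snd D ! i)) [0..<length (snd D)]))"

fun bottom_to_middle :: "vertex \<Rightarrow> vertex" where
  "bottom_to_middle (Bot i) = Mid i"
| "bottom_to_middle v = v"

fun top_to_middle :: "vertex \<Rightarrow> vertex" where
  "top_to_middle (Top i) = Mid i"
| "top_to_middle v = v"

definition rename_ends :: "(vertex \<Rightarrow> vertex) \<Rightarrow> strand multiset \<Rightarrow> strand multiset" where
  "rename_ends f P = image_mset (\<lambda>(u, xs, w). (f u, xs, f w)) P"

text \<open>\<open>composition_yields \<delta> \<epsilon> D\<^sub>1 D\<^sub>2 c D\<close>: stacking \<open>D\<^sub>1\<close> above \<open>D\<^sub>2\<close> and simplifying gives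
  \<open>D\<^sub>1 \<circ> D\<^sub>2 = c D\<close>.\<close>

definition composition_yields ::
    "complex \<Rightarrow> complex \<Rightarrow> mdiagram \<Rightarrow> mdiagram \<Rightarrow> complex \<Rightarrow> mdiagram \<Rightarrow> bool" where
  "composition_yields \<delta> \<epsilon> D\<^sub>1 D\<^sub>2 c D \<longleftrightarrow>
     (\<exists>P\<^sub>1 P\<^sub>2 ht Q. depicts id D\<^sub>1 P\<^sub>1 \<and> depicts (\<lambda>i. length (snd D\<^sub>1) + i) D\<^sub>2 P\<^sub>2 \<and>
        simplifies \<delta> \<epsilon> (rename_ends bottom_to_middle P\<^sub>1 + rename_ends top_to_middle P\<^sub>2) c Q \<and>
        depicts ht D Q)"


section \<open>The functor\<close>

text \<open>The defining properties of the family of maps \<open>F\<close>, for a homogeneous basis \<open>e\<close> with dual basis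
  \<open>e'\<close>.  By linearity it is enough to demand the compatibility with composition and with tensor
  products on diagrams.  Composition is read left to right, so \<open>D\<^sub>1 \<circ> D\<^sub>2\<close> goes to
  \<open>F D\<^sub>1\<close> followed by \<open>F D\<^sub>2\<close>.\<close>

definition brauer_functor ::
    "(complex \<Rightarrow> 'v::ab_group_add \<Rightarrow> 'v) \<Rightarrow> (bit \<Rightarrow> 'v set) \<Rightarrow> ('v \<Rightarrow> 'v \<Rightarrow> complex)
       \<Rightarrow> complex \<Rightarrow> complex \<Rightarrow> nat \<Rightarrow> (nat \<Rightarrow> 'v) \<Rightarrow> (nat \<Rightarrow> 'v)
       \<Rightarrow> (nat \<Rightarrow> nat \<Rightarrow> (mdiagram \<Rightarrow> complex) set \<Rightarrow> 'v tensor \<Rightarrow> 'v tensor) \<Rightarrow> bool" where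
  "brauer_functor scale V b \<delta> \<epsilon> d e e' F \<longleftrightarrow>
     (\<forall>r s. F r s ` brauer_space \<epsilon> r s \<subseteq> equivariant_Hom scale V b r s) \<and>
     (\<forall>r s. \<forall>x\<in>diagram_span r s. \<forall>y\<in>diagram_span r s. \<forall>a c t.
        F r s (brauer_class \<epsilon> r s (fscale a x + fscale c y)) t =
          fscale a (F r s (brauer_class \<epsilon> r s x) t) + fscale c (F r s (brauer_class \<epsilon> r s y) t)) \<and>
     (\<forall>r s u. \<forall>D\<^sub>1\<in>marked_diagrams r s. \<forall>D\<^sub>2\<in>marked_diagrams s u. \<forall>D\<in>marked_diagrams r u. \<forall>c.
        composition_yields \<delta> \<epsilon> D\<^sub>1 D\<^sub>2 c D \<longrightarrow>
        (\<forall>t. F s u (diagram_class \<epsilon> s u D\<^sub>2) (F r s (diagram_class \<epsilon> r s D\<^sub>1) t) =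
             fscale c (F r u (diagram_class \<epsilon> r u D) t))) \<and>
     (\<forall>r s r' s'. \<forall>D\<^sub>1\<in>marked_diagrams r s. \<forall>D\<^sub>2\<in>marked_diagrams r' s'.
        F (r + r') (s + s') (diagram_class \<epsilon> (r + r') (s + s') (tensor_diagram r s D\<^sub>1 D\<^sub>2)) =
          tensor_map scale V r s r' (F r s (diagram_class \<epsilon> r s D\<^sub>1))
            (F r' s' (diagram_class \<epsilon> r' s' D\<^sub>2))) \<and>
     (\<forall>r. \<forall>t\<in>tensor_power scale r. F r r (diagram_class \<epsilon> r r (id_diagram r)) t = t) \<and>
     (\<forall>p q. \<forall>v\<in>V p. \<forall>w\<in>V q.
        F 2 2 (diagram_class \<epsilon> 2 2 cross_diagram) (pure scale [v, w]) =
          fscale (psgn (p * q)) (pure scale [w, v])) \<and>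
     (\<forall>v w. F 2 0 (diagram_class \<epsilon> 2 0 cup_diagram) (pure scale [v, w]) =
        fscale (b v w) (pure scale [])) \<and>
     F 0 2 (diagram_class \<epsilon> 0 2 cap_diagram) (pure scale []) =
       (\<Sum>i<d. fscale (psgn (degree_of V (e i))) (pure scale [e i, e' i]))"

end

theory Submission
  imports Defs
begin

text \<open>Up to sign a marked diagram is determined by its Brauer diagram.  Evaluate \<open>F E\<close> on a tensor
  \<open>v\<^sub>1 \<otimes> \<dots> \<otimes> v\<^sub>r\<close> of homogeneous vectors and then on the form
  \<open>b _ w\<^sub>1 \<cdots> b _ w\<^sub>s\<close>: the result is, up to sign, the product over the edges of \<open>E\<close> of \<open>b\<close> applied
  to the vectors at the two endpoints.  This is proved by induction on \<open>r + s\<close>: adjacent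
  transpositions move an edge to the left end, where it splits off as a tensor factor.  Whenever
  \<open>2 N \<le> m + n\<close> there are \<open>N\<close> mutually orthogonal pairs of homogeneous vectors whose members pair
  nontrivially with each other.  Placing them at the endpoints of the edges of a diagram \<open>E\<^sub>0\<close>
  gives test vectors on which exactly \<open>E\<^sub>0\<close> does not vanish.\<close>

section \<open>Graded spaces\<close>

text \<open>Only vanishing is tracked. For linear independence it is enough that for every E0 some
  evaluation kills the images of all diagrams except E0; the nonzero value left over may be
  anything. This also absorbs the markings: reordering them or turning an arrow multiplies a diagram
  by a power of \<epsilon>, which is 1 or -1, so the space of diagrams is spanned by one marked
  diagram for each Brauer diagram. The obstacle is that composition is defined by rewriting pictures
  made of strands, so each composite used needs an explicit derivation. Diagrams are therefore
  composed with permutation diagrams only, where no loop arises, no marks cancel and the coefficient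
  is 1. Everything else is done with tensor products, whose diagrams are given by a formula; the
  factors split off are a single cup, cap or through string, on which F is prescribed. The bound
  comes from counting: a diagram with N edges has r + s = 2 N ends, and N orthogonal pairs span at
  most 2 N dimensions, so another pair can be chosen as long as there is room in dimension m +
  n.\<close>

lemma psgn_0 [simp]: "psgn 0 = 1" and psgn_1 [simp]: "psgn 1 = -1"
  by (simp_all add: psgn_def)

lemma psgn_square [simp]: "psgn p * psgn p = 1"
  by (simp add: psgn_def)

lemma psgn_nonzero [simp]: "psgn p \<noteq> 0"
  by (simp add: psgn_def)

context vector_space
begin

text \<open>\<open>grade_proj\<close> is a definite description. Two candidates for its value differ
  by a vector lying in both components, hence by zero.\<close>

lemma grade_projI:
  assumes G: "\<And>p. subspace (G p)" and disj: "G 0 \<inter> G 1 = {0}"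
    and u: "u \<in> G p" and xu: "x - u \<in> G (p + 1)"
  shows "grade_proj G p x = u"
  unfolding grade_proj_def
proof (rule the_equality)
  fix u' assume u': "u' \<in> G p \<and> x - u' \<in> G (p + 1)"
  have "u' - u \<in> G p"
    using subspace_diff[OF G] u u' by blast
  moreover have "(x - u) - (x - u') \<in> G (p + 1)"
    using subspace_diff[OF G] xu u' by blast
  hence "u' - u \<in> G (p + 1)" by (simp add: algebra_simps)
  ultimately have "u' - u \<in> G 0 \<inter> G 1"
    by (cases p) auto
  thus "u' = u" using disj by auto
qed (use u xu in auto)

lemma grade_proj_graded:
  assumes G: "\<And>p. subspace (G p)" and disj: "G 0 \<inter> G 1 = {0}" and x: "x \<in> G q"
  shows "grade_proj G p x = (if p = q then x else 0)"
proof (cases "p = q")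
  case True
  thus ?thesis using x by (auto intro!: grade_projI[where G = G, OF G disj] simp: subspace_0[OF G])
next
  case False
  hence "p + 1 = q" by (cases p; cases q) auto
  thus ?thesis using x False
    by (auto intro!: grade_projI[where G = G, OF G disj] simp del: add_bit_eq_xor simp: subspace_0[OF G])
qed

end

text \<open>The carrier \<open>W\<close> is kept apart from the type: \<open>V\<close> fills its
  type, whereas a tensor power is only a subspace of the type of tensors. Both become
  instances.\<close>

locale graded_space = vector_space scale
  for scale :: "complex \<Rightarrow> 'x::ab_group_add \<Rightarrow> 'x" +
  fixes G :: "bit \<Rightarrow> 'x set" and W :: "'x set"
  assumes grade_subspace: "subspace (G p)"
    and grades_disjoint: "G 0 \<inter> G 1 = {0}"
    and grades_sum: "x \<in> W \<Longrightarrow> \<exists>u\<in>G 0. \<exists>v\<in>G 1. x = u + v"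
    and grade_subset: "G p \<subseteq> W"
    and total_subspace: "subspace W"
begin

lemmas proj_graded = grade_proj_graded[where G = G, OF grade_subspace grades_disjoint]
lemmas projI = grade_projI[where G = G, OF grade_subspace grades_disjoint]

lemma twist_graded: "x \<in> G q \<Longrightarrow> sign_twist scale G p x = scale (psgn (p * q)) x"
  unfolding sign_twist_def by (cases p; cases q) (simp_all add: proj_graded)

lemma zero_graded [simp]: "0 \<in> G p"
  by (rule subspace_0[OF grade_subspace])

lemma proj_mem:
  assumes "x \<in> W"
  shows "grade_proj G p x \<in> G p" and "x - grade_proj G p x \<in> G (p + 1)"
proof -
  obtain u v where uv: "u \<in> G 0" "v \<in> G 1" "x = u + v" using grades_sum[OF assms] by blast
  have "\<exists>w. w \<in> G p \<and> x - w \<in> G (p + 1)"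
  proof (cases p)
    case zero
    thus ?thesis using uv by (intro exI[of _ u]) auto
  next
    case one
    thus ?thesis using uv by (intro exI[of _ v]) auto
  qed
  then obtain w where w: "w \<in> G p" "x - w \<in> G (p + 1)" by blast
  hence "grade_proj G p x = w" by (rule projI)
  with w show "grade_proj G p x \<in> G p" and "x - grade_proj G p x \<in> G (p + 1)" by simp_all
qed

lemma proj_total: "x \<in> W \<Longrightarrow> grade_proj G p x \<in> W"
  using proj_mem(1) grade_subset by blast

lemma proj_add:
  assumes "x \<in> W" "y \<in> W"
  shows "grade_proj G p (x + y) = grade_proj G p x + grade_proj G p y"
proof (rule projI)
  show "grade_proj G p x + grade_proj G p y \<in> G p"
    using assms by (intro subspace_add[OF grade_subspace] proj_mem)
  have "(x - grade_proj G p x) + (y - grade_proj G p y) \<in> G (p + 1)"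
    using assms by (intro subspace_add[OF grade_subspace] proj_mem)
  thus "x + y - (grade_proj G p x + grade_proj G p y) \<in> G (p + 1)"
    by (simp only: diff_conv_add_uminus minus_add_distrib add.assoc add.left_commute)
qed

lemma proj_scale:
  assumes "x \<in> W"
  shows "grade_proj G p (scale c x) = scale c (grade_proj G p x)"
proof (rule projI)
  show "scale c (grade_proj G p x) \<in> G p"
    using assms by (intro subspace_scale[OF grade_subspace] proj_mem)
  have "scale c (x - grade_proj G p x) \<in> G (p + 1)"
    using assms by (intro subspace_scale[OF grade_subspace] proj_mem)
  thus "scale c x - scale c (grade_proj G p x) \<in> G (p + 1)"
    by (simp only: scale_right_diff_distrib)
qed

lemma proj_sum: "x \<in> W \<Longrightarrow> x = grade_proj G 0 x + grade_proj G 1 x"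
proof -
  assume x: "x \<in> W"
  have "grade_proj G 1 x = x - grade_proj G 0 x"
    using proj_mem[OF x, of 0] by (intro projI) auto
  thus ?thesis by simp
qed

lemma twist_add:
  assumes "x \<in> W" "y \<in> W"
  shows "sign_twist scale G p (x + y) = sign_twist scale G p x + sign_twist scale G p y"
  using assms by (simp add: sign_twist_def proj_add scale_right_distrib algebra_simps)

lemma twist_scale:
  assumes "x \<in> W"
  shows "sign_twist scale G p (scale c x) = scale c (sign_twist scale G p x)"
  using assms by (simp add: sign_twist_def proj_scale scale_right_distrib algebra_simps)

lemma twist_total: "x \<in> W \<Longrightarrow> sign_twist scale G p x \<in> W"
  unfolding sign_twist_def
  by (intro subspace_sum[OF total_subspace] subspace_scale[OF total_subspace] proj_total)

end

section \<open>Tensor powers\<close>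

lemma fscale_0_right [simp]: "fscale c 0 = 0" and fscale_0_left [simp]: "fscale 0 t = 0" and fscale_1 [simp]: "fscale 1 t = t"
  and fscale_fscale [simp]: "fscale a (fscale c t) = fscale (a * c) t"
  by (simp_all add: fscale_def fun_eq_iff)

lemma fscale_apply: "fscale c t x = c * t x"
  by (simp add: fscale_def)

context superspace
begin

lemma field_vector_space: "vector_space ((*) :: complex \<Rightarrow> complex \<Rightarrow> complex)"
  by standard (auto simp: algebra_simps)

lemma linear_form_iff:
  "Vector_Spaces.linear scale (*) f \<longleftrightarrow>
     (\<forall>x y. f (x + y) = f x + f y) \<and> (\<forall>c x. f (scale c x) = c * f x)"
  by (simp add: Vector_Spaces.linear_iff field_vector_space vector_space_axioms)

sublocale V: graded_space scale V UNIV
  by standard (auto intro: component_subspace simp: components_disjoint components_sum)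

abbreviation mform where "mform \<equiv> multilinear_form scale"
abbreviation T where "T \<equiv> tensor_power scale"
abbreviation G where "G \<equiv> tensor_grade scale V"
abbreviation pur where "pur \<equiv> pure scale"

lemma mform_iff:
  "mform r \<phi> \<longleftrightarrow> (\<forall>vs i. length vs = r \<longrightarrow> i < r \<longrightarrow>
     (\<forall>x y. \<phi> (vs[i := x + y]) = \<phi> (vs[i := x]) + \<phi> (vs[i := y])) \<and>
     (\<forall>c x. \<phi> (vs[i := scale c x]) = c * \<phi> (vs[i := x])))"
  unfolding multilinear_form_def linear_form_iff by blast

lemma mform_cong:
  assumes "\<And>vs. length vs = r \<Longrightarrow> \<phi> vs = \<psi> vs"
  shows "mform r \<phi> \<longleftrightarrow> mform r \<psi>"
  unfolding mform_iff using assms by simp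

lemma mform_lincomb:
  assumes "mform r \<phi>" "mform r \<psi>"
  shows "mform r (\<lambda>vs. a * \<phi> vs + c * \<psi> vs)"
  using assms unfolding mform_iff by (simp add: algebra_simps)

lemma pure_mform: "mform (length vs) \<phi> \<Longrightarrow> pur vs \<phi> = \<phi> vs"
  by (simp add: pure_def)

lemma pure_add: "i < length vs \<Longrightarrow> pur (vs[i := x + y]) = pur (vs[i := x]) + pur (vs[i := y])"
  by (auto simp: pure_def fun_eq_iff mform_iff)

lemma pure_scale: "i < length vs \<Longrightarrow> pur (vs[i := scale c x]) = fscale c (pur (vs[i := x]))"
  by (auto simp: pure_def fun_eq_iff mform_iff fscale_def)

lemma pure_in_T [simp]: "length vs = r \<Longrightarrow> pur vs \<in> T r"
  unfolding tensor_power_def by (rule cfun.span_base) auto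

lemma T_subspace: "cfun.subspace (T r)"
  by (simp add: tensor_power_def)

lemma T_0 [simp]: "0 \<in> T r"
  by (rule cfun.subspace_0[OF T_subspace])

lemma T_add [intro]: "t \<in> T r \<Longrightarrow> u \<in> T r \<Longrightarrow> t + u \<in> T r"
  by (rule cfun.subspace_add[OF T_subspace])

lemma T_scale [intro]: "t \<in> T r \<Longrightarrow> fscale c t \<in> T r"
  by (rule cfun.subspace_scale[OF T_subspace])

text \<open>Unlike plain span induction, the step retains \<open>u \<in> T r\<close>, the side
  condition under which maps are known to be additive.\<close>

lemma T_induct [consumes 1, case_names zero step]:
  assumes "t \<in> T r" "P 0"
    and "\<And>c vs u. length vs = r \<Longrightarrow> u \<in> T r \<Longrightarrow> P u \<Longrightarrow> P (fscale c (pur vs) + u)"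
  shows "P t"
proof -
  have "t \<in> cfun.span {pur vs | vs. length vs = r}"
    using assms(1) by (simp add: tensor_power_def)
  hence "t \<in> T r \<and> P t"
  proof (rule cfun.span_induct_alt)
    fix c x y
    assume "x \<in> {pur vs | vs. length vs = r}" and y: "y \<in> T r \<and> P y"
    then obtain vs where "x = pur vs" "length vs = r" by blast
    with y show "fscale c x + y \<in> T r \<and> P (fscale c x + y)"
      using assms(3)[of vs y c] T_add[of "fscale c x" r y] T_scale[of x r c] by simp
  qed (rule conjI[OF T_0 assms(2)])
  thus ?thesis ..
qed

text \<open>Holds for arbitrary functions, multilinear or not: being multilinear of arity
  \<open>r\<close> depends only on lists of length \<open>r\<close>, and a pure tensor is 0 on
  everything else.\<close>

lemma T_cong:
  assumes "t \<in> T r" "\<And>vs. length vs = r \<Longrightarrow> \<phi> vs = \<psi> vs"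
  shows "t \<phi> = t \<psi>"
  using assms(1)
proof (induction rule: T_induct)
  case (step c vs u)
  then show ?case using assms(2) mform_cong[of r \<phi> \<psi>] by (simp add: fscale_def pure_def)
qed simp

text \<open>Multilinearity of both forms matters: a sum of two functions can be multilinear although
  neither summand is, and a tensor sends each such summand to 0.\<close>

lemma T_lincomb:
  assumes "t \<in> T r" "mform r \<phi>" "mform r \<psi>"
  shows "t (\<lambda>vs. a * \<phi> vs + c * \<psi> vs) = a * t \<phi> + c * t \<psi>"
  using assms(1)
proof (induction rule: T_induct)
  case (step k vs u)
  then show ?case using assms(2,3) mform_lincomb[OF assms(2,3), of a c]
    by (simp add: fscale_def pure_def algebra_simps)
qed simp

lemma T_scale_form:
  assumes "t \<in> T r" "mform r \<phi>"
  shows "t (\<lambda>vs. c * \<phi> vs) = c * t \<phi>"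
  using T_lincomb[OF assms assms(2), of c 0] by simp

lemma T_add_form:
  assumes "t \<in> T r" "mform r \<phi>" "mform r \<psi>"
  shows "t (\<lambda>vs. \<phi> vs + \<psi> vs) = t \<phi> + t \<psi>"
  using T_lincomb[OF assms, of 1 1] by simp

text \<open>Stated at each \<phi> separately, because \<open>tensor_lift\<close> feeds exactly the
  function \<open>\<lambda>vs. h vs \<phi>\<close> to a tensor.\<close>

definition multilinear_map :: "nat \<Rightarrow> ('v list \<Rightarrow> 'v tensor) \<Rightarrow> bool" where
  "multilinear_map r h \<longleftrightarrow> (\<forall>\<phi>. mform r (\<lambda>vs. h vs \<phi>))"

lemma multilinear_mapI:
  assumes "\<And>vs i x y. length vs = r \<Longrightarrow> i < r \<Longrightarrow> h (vs[i := x + y]) = h (vs[i := x]) + h (vs[i := y])"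
    and "\<And>vs i c x. length vs = r \<Longrightarrow> i < r \<Longrightarrow> h (vs[i := scale c x]) = fscale c (h (vs[i := x]))"
  shows "multilinear_map r h"
  unfolding multilinear_map_def mform_iff using assms by (simp add: fscale_def)

lemma lift_pure: "multilinear_map r h \<Longrightarrow> length vs = r \<Longrightarrow> tensor_lift h (pur vs) = h vs"
  by (auto simp: tensor_lift_def multilinear_map_def pure_mform)

section \<open>Products of tensors\<close>

lemma append_update: "vs @ ws[i := x] = (vs @ ws)[length vs + i := x]"
  by (simp add: list_update_append)

lemma multilinear_map_pure_append_right: "multilinear_map r (\<lambda>ws. pur (vs @ ws))"
proof (rule multilinear_mapI)
  show "pur (vs @ ws[i := x + y]) = pur (vs @ ws[i := x]) + pur (vs @ ws[i := y])"
    if "length ws = r" "i < r" for ws i x y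
    unfolding append_update by (rule pure_add) (use that in simp)
  show "pur (vs @ ws[i := scale c x]) = fscale c (pur (vs @ ws[i := x]))"
    if "length ws = r" "i < r" for ws i c x
    unfolding append_update by (rule pure_scale) (use that in simp)
qed

lemma multilinear_map_pure_append_left: "multilinear_map r (\<lambda>vs. pur (vs @ ws))"
proof (rule multilinear_mapI)
  have eq: "vs[i := x] @ ws = (vs @ ws)[i := x]" if "length vs = r" "i < r" for vs :: "'v list" and i x
    using that by (simp add: list_update_append)
  show "pur (vs[i := x + y] @ ws) = pur (vs[i := x] @ ws) + pur (vs[i := y] @ ws)"
    if "length vs = r" "i < r" for vs i x y
    unfolding eq[OF that] by (rule pure_add) (use that in simp)
  show "pur (vs[i := scale c x] @ ws) = fscale c (pur (vs[i := x] @ ws))"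
    if "length vs = r" "i < r" for vs i c x
    unfolding eq[OF that] by (rule pure_scale) (use that in simp)
qed

lemma tensor_mult_apply: "tensor_mult scale t u \<phi> = t (\<lambda>vs. u (\<lambda>ws. pur (vs @ ws) \<phi>))"
  by (simp add: tensor_mult_def tensor_lift_def)

lemma tensor_mult_pure: "tensor_mult scale (pur vs) (pur ws) = pur (vs @ ws)"
proof -
  have "tensor_lift (\<lambda>ws. pur (us @ ws)) (pur ws) = pur (us @ ws)" for us
    by (rule lift_pure[OF multilinear_map_pure_append_right HOL.refl])
  thus ?thesis
    using lift_pure[OF multilinear_map_pure_append_left HOL.refl, of ws vs] by (simp add: tensor_mult_def)
qed

text \<open>Makes the inner function of \<open>tensor_mult_apply\<close> a multilinear form, on
  which the outer tensor is known to act linearly.\<close>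

lemma mform_pure_append:
  assumes "u \<in> T s"
  shows "mform r (\<lambda>vs. u (\<lambda>ws. pur (vs @ ws) \<phi>))"
  using assms
proof (induction rule: T_induct)
  case zero
  show ?case by (simp add: mform_iff)
next
  case (step c ws u)
  have "mform s (\<lambda>ws. pur (vs @ ws) \<phi>)" for vs
    using multilinear_map_pure_append_right by (simp add: multilinear_map_def)
  moreover have "mform r (\<lambda>vs. pur (vs @ ws) \<phi>)"
    using multilinear_map_pure_append_left by (simp add: multilinear_map_def)
  ultimately show ?case
    using step mform_lincomb[of r "\<lambda>vs. pur (vs @ ws) \<phi>" _ c 1]
    by (simp add: fscale_def pure_mform)
qed

lemma tensor_mult_add_left:
  "tensor_mult scale (t + t') u = tensor_mult scale t u + tensor_mult scale t' u"
  by (simp add: fun_eq_iff tensor_mult_apply)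

lemma tensor_mult_scale_left: "tensor_mult scale (fscale c t) u = fscale c (tensor_mult scale t u)"
  by (simp add: fun_eq_iff tensor_mult_apply fscale_def)

lemma tensor_mult_0_left [simp]: "tensor_mult scale 0 u = 0"
  by (simp add: fun_eq_iff tensor_mult_apply)

lemma tensor_mult_add_right:
  assumes "t \<in> T r" "u \<in> T s" "u' \<in> T s"
  shows "tensor_mult scale t (u + u') = tensor_mult scale t u + tensor_mult scale t u'"
  using assms by (simp add: fun_eq_iff tensor_mult_apply T_add_form[OF _ mform_pure_append mform_pure_append])

lemma tensor_mult_scale_right:
  assumes "t \<in> T r" "u \<in> T s"
  shows "tensor_mult scale t (fscale c u) = fscale c (tensor_mult scale t u)"
  using assms by (simp add: fun_eq_iff tensor_mult_apply fscale_def T_scale_form[OF _ mform_pure_append])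

text \<open>For fixed \<open>vs\<close> the inner evaluation is the scalar \<open>\<phi>1 vs\<close>
  times \<open>u \<phi>2\<close>; pulling \<open>u \<phi>2\<close> out of the outer evaluation
  leaves \<open>t \<phi>1\<close>.\<close>

lemma tensor_mult_form:
  assumes t: "t \<in> T r" and u: "u \<in> T s" and \<phi>: "mform (r + s) \<phi>"
    and \<phi>1: "mform r \<phi>1" and \<phi>2: "mform s \<phi>2"
    and eq: "\<And>vs ws. length vs = r \<Longrightarrow> length ws = s \<Longrightarrow> \<phi> (vs @ ws) = \<phi>1 vs * \<phi>2 ws"
  shows "tensor_mult scale t u \<phi> = t \<phi>1 * u \<phi>2"
proof -
  have "u (\<lambda>ws. pur (vs @ ws) \<phi>) = u \<phi>2 * \<phi>1 vs" if vs: "length vs = r" for vs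
  proof -
    have "u (\<lambda>ws. pur (vs @ ws) \<phi>) = u (\<lambda>ws. \<phi>1 vs * \<phi>2 ws)"
      by (rule T_cong[OF u]) (use vs \<phi> eq in \<open>simp add: pure_mform\<close>)
    also have "\<dots> = \<phi>1 vs * u \<phi>2" by (rule T_scale_form[OF u \<phi>2])
    finally show ?thesis by simp
  qed
  hence "tensor_mult scale t u \<phi> = t (\<lambda>vs. u \<phi>2 * \<phi>1 vs)"
    unfolding tensor_mult_apply by (rule T_cong[OF t])
  also have "\<dots> = u \<phi>2 * t \<phi>1" by (rule T_scale_form[OF t \<phi>1])
  finally show ?thesis by simp
qed

text \<open>In contrast to \<open>tensor_Hom\<close>, values outside \<open>T r\<close> are
  unconstrained. Sign twists and homogeneous components of maps, being built from definite
  descriptions, satisfy this version.\<close>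

definition linear_on :: "nat \<Rightarrow> nat \<Rightarrow> ('v tensor \<Rightarrow> 'v tensor) \<Rightarrow> bool" where
  "linear_on r s A \<longleftrightarrow> (\<forall>t\<in>T r. A t \<in> T s) \<and> (\<forall>t\<in>T r. \<forall>u\<in>T r. A (t + u) = A t + A u) \<and>
     (\<forall>c. \<forall>t\<in>T r. A (fscale c t) = fscale c (A t))"

lemma linear_onD:
  assumes "linear_on r s A" "t \<in> T r"
  shows "A t \<in> T s" "u \<in> T r \<Longrightarrow> A (t + u) = A t + A u" "A (fscale c t) = fscale c (A t)"
  using assms by (auto simp: linear_on_def)

lemma linear_on_0: "linear_on r s A \<Longrightarrow> A 0 = 0"
  using linear_onD(3)[of r s A 0 0] by simp

lemma linear_on_compose: "linear_on r s A \<Longrightarrow> linear_on s u B \<Longrightarrow> linear_on r u (\<lambda>t. B (A t))"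
  by (auto simp: linear_on_def)

lemma multilinear_map_mult:
  assumes A: "linear_on r s A" and B: "linear_on r' s' B"
  shows "multilinear_map (r + r') (\<lambda>us. tensor_mult scale (A (pur (take r us))) (B (pur (drop r us))))"
    (is "multilinear_map _ ?h")
proof -
  have upd: "(if i < r then take r (vs[i := x]) = (take r vs)[i := x] \<and> drop r (vs[i := x]) = drop r vs
      else take r (vs[i := x]) = take r vs \<and> drop r (vs[i := x]) = (drop r vs)[i - r := x])"
    for vs :: "'v list" and i x
    by (cases "i < r") (simp_all add: take_update_swap drop_update_swap list_update_beyond)
  have len: "length (take r vs) = r" "length (drop r vs) = r'" if "length vs = r + r'" for vs :: "'v list"
    using that by auto
  note lin = linear_onD[OF A] linear_onD[OF B] tensor_mult_add_left tensor_mult_scale_left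
    tensor_mult_add_right[where r = s and s = s'] tensor_mult_scale_right[where r = s and s = s']
  show ?thesis
  proof (rule multilinear_mapI)
    fix vs :: "'v list" and i x y assume "length vs = r + r'" "i < r + r'"
    thus "?h (vs[i := x + y]) = ?h (vs[i := x]) + ?h (vs[i := y])"
      using len[of vs] upd[of i vs x] upd[of i vs y] upd[of i vs "x + y"]
      by (cases "i < r") (simp_all add: pure_add lin)
  next
    fix vs :: "'v list" and i c x assume "length vs = r + r'" "i < r + r'"
    thus "?h (vs[i := scale c x]) = fscale c (?h (vs[i := x]))"
      using len[of vs] upd[of i vs x] upd[of i vs "scale c x"]
      by (cases "i < r") (simp_all add: pure_scale lin)
  qed
qed

lemma multilinear_map_add:
  assumes "multilinear_map r g" "multilinear_map r h"
  shows "multilinear_map r (\<lambda>vs. g vs + h vs)"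
  using assms mform_lincomb[of r _ _ 1 1] by (simp add: multilinear_map_def)

subsection \<open>The grading\<close>

lemma psgn_add: "psgn (p + q) = psgn p * psgn q"
  by (cases p; cases q) simp_all

lemma mform_twist:
  assumes "mform r \<phi>"
  shows "mform r (\<lambda>vs. \<phi> (map (sign_twist scale V 1) vs))"
  using assms unfolding mform_iff by (simp add: map_update V.twist_add V.twist_scale)

text \<open>The arguments are untwisted from left to right, each contributing the sign of its
  degree; the prefix \<open>us\<close> holds those already treated.\<close>

lemma mform_twist_graded:
  assumes "list_all2 (\<lambda>v q. v \<in> V q) vs ps" "mform (length us + length vs) \<phi>"
  shows "\<phi> (us @ map (sign_twist scale V 1) vs) = psgn (sum_list ps) * \<phi> (us @ vs)"
  using assms
proof (induction arbitrary: us rule: list_all2_induct)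
  case (Cons v vs p ps)
  have "\<phi> (us @ scale (psgn p) v # vs) = psgn p * \<phi> (us @ v # vs)"
    using Cons.prems unfolding mform_iff
    by (auto dest!: spec[of _ "us @ v # vs"] spec[of _ "length us"] simp: list_update_append)
  moreover have "\<phi> ((us @ [scale (psgn p) v]) @ map (sign_twist scale V 1) vs) =
      psgn (sum_list ps) * \<phi> ((us @ [scale (psgn p) v]) @ vs)"
    using Cons.prems by (intro Cons.IH) auto
  moreover have "sign_twist scale V 1 v = scale (psgn p) v"
    using V.twist_graded[OF Cons.hyps(1), of 1] by (cases p) auto
  ultimately show ?case
    by (simp add: psgn_add del: add_bit_eq_xor)
qed simp

lemma grade_in_T: "G r p \<subseteq> T r"
  unfolding tensor_grade_def tensor_power_def by (rule cfun.span_mono) auto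

text \<open>Twisting the arguments of forms separates the two components of a tensor power.\<close>

lemma grade_twist:
  assumes "t \<in> G r p" and \<phi>: "mform r \<phi>"
  shows "t (\<lambda>vs. \<phi> (map (sign_twist scale V 1) vs)) = psgn p * t \<phi>"
  using assms(1) unfolding tensor_grade_def
proof (induction rule: cfun.span_induct_alt)
  case (step c x y)
  then obtain vs ps where "x = pur vs" "length vs = r" "list_all2 (\<lambda>v q. v \<in> V q) vs ps" "sum_list ps = p"
    by blast
  thus ?case
    using step mform_twist_graded[of vs ps "[]" \<phi>] \<phi> mform_twist[OF \<phi>]
    by (simp add: pure_mform fscale_def algebra_simps del: add_bit_eq_xor)
qed simp

lemma grade_pure:
  "list_all2 (\<lambda>v q. v \<in> V q) vs ps \<Longrightarrow> pur vs \<in> G (length vs) (sum_list ps)"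
  unfolding tensor_grade_def by (rule cfun.span_base) blast

definition homs :: "'v list \<Rightarrow> bool" where
  "homs vs \<longleftrightarrow> (\<forall>v\<in>set vs. \<exists>p. v \<in> V p)"

lemma homs_simps [simp]: "homs []" "homs (v # vs) \<longleftrightarrow> (\<exists>p. v \<in> V p) \<and> homs vs"
  "homs (vs @ ws) \<longleftrightarrow> homs vs \<and> homs ws"
  by (auto simp: homs_def)

lemma homs_grade:
  assumes "homs vs"
  shows "\<exists>p. pur vs \<in> G (length vs) p"
proof -
  obtain d where "\<forall>v\<in>set vs. v \<in> V (d v)" using assms unfolding homs_def by metis
  hence "list_all2 (\<lambda>v q. v \<in> V q) vs (map d vs)" by (simp add: list_all2_conv_all_nth)
  thus ?thesis using grade_pure by blast
qed

text \<open>Multilinearity lets one argument after the other be split into its even and odd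
  component; \<open>us\<close> collects the arguments that are homogeneous already.\<close>

lemma pure_in_span_homs:
  assumes "homs us"
  shows "pur (us @ vs) \<in> cfun.span {pur ws | ws. length ws = length us + length vs \<and> homs ws}"
  using assms
proof (induction vs arbitrary: us)
  case Nil
  thus ?case by (intro cfun.span_base) auto
next
  case (Cons x vs)
  let ?S = "{pur ws | ws. length ws = length us + length (x # vs) \<and> homs ws}"
  obtain y z where yz: "y \<in> V 0" "z \<in> V 1" "x = y + z" using components_sum by blast
  have "pur ((us @ [y]) @ vs) \<in> cfun.span ?S" "pur ((us @ [z]) @ vs) \<in> cfun.span ?S"
    using Cons.IH[of "us @ [y]"] Cons.IH[of "us @ [z]"] Cons.prems yz by auto
  hence "pur ((us @ [y]) @ vs) + pur ((us @ [z]) @ vs) \<in> cfun.span ?S"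
    by (rule cfun.span_add)
  also have "pur ((us @ [y]) @ vs) + pur ((us @ [z]) @ vs) = pur (us @ x # vs)"
    using pure_add[of "length us" "us @ x # vs" y z] yz by (simp add: list_update_append)
  finally show ?case .
qed

lemma T_span_homs: "T r = cfun.span {pur vs | vs. length vs = r \<and> homs vs}"
proof
  show "T r \<subseteq> cfun.span {pur vs | vs. length vs = r \<and> homs vs}"
    unfolding tensor_power_def using pure_in_span_homs[of "[]"]
    by (intro cfun.span_minimal) auto
  show "cfun.span {pur vs | vs. length vs = r \<and> homs vs} \<subseteq> T r"
    unfolding tensor_power_def by (rule cfun.span_mono) auto
qed

text \<open>The sum is everything because pure tensors of homogeneous vectors generate. It is direct
  because twisting the arguments of a form acts on the even component as 1 and on the odd one as -1,
  so a common element vanishes on multilinear forms, and every element of \<open>T r\<close>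
  vanishes on all other functions.\<close>

sublocale TG: graded_space fscale "G r" "T r" for r
proof
  show G: "cfun.subspace (G r p)" for p by (simp add: tensor_grade_def)
  show "cfun.subspace (T r)" by (rule T_subspace)
  show "G r p \<subseteq> T r" for p by (rule grade_in_T)
  show "G r 0 \<inter> G r 1 = {0}"
  proof (intro equalityI subsetI)
    fix t assume t: "t \<in> G r 0 \<inter> G r 1"
    have "t \<phi> = 0" for \<phi>
    proof (cases "mform r \<phi>")
      case True
      thus ?thesis using t grade_twist[of t r 0 \<phi>] grade_twist[of t r 1 \<phi>] by simp
    next
      case False
      have "t \<in> T r" using t grade_in_T by blast
      thus ?thesis
        by (induction rule: T_induct) (use False in \<open>simp_all add: fscale_def pure_def\<close>)
    qed
    thus "t \<in> {0}" by (simp add: fun_eq_iff)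
  qed (use cfun.subspace_0[OF G] in auto)
  let ?S = "{x + y | x y. x \<in> G r 0 \<and> y \<in> G r 1}"
  have S: "cfun.subspace ?S" by (rule cfun.subspace_sums[OF G G])
  have "pur vs \<in> ?S" if vs: "length vs = r" "homs vs" for vs
  proof -
    obtain p where "pur vs \<in> G r p" using homs_grade[of vs] vs by blast
    thus ?thesis using cfun.subspace_0[OF G]
      by (cases p) (metis (mono_tags, lifting) add_0 add_0_right mem_Collect_eq)+
  qed
  hence "T r \<subseteq> ?S" unfolding T_span_homs by (intro cfun.span_minimal S) auto
  thus "\<exists>u\<in>G r 0. \<exists>v\<in>G r 1. t = u + v" if "t \<in> T r" for t using that by blast
qed

section \<open>Homogeneous components of maps and the sign rule\<close>

lemma linear_on_degree_part:
  assumes f: "linear_on r s f"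
  shows "linear_on r s (degree_part (G r) (G s) p f)"
  unfolding linear_on_def degree_part_def
  by (auto simp: TG.proj_total TG.proj_add TG.proj_scale linear_onD[OF f] cfun.scale_right_distrib add_ac
      simp del: add_bit_eq_xor intro!: T_add)

lemma linear_on_twist: "linear_on r r (sign_twist fscale (G r) p)"
  unfolding linear_on_def by (auto simp: TG.twist_add TG.twist_scale TG.twist_total)

lemma degree_part_graded:
  assumes f: "linear_on r s f" and t: "t \<in> G r q" and ft: "f t \<in> G s q'"
  shows "degree_part (G r) (G s) p f t = (if p + q = q' then f t else 0)"
proof -
  have "f (grade_proj (G r) q'' t) = (if q'' = q then f t else 0)" for q''
    by (simp add: TG.proj_graded[OF t] linear_on_0[OF f])
  hence "degree_part (G r) (G s) p f t = grade_proj (G s) (p + q) (f t)"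
    by (cases q) (simp_all add: degree_part_def TG.proj_graded[where q = 0] del: add_bit_eq_xor)
  thus ?thesis by (simp only: TG.proj_graded[OF ft])
qed

text \<open>Of the two components of \<open>f\<close> only the one of degree \<open>p' + p\<close>
  (the difference of the degrees, modulo 2) is nonzero at \<open>pur us\<close>. It contributes the
  sign obtained by moving a map of that degree past a tensor of degree \<open>q\<close>.\<close>

lemma tensor_map_pure:
  assumes f: "linear_on r s f" and g: "linear_on r' s' g"
    and us: "length us = r" "pur us \<in> G r p" "f (pur us) \<in> G s p'"
    and vs: "length vs = r'" "pur vs \<in> G r' q"
  shows "tensor_map scale V r s r' f g (pur (us @ vs)) =
    fscale (psgn ((p' + p) * q)) (tensor_mult scale (f (pur us)) (g (pur vs)))"
proof -
  let ?h = "\<lambda>d us. tensor_mult scale (degree_part (G r) (G s) d f (pur (take r us)))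
     (g (sign_twist fscale (G r') d (pur (drop r us))))"
  have h: "multilinear_map (r + r') (?h d)" for d
    by (rule multilinear_map_mult[OF linear_on_degree_part[OF f] linear_on_compose[OF linear_on_twist g]])
  have eq: "?h d (us @ vs) =
      (if d + p = p' then fscale (psgn (d * q)) (tensor_mult scale (f (pur us)) (g (pur vs))) else 0)" for d
  proof -
    have tw: "sign_twist fscale (G r') d (pur vs) = fscale (psgn (d * q)) (pur vs)"
      by (rule TG.twist_graded[OF vs(2)])
    have m: "tensor_mult scale (f (pur us)) (fscale c (g (pur vs))) =
        fscale c (tensor_mult scale (f (pur us)) (g (pur vs)))" for c
      by (rule tensor_mult_scale_right[OF linear_onD(1)[OF f] linear_onD(1)[OF g]]) (use us vs in auto)
    have gs: "g (fscale c (pur vs)) = fscale c (g (pur vs))" for c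
      by (rule linear_onD(3)[OF g]) (use vs in simp)
    have td: "take r (us @ vs) = us" "drop r (us @ vs) = vs"
      using append_eq_conv_conj[of us vs "us @ vs"] us(1) by metis+
    have dp: "degree_part (G r) (G s) d f (pur us) = (if d + p = p' then f (pur us) else 0)"
      using degree_part_graded[where f = f and t = "pur us" and q = p and q' = p' and p = d, OF f] us(2,3)
      by blast
    have h_eq: "?h d (us @ vs) = tensor_mult scale (if d + p = p' then f (pur us) else 0)
        (fscale (psgn (d * q)) (g (pur vs)))"
      by (subst td, subst td, subst tw, subst gs, subst dp) (rule HOL.refl)
    show ?thesis
    proof (cases "d + p = p'")
      case True
      show ?thesis unfolding h_eq if_P[OF True] by (rule m)
    next
      case False
      show ?thesis unfolding h_eq if_not_P[OF False] by (rule tensor_mult_0_left)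
    qed
  qed
  have "tensor_map scale V r s r' f g (pur (us @ vs)) = ?h 0 (us @ vs) + ?h 1 (us @ vs)"
    using lift_pure[OF multilinear_map_add[OF h h], of "us @ vs" 0 1] us vs by (simp add: tensor_map_def)
  thus ?thesis unfolding eq by (cases p; cases p'; cases q) simp_all
qed

end

section \<open>Diagrams\<close>

text \<open>One kind of relabelling for two purposes: shifting the right factor of a tensor product
  and permuting the vertices of a single row.\<close>

fun vmap :: "(nat \<Rightarrow> nat) \<Rightarrow> (nat \<Rightarrow> nat) \<Rightarrow> vertex \<Rightarrow> vertex" where
  "vmap f g (Top i) = Top (f i)"
| "vmap f g (Mid i) = Mid i"
| "vmap f g (Bot i) = Bot (g i)"

fun mark_map :: "(vertex \<Rightarrow> vertex) \<Rightarrow> marking \<Rightarrow> marking" where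
  "mark_map \<rho> (BeadOn e) = BeadOn (\<rho> ` e)"
| "mark_map \<rho> (ArrowOn u w) = ArrowOn (\<rho> u) (\<rho> w)"

lemma shift_vertex_eq: "shift_vertex r s = vmap ((+) r) ((+) s)"
proof
  show "shift_vertex r s v = vmap ((+) r) ((+) s) v" for v by (cases v) auto
qed

lemma shift_marking_eq: "shift_marking r s = mark_map (shift_vertex r s)"
proof
  show "shift_marking r s m = mark_map (shift_vertex r s) m" for m by (cases m) auto
qed

lemma inj_vmap:
  assumes "inj f" "inj g"
  shows "inj (vmap f g)"
proof (rule injI)
  show "u = v" if "vmap f g u = vmap f g v" for u v
    using that assms by (cases u; cases v) (auto dest: injD)
qed

section \<open>Relabelling and disjoint union of marked diagrams\<close>

lemma inj_shift_vertex: "inj (shift_vertex r s)"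
  unfolding shift_vertex_eq by (rule inj_vmap) auto

lemma vmap_range_iff [simp]: "vmap f g v \<in> range Top \<longleftrightarrow> v \<in> range Top" "vmap f g v \<in> range Bot \<longleftrightarrow> v \<in> range Bot"
  by (cases v; auto)+

lemma vmap_image_subset_iff: "vmap f g ` e \<subseteq> range Top \<longleftrightarrow> e \<subseteq> range Top"
    "vmap f g ` e \<subseteq> range Bot \<longleftrightarrow> e \<subseteq> range Bot"
  using vmap_range_iff by blast+

text \<open>Marked diagrams over any vertex set. The shifted right factor of a tensor product lives
  on a set that need not be of the form \<open>vertices r s\<close>.\<close>

definition marked_on :: "vertex set \<Rightarrow> mdiagram set" where
  "marked_on S =
     {(E, ms). partition_on S E \<and> (\<forall>e\<in>E. card e = 2) \<and>
        distinct (map marked_edge ms) \<and>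
        {e. BeadOn e \<in> set ms} = cups E \<and>
        {{u, w} | u w. ArrowOn u w \<in> set ms} = caps E}"

lemma marked_diagrams_eq: "marked_diagrams r s = marked_on (vertices r s)"
  by (auto simp: marked_diagrams_def marked_on_def brauer_diagram_def)

lemma marked_edge_mark_map: "marked_edge (mark_map \<rho> m) = \<rho> ` marked_edge m"
  by - (cases m; auto)

text \<open>Injectivity preserves partitions and sizes of edges, and \<open>vmap\<close> keeps every
  vertex in its row, so cups stay cups, caps stay caps, and the markings move along with their
  edges.\<close>

lemma marked_on_image:
  assumes "(E, ms) \<in> marked_on S" "inj f" "inj g"
  shows "((`) (vmap f g) ` E, map (mark_map (vmap f g)) ms) \<in> marked_on (vmap f g ` S)"
proof -
  let ?\<rho> = "vmap f g"
  have inj: "inj ?\<rho>" using assms by (intro inj_vmap)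
  have E: "partition_on S E" "\<And>e. e \<in> E \<Longrightarrow> card e = 2" "distinct (map marked_edge ms)"
    and beads: "{e. BeadOn e \<in> set ms} = cups E"
    and arrows: "{{u, w} | u w. ArrowOn u w \<in> set ms} = caps E"
    using assms(1) by (auto simp: marked_on_def)
  have "{} \<notin> (`) ?\<rho> ` E" using partition_onD3[OF E(1)] by auto
  hence "partition_on (?\<rho> ` S) ((`) ?\<rho> ` E)"
    using partition_on_inj_image[OF E(1), of ?\<rho>] inj by (simp add: inj_on_def)
  moreover have "\<forall>e\<in>(`) ?\<rho> ` E. card e = 2"
    using E(2) inj by (auto simp: card_image inj_on_def inj_def)
  moreover have "distinct (map marked_edge (map (mark_map ?\<rho>) ms))"
  proof -
    have "map marked_edge (map (mark_map ?\<rho>) ms) = map ((`) ?\<rho>) (map marked_edge ms)"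
      by (simp add: marked_edge_mark_map)
    thus ?thesis using E(3) inj by (simp only: distinct_map) (simp add: inj_on_def inj_image_eq_iff)
  qed
  moreover have "{e. BeadOn e \<in> set (map (mark_map ?\<rho>) ms)} = cups ((`) ?\<rho> ` E)"
  proof -
    have "BeadOn e \<in> set (map (mark_map ?\<rho>) ms) \<longleftrightarrow> e \<in> (`) ?\<rho> ` {e. BeadOn e \<in> set ms}" for e
    proof
      assume "BeadOn e \<in> set (map (mark_map ?\<rho>) ms)"
      then obtain m where "m \<in> set ms" "mark_map ?\<rho> m = BeadOn e" by auto
      thus "e \<in> (`) ?\<rho> ` {e. BeadOn e \<in> set ms}" by - (cases m; auto)
    qed force
    thus ?thesis unfolding beads by (auto simp: cups_def vmap_image_subset_iff)
  qed
  moreover have "{{u, w} | u w. ArrowOn u w \<in> set (map (mark_map ?\<rho>) ms)} = caps ((`) ?\<rho> ` E)"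
  proof -
    have "ArrowOn u w \<in> set (map (mark_map ?\<rho>) ms) \<longleftrightarrow>
        (\<exists>u' w'. ArrowOn u' w' \<in> set ms \<and> u = ?\<rho> u' \<and> w = ?\<rho> w')" for u w
    proof
      assume "ArrowOn u w \<in> set (map (mark_map ?\<rho>) ms)"
      then obtain m where "m \<in> set ms" "mark_map ?\<rho> m = ArrowOn u w" by auto
      thus "\<exists>u' w'. ArrowOn u' w' \<in> set ms \<and> u = ?\<rho> u' \<and> w = ?\<rho> w'" by - (cases m; auto)
    qed force
    hence "{{u, w} | u w. ArrowOn u w \<in> set (map (mark_map ?\<rho>) ms)} =
        (`) ?\<rho> ` {{u, w} | u w. ArrowOn u w \<in> set ms}"
      by (auto simp: image_iff) (metis image_empty image_insert)
    thus ?thesis unfolding arrows by (auto simp: caps_def vmap_image_subset_iff)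
  qed
  ultimately show ?thesis by (simp add: marked_on_def)
qed

lemma marked_edges:
  assumes "(E, ms) \<in> marked_on S"
  shows "set (map marked_edge ms) = cups E \<union> caps E"
proof -
  have "e \<in> marked_edge ` set ms \<longleftrightarrow> e \<in> {e. BeadOn e \<in> set ms} \<union> {{u, w} | u w. ArrowOn u w \<in> set ms}" for e
  proof
    assume "e \<in> marked_edge ` set ms"
    then obtain m where "m \<in> set ms" "e = marked_edge m" by blast
    thus "e \<in> {e. BeadOn e \<in> set ms} \<union> {{u, w} | u w. ArrowOn u w \<in> set ms}" by - (cases m; auto)
  qed (force simp: image_iff)
  hence "marked_edge ` set ms = {e. BeadOn e \<in> set ms} \<union> {{u, w} | u w. ArrowOn u w \<in> set ms}"
    by blast
  thus ?thesis using assms by (simp add: marked_on_def)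
qed

lemma marked_onD:
  assumes "(E, ms) \<in> marked_on S"
  shows "{e. BeadOn e \<in> set ms} = cups E" "{{u, w} | u w. ArrowOn u w \<in> set ms} = caps E"
    "\<And>e. e \<in> E \<Longrightarrow> card e = 2"
  using assms unfolding marked_on_def mem_Collect_eq case_prod_conv by blast+

lemma marked_on_arrow: "(E, ms) \<in> marked_on S \<Longrightarrow> ArrowOn u w \<in> set ms \<Longrightarrow> {u, w} \<in> caps E"
  by (subst marked_onD(2)[symmetric]) blast+

lemma marked_on_bead: "(E, ms) \<in> marked_on S \<Longrightarrow> BeadOn e \<in> set ms \<Longrightarrow> e \<in> cups E"
  by (subst marked_onD(1)[symmetric]) blast+

lemma marked_on_Un:
  assumes "(E, ms) \<in> marked_on S" "(E', ms') \<in> marked_on S'" "S \<inter> S' = {}"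
  shows "(E \<union> E', ms @ ms') \<in> marked_on (S \<union> S')"
proof -
  have m: "partition_on S E" "distinct (map marked_edge ms)" "partition_on S' E'" "distinct (map marked_edge ms')"
    using assms(1,2) by (auto simp: marked_on_def)
  note S = partition_onD1[OF m(1)] partition_onD1[OF m(3)] partition_onD3[OF m(1)] partition_onD3[OF m(3)]
  have "E \<inter> E' = {}"
  proof (rule ccontr)
    assume "E \<inter> E' \<noteq> {}"
    then obtain e where e: "e \<in> E" "e \<in> E'" by blast
    hence "e \<subseteq> S \<inter> S'" using S(1,2) by blast
    with e S(3) assms(3) show False by simp
  qed
  moreover have "set (map marked_edge ms) \<subseteq> E" "set (map marked_edge ms') \<subseteq> E'"
    unfolding marked_edges[OF assms(1)] marked_edges[OF assms(2)] by (auto simp: cups_def caps_def)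
  ultimately have "set (map marked_edge ms) \<inter> set (map marked_edge ms') = {}" by blast
  hence d: "distinct (map marked_edge (ms @ ms'))"
    unfolding map_append distinct_append using m by blast
  have p: "partition_on (S \<union> S') (E \<union> E')"
  proof (rule partition_onI)
    show "\<Union>(E \<union> E') = S \<union> S'" using S(1,2) by blast
    show "{} \<notin> E \<union> E'" using S(3,4) by blast
    fix p q assume pq: "p \<in> E \<union> E'" "q \<in> E \<union> E'" "p \<noteq> q"
    have "disjnt p q \<and> disjnt q p" if "p \<in> E" "q \<in> E'" for p q
      using that S(1,2) assms(3) unfolding disjnt_def by blast
    moreover have "disjnt p q" if "p \<in> E" "q \<in> E" using that partition_onD2[OF m(1)] pq(3)
      by (auto simp: pairwise_def)
    moreover have "disjnt p q" if "p \<in> E'" "q \<in> E'" using that partition_onD2[OF m(3)] pq(3)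
      by (auto simp: pairwise_def)
    ultimately show "disjnt p q" using pq(1,2) by blast
  qed
  have marks: "{e. BeadOn e \<in> set (ms @ ms')} = cups E \<union> cups E'"
    "{{u, w} | u w. ArrowOn u w \<in> set (ms @ ms')} = caps E \<union> caps E'"
  proof -
    have "{e. BeadOn e \<in> set (ms @ ms')} = {e. BeadOn e \<in> set ms} \<union> {e. BeadOn e \<in> set ms'}"
      by auto
    also have "\<dots> = cups E \<union> cups E'" unfolding marked_onD(1)[OF assms(1)] marked_onD(1)[OF assms(2)] ..
    finally show "{e. BeadOn e \<in> set (ms @ ms')} = cups E \<union> cups E'" .
    have "{{u, w} | u w. ArrowOn u w \<in> set (ms @ ms')} =
        {{u, w} | u w. ArrowOn u w \<in> set ms} \<union> {{u, w} | u w. ArrowOn u w \<in> set ms'}"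
      unfolding set_append by blast
    also have "\<dots> = caps E \<union> caps E'" unfolding marked_onD(2)[OF assms(1)] marked_onD(2)[OF assms(2)] ..
    finally show "{{u, w} | u w. ArrowOn u w \<in> set (ms @ ms')} = caps E \<union> caps E'" .
  qed
  have un: "cups (E \<union> E') = cups E \<union> cups E'" "caps (E \<union> E') = caps E \<union> caps E'"
    unfolding cups_def caps_def by blast+
  have c: "\<forall>e\<in>E \<union> E'. card e = 2" using marked_onD(3)[OF assms(1)] marked_onD(3)[OF assms(2)] by blast
  show ?thesis unfolding marked_on_def mem_Collect_eq case_prod_conv marks un
    by (intro conjI d p c HOL.refl)
qed

lemma vertices_split:
  "vertices (r1 + r) (s1 + s) = vertices r1 s1 \<union> shift_vertex r1 s1 ` vertices r s"
  "vertices r1 s1 \<inter> shift_vertex r1 s1 ` vertices r s = {}"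
proof -
  have split: "{..<a + b} = {..<a} \<union> (+) a ` {..<b}" for a b :: nat
  proof (rule set_eqI)
    show "i \<in> {..<a + b} \<longleftrightarrow> i \<in> {..<a} \<union> (+) a ` {..<b}" for i
      by (auto simp: image_iff intro: bexI[of _ "i - a"])
  qed
  have "Top ` {..<a + b} = Top ` {..<a} \<union> Top ` (+) a ` {..<b}"
    "Bot ` {..<a + b} = Bot ` {..<a} \<union> Bot ` (+) a ` {..<b}" for a b
    unfolding split by auto
  thus "vertices (r1 + r) (s1 + s) = vertices r1 s1 \<union> shift_vertex r1 s1 ` vertices r s"
    by (simp add: vertices_def image_Un image_image) blast
  show "vertices r1 s1 \<inter> shift_vertex r1 s1 ` vertices r s = {}"
    by (auto simp: vertices_def)
qed

lemma tensor_diagram_marked: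
  assumes "(E, ms) \<in> marked_diagrams r s" "(E', ms') \<in> marked_diagrams r' s'"
  shows "tensor_diagram r s (E, ms) (E', ms') \<in> marked_diagrams (r + r') (s + s')"
proof -
  have "((`) (shift_vertex r s) ` E', map (shift_marking r s) ms') \<in> marked_on (shift_vertex r s ` vertices r' s')"
    using marked_on_image[of E' ms' "vertices r' s'" "(+) r" "(+) s"] assms(2)
    by (simp add: marked_diagrams_eq shift_vertex_eq shift_marking_eq)
  from marked_on_Un[OF _ this vertices_split(2)] assms(1) show ?thesis
    by (simp add: tensor_diagram_def marked_diagrams_eq vertices_split(1))
qed

section \<open>Choosing markings and removing an edge\<close>

lemma finite_vertices [simp]: "finite (vertices r s)"
  by (simp add: vertices_def)

lemma brauer_finite: "brauer_diagram r s E \<Longrightarrow> finite E"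
  unfolding brauer_diagram_def partition_on_def using finite_UnionD[of E] by auto

lemma brauer_marked: "(E, ms) \<in> marked_diagrams r s \<Longrightarrow> brauer_diagram r s E"
  by (simp add: marked_diagrams_def)

text \<open>List the cups with their beads, then the caps with arrows in arbitrary directions. No
  edge is listed twice, since an edge that is both a cup and a cap would be empty.\<close>

lemma exists_marking:
  assumes "brauer_diagram r s E"
  shows "\<exists>ms. (E, ms) \<in> marked_diagrams r s"
proof -
  have E: "finite E" "\<And>e. e \<in> E \<Longrightarrow> card e = 2"
    using assms brauer_finite by (auto simp: brauer_diagram_def)
  have "finite (cups E)" "finite (caps E)" using E(1) by (auto simp: cups_def caps_def)
  then obtain cs ds where cs: "set cs = cups E" "distinct cs" and ds: "set ds = caps E" "distinct ds"
    by (meson finite_distinct_list)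
  obtain u w where uw: "\<And>e. e \<in> E \<Longrightarrow> e = {u e, w e}"
    using E(2) card_2_iff by metis
  let ?ms = "map BeadOn cs @ map (\<lambda>e. ArrowOn (u e) (w e)) ds"
  have capsE: "e \<in> E" if "e \<in> caps E" for e using that by (simp add: caps_def)
  have "cups E \<inter> caps E = {}"
  proof (rule ccontr)
    assume "cups E \<inter> caps E \<noteq> {}"
    then obtain e where "e \<in> E" "e \<subseteq> range Top" "e \<subseteq> range Bot" by (auto simp: cups_def caps_def)
    hence "e = {}" by auto
    with E(2)[OF \<open>e \<in> E\<close>] show False by simp
  qed
  moreover have "map marked_edge ?ms = cs @ ds"
    using ds(1) capsE uw by (auto intro!: map_idI)
  moreover have "{e. BeadOn e \<in> set ?ms} = cups E" using cs(1) by auto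
  moreover have "{{u, w} | u w. ArrowOn u w \<in> set ?ms} = caps E"
  proof -
    have "{{u, w} | u w. ArrowOn u w \<in> set ?ms} = (\<lambda>e. {u e, w e}) ` caps E" using ds(1) by auto
    also have "\<dots> = (\<lambda>e. e) ` caps E" by (rule image_cong) (use capsE uw in auto)
    finally show ?thesis by simp
  qed
  ultimately have "(E, ?ms) \<in> marked_diagrams r s"
    using assms cs ds by (simp add: marked_diagrams_def)
  thus ?thesis by blast
qed

lemma brauer_image:
  assumes "brauer_diagram r s E" "inj f" "inj g" "vmap f g ` vertices r s = vertices r' s'"
  shows "brauer_diagram r' s' ((`) (vmap f g) ` E)"
  using exists_marking[OF assms(1)] marked_on_image[OF _ assms(2,3)] assms(4) brauer_marked
  by (metis marked_diagrams_eq)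

text \<open>Undoes the tensor product with a diagram of one edge on the left. That edge uses up all
  of \<open>vertices r1 s1\<close>, so the others partition the shifted vertices and can be shifted
  back. It will be applied to a cup, a cap and a through string.\<close>

lemma brauer_peel:
  assumes E: "brauer_diagram (r1 + r) (s1 + s) E" and e: "vertices r1 s1 \<in> E"
  shows "\<exists>E'. brauer_diagram r s E' \<and> E = insert (vertices r1 s1) ((`) (shift_vertex r1 s1) ` E')"
proof -
  let ?\<rho> = "shift_vertex r1 s1"
  let ?g = "inv ?\<rho>"
  have pE: "partition_on (vertices (r1 + r) (s1 + s)) E" and cE: "\<And>e. e \<in> E \<Longrightarrow> card e = 2"
    using E by (simp_all add: brauer_diagram_def)
  have ins: "insert (vertices r1 s1) (E - {vertices r1 s1}) = E" using e by (rule insert_Diff)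
  have "disjnt (vertices r1 s1) e'" if "e' \<in> E - {vertices r1 s1}" for e'
    by (rule pairwiseD[OF partition_onD2[OF pE] e]) (use that in auto)
  hence "disjnt (vertices r1 s1) (\<Union>(E - {vertices r1 s1}))" by simp
  from partition_on_insert[OF this, of "vertices (r1 + r) (s1 + s)"] pE
  have "partition_on (vertices (r1 + r) (s1 + s) - vertices r1 s1) (E - {vertices r1 s1})"
    unfolding ins by (rule iffD1[THEN conjunct1])
  moreover have "vertices (r1 + r) (s1 + s) - vertices r1 s1 = ?\<rho> ` vertices r s"
    unfolding vertices_split(1) using vertices_split(2)[of r1 s1 r s] by blast
  ultimately have part: "partition_on (?\<rho> ` vertices r s) (E - {vertices r1 s1})" by (simp only:)
  have g: "?g (?\<rho> v) = v" for v by (rule inv_f_f[OF inj_shift_vertex])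
  have sub: "\<exists>e'. e = ?\<rho> ` e'" if "e \<in> E - {vertices r1 s1}" for e
    using that partition_onD1[OF part] by (metis Union_upper subset_imageE)
  have inj: "inj_on ?g (?\<rho> ` vertices r s)" by (auto simp: inj_on_def g)
  have "{} \<notin> (`) ?g ` (E - {vertices r1 s1})" using partition_onD3[OF part] by auto
  with partition_on_inj_image[OF part inj]
  have "partition_on (vertices r s) ((`) ?g ` (E - {vertices r1 s1}))"
    by (simp add: image_image g)
  moreover have "card e = 2" if eg: "e \<in> (`) ?g ` (E - {vertices r1 s1})" for e
  proof -
    obtain e0 where "e0 \<in> E - {vertices r1 s1}" "e = ?g ` e0" using eg by blast
    moreover obtain e1 where "e0 = ?\<rho> ` e1" using sub calculation(1) by blast
    ultimately have "e = e1" "card e0 = 2" using cE by (simp_all add: image_image g)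
    thus ?thesis using \<open>e0 = ?\<rho> ` e1\<close> card_image[of ?\<rho> e1] inj_on_subset[OF inj_shift_vertex] by simp
  qed
  ultimately have "brauer_diagram r s ((`) ?g ` (E - {vertices r1 s1}))"
    by (simp add: brauer_diagram_def)
  moreover have "(`) ?\<rho> ` (`) ?g ` (E - {vertices r1 s1}) = E - {vertices r1 s1}"
  proof -
    have "?\<rho> ` ?g ` e = e" if "e \<in> E - {vertices r1 s1}" for e
      using sub[OF that] by (auto simp: image_image g)
    thus ?thesis by (simp add: image_image)
  qed
  ultimately show ?thesis using e by (metis insert_Diff)
qed

subsection \<open>Markings\<close>

lemma fscale_diff: "fscale c (x - y) = fscale c x - fscale c y"
  by (simp add: fscale_def fun_eq_iff algebra_simps)

text \<open>Proportionality in the quotient. The factor stays anonymous because only its being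
  nonzero is used later.\<close>

definition class_eq :: "complex \<Rightarrow> nat \<Rightarrow> nat \<Rightarrow> mdiagram \<Rightarrow> mdiagram \<Rightarrow> bool" where
  "class_eq \<epsilon> r s D D' \<longleftrightarrow> (\<exists>c. c \<noteq> 0 \<and> single D - fscale c (single D') \<in> diagram_relations \<epsilon> r s)"

lemma relations_subspace: "cfun.subspace (diagram_relations \<epsilon> r s)"
  by (simp add: diagram_relations_def)

lemma class_eq_refl: "class_eq \<epsilon> r s D D"
  unfolding class_eq_def using cfun.subspace_0[OF relations_subspace]
  by (intro exI[of _ 1]) (simp add: fscale_def)

lemma class_eq_trans:
  assumes "class_eq \<epsilon> r s D D'" "class_eq \<epsilon> r s D' D''"
  shows "class_eq \<epsilon> r s D D''"
proof -
  obtain c c' where c: "c \<noteq> 0" "single D - fscale c (single D') \<in> diagram_relations \<epsilon> r s"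
    and c': "c' \<noteq> 0" "single D' - fscale c' (single D'') \<in> diagram_relations \<epsilon> r s"
    using assms by (auto simp: class_eq_def)
  have "(single D - fscale c (single D')) + fscale c (single D' - fscale c' (single D'')) \<in> diagram_relations \<epsilon> r s"
    using c c' relations_subspace cfun.subspace_add cfun.subspace_scale by blast
  moreover have "(single D - fscale c (single D')) + fscale c (single D' - fscale c' (single D'')) =
      single D - fscale (c * c') (single D'')"
    by (simp add: fscale_def fun_eq_iff algebra_simps)
  ultimately have "single D - fscale (c * c') (single D'') \<in> diagram_relations \<epsilon> r s" by (simp only:)
  thus ?thesis using c(1) c'(1) unfolding class_eq_def by (intro exI[of _ "c * c'"]) simp
qed

lemma class_eq_swap:
  assumes "(E, xs @ [x, y] @ ys) \<in> marked_diagrams r s" "\<epsilon> \<noteq> 0"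
  shows "class_eq \<epsilon> r s (E, xs @ [y, x] @ ys) (E, xs @ [x, y] @ ys)"
  unfolding class_eq_def diagram_relations_def
  using assms by (intro exI[of _ \<epsilon>] conjI cfun.span_base) blast+

lemma class_eq_flip:
  assumes "(E, xs @ [ArrowOn u w] @ ys) \<in> marked_diagrams r s" "\<epsilon> \<noteq> 0"
  shows "class_eq \<epsilon> r s (E, xs @ [ArrowOn w u] @ ys) (E, xs @ [ArrowOn u w] @ ys)"
  unfolding class_eq_def diagram_relations_def
  using assms by (intro exI[of _ \<epsilon>] conjI cfun.span_base) blast+

lemma marked_permute:
  assumes "(E, xs) \<in> marked_diagrams r s" "mset xs = mset ys"
  shows "(E, ys) \<in> marked_diagrams r s"
proof -
  have "set xs = set ys" using assms(2) by (metis set_mset_mset)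
  moreover have "mset (map marked_edge xs) = mset (map marked_edge ys)" using assms(2) by simp
  hence "distinct (map marked_edge xs) \<longleftrightarrow> distinct (map marked_edge ys)"
    by (metis mset_eq_imp_distinct_iff)
  ultimately show ?thesis using assms(1) by (auto simp: marked_diagrams_def)
qed

lemma marked_flip:
  assumes "(E, xs @ ArrowOn u w # ys) \<in> marked_diagrams r s"
  shows "(E, xs @ ArrowOn w u # ys) \<in> marked_diagrams r s"
proof -
  have "{{u', w'} | u' w'. ArrowOn u' w' \<in> set (xs @ ArrowOn w u # ys)} =
      {{u', w'} | u' w'. ArrowOn u' w' \<in> set (xs @ ArrowOn u w # ys)}"
    by (auto simp: insert_commute)
  moreover have "{e. BeadOn e \<in> set (xs @ ArrowOn w u # ys)} = {e. BeadOn e \<in> set (xs @ ArrowOn u w # ys)}"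
    by auto
  ultimately show ?thesis using assms by (simp add: marked_diagrams_def insert_commute[of w u])
qed

text \<open>The marking \<open>y\<close> moves up through \<open>ys\<close> by interchanges with its
  upper neighbour, each costing a factor \<epsilon>.\<close>

lemma class_eq_front:
  assumes "(E, pre @ ys @ y # zs) \<in> marked_diagrams r s" "\<epsilon> \<noteq> 0"
  shows "class_eq \<epsilon> r s (E, pre @ y # ys @ zs) (E, pre @ ys @ y # zs)"
  using assms(1)
proof (induction ys arbitrary: zs rule: rev_induct)
  case Nil
  show ?case by (simp add: class_eq_refl)
next
  case (snoc x ys)
  have "(E, pre @ ys @ y # x # zs) \<in> marked_diagrams r s"
    by (rule marked_permute[OF snoc.prems]) simp
  hence "class_eq \<epsilon> r s (E, pre @ y # ys @ x # zs) (E, pre @ ys @ y # x # zs)"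
    by (rule snoc.IH)
  moreover have "class_eq \<epsilon> r s (E, (pre @ ys) @ [y, x] @ zs) (E, (pre @ ys) @ [x, y] @ zs)"
    using snoc.prems assms(2) by (intro class_eq_swap) auto
  ultimately show ?case using class_eq_trans[of \<epsilon> r s "(E, pre @ y # ys @ x # zs)" "(E, pre @ ys @ y # x # zs)"]
    by simp
qed

text \<open>An edge is not both a cup and a cap, so the two markings are of the same kind: equal
  beads, or arrows that agree or are opposite.\<close>

lemma same_edge_marks:
  assumes "(E, xs) \<in> marked_diagrams r s" "(E, ys) \<in> marked_diagrams r s"
    and "x \<in> set xs" "y \<in> set ys" "marked_edge x = marked_edge y"
  shows "x = y \<or> (\<exists>u w. x = ArrowOn u w \<and> y = ArrowOn w u)"
proof -
  note m = assms(1,2)[unfolded marked_diagrams_eq]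
  have disj: False if "e \<in> cups E" "e \<in> caps E" for e
  proof -
    have "e = {}" using that by (auto simp: cups_def caps_def)
    moreover have "card e = 2" using that(1) marked_onD(3)[OF m(1)] by (simp add: cups_def)
    ultimately show False by simp
  qed
  have arrow: "{u, w} \<in> caps E" if "ArrowOn u w \<in> {x, y}" for u w
    using that assms(3,4) marked_on_arrow[OF m(1)] marked_on_arrow[OF m(2)] by fastforce
  have bead: "e \<in> cups E" if "BeadOn e \<in> {x, y}" for e
    using that assms(3,4) marked_on_bead[OF m(1)] marked_on_bead[OF m(2)] by fastforce
  show ?thesis
  proof (cases x)
    case x: (BeadOn e)
    show ?thesis
    proof (cases y)
      case (ArrowOn u w)
      thus ?thesis using x assms(5) disj bead[of e] arrow[of u w] by simp
    qed (use x assms(5) in simp)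
  next
    case x: (ArrowOn u w)
    show ?thesis
    proof (cases y)
      case (BeadOn e)
      thus ?thesis using x assms(5) disj bead[of e] arrow[of u w] by simp
    next
      case (ArrowOn u' w')
      thus ?thesis using x assms(5) by (auto simp: doubleton_eq_iff)
    qed
  qed
qed

text \<open>Selection sort. The marking of \<open>ys\<close> on the same edge as the head
  \<open>x\<close> is brought to the front, turned if it is the opposite arrow, and then joins the
  prefix \<open>pre\<close> on which both lists agree.\<close>

lemma class_eq_markings:
  assumes "(E, pre @ xs) \<in> marked_diagrams r s" "(E, pre @ ys) \<in> marked_diagrams r s" "\<epsilon> \<noteq> 0"
  shows "class_eq \<epsilon> r s (E, pre @ xs) (E, pre @ ys)"
  using assms(1,2)
proof (induction xs arbitrary: pre ys)
  case Nil
  hence "marked_edge ` set pre = marked_edge ` set (pre @ ys)"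
    using marked_edges unfolding marked_diagrams_eq by (metis append.right_neutral set_map)
  moreover have "distinct (map marked_edge (pre @ ys))"
    using Nil by (simp add: marked_diagrams_def)
  ultimately have "ys = []" by (cases ys) auto
  thus ?case by (simp add: class_eq_refl)
next
  case (Cons x xs)
  have "set (map marked_edge (pre @ x # xs)) = set (map marked_edge (pre @ ys))"
    using Cons.prems marked_edges unfolding marked_diagrams_eq by metis
  moreover have "distinct (map marked_edge (pre @ x # xs))"
    using Cons.prems by (simp add: marked_diagrams_def)
  ultimately have "marked_edge x \<in> marked_edge ` set ys" by auto
  then obtain y ys1 ys2 where y: "marked_edge x = marked_edge y" "ys = ys1 @ y # ys2"
    by (metis imageE split_list)
  have m1: "(E, pre @ y # ys1 @ ys2) \<in> marked_diagrams r s"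
    by (rule marked_permute[OF Cons.prems(2)]) (simp add: y)
  have c1: "class_eq \<epsilon> r s (E, pre @ y # ys1 @ ys2) (E, pre @ ys)"
    using class_eq_front[OF _ assms(3)] Cons.prems(2) y(2) by simp
  have "x = y \<or> (\<exists>u w. x = ArrowOn u w \<and> y = ArrowOn w u)"
    by (rule same_edge_marks[OF Cons.prems]) (use y in auto)
  hence "(E, (pre @ [x]) @ ys1 @ ys2) \<in> marked_diagrams r s \<and>
      class_eq \<epsilon> r s (E, (pre @ [x]) @ ys1 @ ys2) (E, pre @ y # ys1 @ ys2)"
  proof (elim disjE exE conjE)
    assume "x = y"
    thus ?thesis using m1 by (simp add: class_eq_refl)
  next
    fix u w assume xy: "x = ArrowOn u w" "y = ArrowOn w u"
    show ?thesis using m1 marked_flip[of E pre w u "ys1 @ ys2"] class_eq_flip[of E pre w u "ys1 @ ys2"] xy assms(3)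
      by simp
  qed
  moreover from this have "class_eq \<epsilon> r s (E, (pre @ [x]) @ xs) (E, (pre @ [x]) @ ys1 @ ys2)"
    using Cons.prems(1) by (intro Cons.IH) auto
  ultimately show ?case using class_eq_trans[OF class_eq_trans c1] by simp
qed

subsection \<open>Composition with permutations\<close>

text \<open>A multiset, in order to count how many strand ends meet at a middle vertex.\<close>

definition ends :: "strand multiset \<Rightarrow> vertex multiset" where
  "ends P = (\<Sum>(u, xs, w)\<in>#P. {#u, w#})"

lemma ends_simps [simp]: "ends {#} = {#}" "ends (add_mset (u, xs, w) P) = add_mset u (add_mset w (ends P))"
  "ends (P + Q) = ends P + ends Q"
  by (simp_all add: ends_def)

lemma ends_rename: "ends (rename_ends f P) = image_mset f (ends P)"
  by (induction P) (auto simp: rename_ends_def)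

lemma ends_mem: "v \<in># ends P \<longleftrightarrow> (\<exists>(u, xs, w)\<in>#P. v = u \<or> v = w)"
  by (induction P) auto

lemma rename_ends_simps [simp]: "rename_ends f {#} = {#}"
  "rename_ends f (add_mset (u, xs, w) P) = add_mset (f u, xs, f w) (rename_ends f P)"
  "rename_ends f (P + Q) = rename_ends f P + rename_ends f Q"
  by (simp_all add: rename_ends_def)

lemma rename_ends_cong: "(\<And>v. v \<in># ends P \<Longrightarrow> f v = g v) \<Longrightarrow> rename_ends f P = rename_ends g P"
  by (induction P) auto

lemma rename_ends_compose: "rename_ends f (rename_ends g P) = rename_ends (\<lambda>v. f (g v)) P"
  by (induction P) auto

lemma rename_ends_id: "rename_ends (\<lambda>v. v) P = P"
  by (induction P) auto

lemma simplifies_trans: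
  assumes "simplifies \<delta> \<epsilon> P c Q" "simplifies \<delta> \<epsilon> Q c' R"
  shows "simplifies \<delta> \<epsilon> P (c * c') R"
  using assms
proof (induction rule: simplifies.induct)
  case (step P c Q c'' R)
  thus ?case using simplifies.step[OF step.hyps(1)] by (simp add: mult.assoc)
qed simp

lemma simplifies_step: "simplify_step \<delta> \<epsilon> P c Q \<Longrightarrow> simplifies \<delta> \<epsilon> P c Q"
  using simplifies.step[OF _ simplifies.refl] by fastforce

text \<open>The strand from \<open>Mid j\<close> to \<open>g\<close> has no marks, so joining it to
  the only other end at \<open>Mid j\<close> amounts to renaming that end. If that end is the start
  of its strand, the unmarked strand is reversed, because \<open>join\<close> needs a strand ending
  at the middle vertex followed by one starting there.\<close>

lemma connect_one:
  assumes "count (ends P) (Mid j) = 1"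
  shows "simplifies \<delta> \<epsilon> (add_mset (Mid j, [], g) P) 1 (rename_ends ((\<lambda>v. v)(Mid j := g)) P)"
proof -
  have "Mid j \<in># ends P" using assms by (metis count_eq_zero_iff zero_neq_one)
  then obtain u xs w where st: "(u, xs, w) \<in># P" "Mid j = u \<or> Mid j = w" by (auto simp: ends_mem)
  then obtain P' where P: "P = add_mset (u, xs, w) P'" by (metis multi_member_split)
  have "count (ends P') (Mid j) = 0" using assms st(2) by (auto simp: P split: if_splits)
  hence "Mid j \<notin># ends P'" by (simp add: count_eq_zero_iff)
  hence P': "rename_ends ((\<lambda>v. v)(Mid j := g)) P' = P'"
    using rename_ends_cong[of P' "(\<lambda>v. v)(Mid j := g)" "\<lambda>v. v"] rename_ends_id by fastforce
  show ?thesis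
  proof (cases "u = Mid j")
    case True
    hence w: "w \<noteq> Mid j" using assms by (auto simp: P)
    have "simplify_step \<delta> \<epsilon> (add_mset (Mid j, [], g) P) 1 (add_mset (g, [], Mid j) P)"
      using simplify_step.reverse[of \<delta> \<epsilon> "Mid j" "[]" g P] by simp
    moreover have "simplify_step \<delta> \<epsilon> (add_mset (g, [], Mid j) P) 1 (add_mset (g, xs, w) P')"
      using simplify_step.join[of \<delta> \<epsilon> g "[]" j xs w P'] True by (simp add: P)
    ultimately show ?thesis
      using simplifies.step[OF _ simplifies_step] True w P' by (fastforce simp: P)
  next
    case False
    hence w: "w = Mid j" using st by simp
    have "simplify_step \<delta> \<epsilon> (add_mset (Mid j, [], g) P) 1 (add_mset (u, xs, g) P')"
      using simplify_step.join[of \<delta> \<epsilon> u xs j "[]" g P'] w by (simp add: P add_mset_commute)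
    thus ?thesis using False w P' by (simp add: P simplifies_step)
  qed
qed

definition connect :: "nat set \<Rightarrow> (nat \<Rightarrow> vertex) \<Rightarrow> vertex \<Rightarrow> vertex" where
  "connect J g v = (case v of Mid j \<Rightarrow> if j \<in> J then g j else Mid j | _ \<Rightarrow> v)"

text \<open>As \<open>g\<close> takes no middle vertex as value, a join creates no new end in the
  middle row, and the multiplicity 1 of the remaining middle vertices is preserved.\<close>

lemma connect_all:
  assumes "finite J" "\<And>j. j \<in> J \<Longrightarrow> count (ends P) (Mid j) = 1" "\<And>j i. g j \<noteq> Mid i"
  shows "simplifies \<delta> \<epsilon> (image_mset (\<lambda>j. (Mid j, [], g j)) (mset_set J) + P) 1
    (rename_ends (connect J g) P)"
  using assms(1,2)
proof (induction J arbitrary: P rule: finite_induct)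
  case empty
  have "connect {} g = (\<lambda>v. v)" by (auto simp: connect_def fun_eq_iff split: vertex.splits)
  thus ?case by (simp add: rename_ends_id simplifies.refl)
next
  case (insert j J)
  let ?C = "image_mset (\<lambda>j. (Mid j, [], g j)) (mset_set J) :: strand multiset"
  let ?f = "(\<lambda>v. v)(Mid j := g j)"
  have ends_C: "ends ?C = image_mset Mid (mset_set J) + image_mset g (mset_set J)"
    using insert.hyps(1) by (induction J rule: finite_induct) auto
  have "Mid j \<notin># ends ?C" using insert.hyps assms(3)[symmetric] by (auto simp: ends_C)
  hence "count (ends (?C + P)) (Mid j) = 1"
    using insert.prems by (simp add: count_eq_zero_iff)
  from connect_one[OF this]
  have "simplifies \<delta> \<epsilon> (add_mset (Mid j, [], g j) (?C + P)) 1 (rename_ends ?f (?C + P))" .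
  moreover have "rename_ends ?f ?C = ?C"
    using rename_ends_cong[of ?C ?f "\<lambda>v. v"] \<open>Mid j \<notin># ends ?C\<close> rename_ends_id by fastforce
  moreover have "simplifies \<delta> \<epsilon> (?C + rename_ends ?f P) 1 (rename_ends (connect J g) (rename_ends ?f P))"
  proof (rule insert.IH)
    fix i assume i: "i \<in> J"
    have "count (image_mset ?f M) (Mid i) = count M (Mid i)" for M
      using i insert.hyps assms(3) by (induction M) auto
    thus "count (ends (rename_ends ?f P)) (Mid i) = 1"
      using insert.prems i by (simp add: ends_rename)
  qed
  moreover have "rename_ends (connect J g) (rename_ends ?f P) = rename_ends (connect (insert j J) g) P"
  proof -
    have "(\<lambda>v. connect J g (?f v)) = connect (insert j J) g"
    proof
      show "connect J g (?f v) = connect (insert j J) g v" for v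
        using assms(3) insert.hyps by (cases v; cases "g j") (auto simp: connect_def)
    qed
    thus ?thesis by (simp add: rename_ends_compose)
  qed
  ultimately show ?case
    using insert.hyps simplifies_trans[of \<delta> \<epsilon> _ 1 _ 1] by fastforce
qed

section \<open>Strand pictures of Brauer diagrams\<close>

lemma depicts_exists:
  assumes "finite E" "\<And>e. e \<in> E \<Longrightarrow> card e = 2" "strict_mono ht"
  shows "\<exists>P. depicts ht (E, ms) P"
proof -
  obtain u w where uw: "\<And>e. e \<in> E \<Longrightarrow> e = {u e, w e}"
    using assms(2) card_2_iff by metis
  let ?s = "\<lambda>e. (u e, concat (map (\<lambda>i. edge_marks (u e) (w e) (ht i) (ms ! i)) [0..<length ms]), w e)"
  have "image_mset (\<lambda>e. {u e, w e}) (mset_set E) = image_mset (\<lambda>e. e) (mset_set E)"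
    by (rule image_mset_cong) (use uw assms(1) in auto)
  hence "depicts ht (E, ms) (image_mset ?s (mset_set E))"
    using assms by (simp add: depicts_def image_mset.compositionality comp_def)
  thus ?thesis by blast
qed

text \<open>Every vertex lies on exactly one edge. This yields the multiplicity 1 demanded by
  \<open>connect_all\<close>.\<close>

lemma ends_depicts:
  assumes "depicts ht (E, ms) P" "brauer_diagram r s E"
  shows "ends P = mset_set (vertices r s)"
proof -
  have E: "finite E" "\<And>e. e \<in> E \<Longrightarrow> card e = 2" "partition_on (vertices r s) E"
    using assms(2) brauer_finite by (auto simp: brauer_diagram_def)
  have P: "image_mset (\<lambda>(u, xs, w). {u, w}) P = mset_set E" using assms(1) by (simp add: depicts_def)
  have "{#u, w#} = mset_set {u, w}" if "(u, xs, w) \<in># P" for u xs w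
  proof -
    have "{u, w} \<in># mset_set E" using that by (force simp flip: P)
    hence "card {u, w} = 2" using E by auto
    hence "u \<noteq> w" by auto
    thus ?thesis by simp
  qed
  hence "ends P = sum_mset (image_mset (\<lambda>st. mset_set (case st of (u, xs, w) \<Rightarrow> {u, w})) P)"
    unfolding ends_def by (intro arg_cong[where f = sum_mset] image_mset_cong) auto
  also have "\<dots> = sum_mset (image_mset mset_set (mset_set E))"
    by (simp flip: P add: image_mset.compositionality comp_def)
  also have "\<dots> = (\<Sum>e\<in>E. mset_set e)" by (simp add: sum_unfold_sum_mset)
  also have "\<dots> = mset_set (vertices r s)"
  proof (rule multiset_eqI)
    fix v
    have fin: "finite e" if "e \<in> E" for e using E(2)[OF that] card_ge_0_finite[of e] by simp
    have "count (\<Sum>e\<in>E. mset_set e) v = (\<Sum>e\<in>E. count (mset_set e) v)" by (rule count_sum)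
    also have "\<dots> = (\<Sum>e\<in>E. if v \<in> e then 1 else 0)"
      by (rule sum.cong) (use fin in \<open>auto simp: count_mset_set'\<close>)
    also have "\<dots> = card {e \<in> E. v \<in> e}" using E(1) by (simp add: sum.If_cases Int_def)
    also have "\<dots> = (if v \<in> vertices r s then 1 else 0)"
    proof (cases "v \<in> vertices r s")
      case True
      then obtain e where e: "e \<in> E" "v \<in> e" using partition_onD1[OF E(3)] by blast
      have "e' = e" if "e' \<in> E" "v \<in> e'" for e'
        using pairwiseD[OF partition_onD2[OF E(3)] that(1) e(1)] that e by (auto simp: disjnt_def)
      hence "{e \<in> E. v \<in> e} = {e}" using e by blast
      thus ?thesis using True by simp
    next
      case False
      hence none: "{e \<in> E. v \<in> e} = {}" using partition_onD1[OF E(3)] by blast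
      show ?thesis unfolding none using False by simp
    qed
    finally show "count (\<Sum>e\<in>E. mset_set e) v = count (mset_set (vertices r s)) v"
      by (simp add: count_mset_set')
  qed
  finally show ?thesis .
qed

lemma edge_marks_mark_map:
  assumes "inj \<rho>"
  shows "edge_marks (\<rho> u) (\<rho> w) h (mark_map \<rho> m) = edge_marks u w h m"
proof (cases m)
  case (BeadOn e)
  have "\<rho> ` e = {\<rho> u, \<rho> w} \<longleftrightarrow> e = {u, w}"
    using inj_image_eq_iff[OF assms, of e "{u, w}"] by simp
  thus ?thesis using BeadOn by simp
next
  case (ArrowOn x y)
  thus ?thesis using assms by (simp add: inj_eq)
qed

text \<open>The renaming \<sigma> that arises in a composition passes through the middle row and
  agrees with the injective relabelling \<rho> only at vertices that occur as ends.\<close>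

lemma depicts_rename:
  assumes P: "depicts ht (E, ms) P" and inj: "inj \<rho>" and \<sigma>: "\<And>v. v \<in># ends P \<Longrightarrow> \<sigma> v = \<rho> v"
  shows "depicts ht ((`) \<rho> ` E, map (mark_map \<rho>) ms) (rename_ends \<sigma> P)"
proof -
  have ren: "rename_ends \<sigma> P = rename_ends \<rho> P" using \<sigma> by (rule rename_ends_cong)
  have "image_mset (\<lambda>(u, xs, w). {u, w}) (rename_ends \<rho> P) =
      image_mset ((`) \<rho>) (image_mset (\<lambda>(u, xs, w). {u, w}) P)"
    by (induction P) auto
  also have "\<dots> = image_mset ((`) \<rho>) (mset_set E)"
    using P by (simp add: depicts_def)
  also have "\<dots> = mset_set ((`) \<rho> ` E)"
    by (rule image_mset_mset_set) (use inj in \<open>auto simp: inj_on_def inj_image_eq_iff\<close>)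
  finally have "image_mset (\<lambda>(u, xs, w). {u, w}) (rename_ends \<sigma> P) = mset_set ((`) \<rho> ` E)"
    unfolding ren .
  moreover have "xs = concat (map (\<lambda>i. edge_marks u w (ht i) (map (mark_map \<rho>) ms ! i)) [0..<length ms])"
    if st: "(u, xs, w) \<in># rename_ends \<sigma> P" for u xs w
  proof -
    obtain u' w' where uw: "(u', xs, w') \<in># P" "u = \<rho> u'" "w = \<rho> w'"
      using st[unfolded ren] unfolding rename_ends_def by auto
    have "xs = concat (map (\<lambda>i. edge_marks u' w' (ht i) (ms ! i)) [0..<length ms])"
      using P uw(1) by (auto simp: depicts_def)
    also have "\<dots> = concat (map (\<lambda>i. edge_marks u w (ht i) (map (mark_map \<rho>) ms ! i)) [0..<length ms])"
      unfolding uw(2,3) by (intro arg_cong[where f = concat] map_cong) (auto simp: edge_marks_mark_map[OF inj])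
    finally show ?thesis .
  qed
  ultimately show ?thesis using P by (auto simp: depicts_def)
qed

text \<open>The edges of a permutation diagram are unmarked and each is attached to one top vertex
  of \<open>E\<close>, so the composite is \<open>E\<close> with its top vertices renamed, and all
  steps used have coefficient 1.\<close>

lemma composition_permute_top:
  assumes E: "brauer_diagram r s E" and \<tau>: "inj \<tau>"
  shows "composition_yields \<delta> \<epsilon> ((\<lambda>j. {Top (\<tau> j), Bot j}) ` {..<r}, []) (E, ms) 1
    ((`) (vmap \<tau> id) ` E, map (mark_map (vmap \<tau> id)) ms)"
proof -
  \<comment> \<open>The strands are read upwards, so that after \<open>bottom_to_middle\<close> they
    start at middle vertices as \<open>connect_all\<close> expects.\<close>
  let ?P1 = "image_mset (\<lambda>j. (Bot j, [], Top (\<tau> j))) (mset_set {..<r}) :: strand multiset"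
  have "inj_on (\<lambda>j. {Top (\<tau> j), Bot j}) {..<r}" by (auto simp: inj_on_def doubleton_eq_iff)
  hence P1: "depicts id ((\<lambda>j. {Top (\<tau> j), Bot j}) ` {..<r}, []) ?P1"
    by (auto simp: depicts_def image_mset.compositionality comp_def strict_mono_def insert_commute
        simp flip: image_mset_mset_set)
  have ht: "strict_mono (\<lambda>i::nat. i)" by (simp add: strict_mono_def)
  obtain P where P: "depicts (\<lambda>i. i) (E, ms) P"
    using depicts_exists[OF brauer_finite[OF E] _ ht] E by (auto simp: brauer_diagram_def)
  note ends = ends_depicts[OF P E]
  have inj: "inj_on top_to_middle (vertices r s)" by (auto simp: inj_on_def vertices_def)
  have "ends (rename_ends top_to_middle P) = mset_set (top_to_middle ` vertices r s)"
    by (simp add: ends_rename ends image_mset_mset_set[OF inj])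
  moreover have "Mid j \<in> top_to_middle ` vertices r s" if "j < r" for j
    using that by (force simp: vertices_def image_iff)
  ultimately have "simplifies \<delta> \<epsilon> (image_mset (\<lambda>j. (Mid j, [], Top (\<tau> j))) (mset_set {..<r}) +
      rename_ends top_to_middle P) 1 (rename_ends (connect {..<r} (\<lambda>j. Top (\<tau> j))) (rename_ends top_to_middle P))"
    by (intro connect_all) simp_all
  moreover have "rename_ends bottom_to_middle ?P1 = image_mset (\<lambda>j. (Mid j, [], Top (\<tau> j))) (mset_set {..<r})"
    by (simp add: rename_ends_def image_mset.compositionality comp_def)
  moreover have "depicts (\<lambda>i. i) ((`) (vmap \<tau> id) ` E, map (mark_map (vmap \<tau> id)) ms)
      (rename_ends (connect {..<r} (\<lambda>j. Top (\<tau> j))) (rename_ends top_to_middle P))"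
    unfolding rename_ends_compose
  proof (rule depicts_rename[OF P inj_vmap[OF \<tau> inj_on_id]])
    show "connect {..<r} (\<lambda>j. Top (\<tau> j)) (top_to_middle v) = vmap \<tau> id v" if "v \<in># ends P" for v
      using that by (auto simp: ends vertices_def connect_def)
  qed
  moreover have "(+) (0 :: nat) = (\<lambda>i. i)" by (simp add: fun_eq_iff)
  ultimately show ?thesis unfolding composition_yields_def using P1 P
    by (intro exI[of _ ?P1] exI[of _ P] exI[of _ "\<lambda>i. i"]
        exI[of _ "rename_ends (connect {..<r} (\<lambda>j. Top (\<tau> j))) (rename_ends top_to_middle P)"]) simp
qed

lemma composition_permute_bottom:
  assumes E: "brauer_diagram r s E" and \<tau>: "inj \<tau>"
  shows "composition_yields \<delta> \<epsilon> (E, ms) ((\<lambda>j. {Top j, Bot (\<tau> j)}) ` {..<s}, []) 1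
    ((`) (vmap id \<tau>) ` E, map (mark_map (vmap id \<tau>)) ms)"
proof -
  let ?P2 = "image_mset (\<lambda>j. (Top j, [], Bot (\<tau> j))) (mset_set {..<s}) :: strand multiset"
  have "inj_on (\<lambda>j. {Top j, Bot (\<tau> j)}) {..<s}" by (auto simp: inj_on_def doubleton_eq_iff)
  hence P2: "depicts ((+) (length ms)) ((\<lambda>j. {Top j, Bot (\<tau> j)}) ` {..<s}, []) ?P2"
    by (auto simp: depicts_def image_mset.compositionality comp_def strict_mono_def insert_commute
        simp flip: image_mset_mset_set)
  have ht: "strict_mono (id :: nat \<Rightarrow> nat)" by (simp add: strict_mono_def)
  obtain P where P: "depicts id (E, ms) P"
    using depicts_exists[OF brauer_finite[OF E] _ ht] E by (auto simp: brauer_diagram_def)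
  note ends = ends_depicts[OF P E]
  have inj: "inj_on bottom_to_middle (vertices r s)" by (auto simp: inj_on_def vertices_def)
  have "ends (rename_ends bottom_to_middle P) = mset_set (bottom_to_middle ` vertices r s)"
    by (simp add: ends_rename ends image_mset_mset_set[OF inj])
  moreover have "Mid j \<in> bottom_to_middle ` vertices r s" if "j < s" for j
    using that by (force simp: vertices_def image_iff)
  ultimately have "simplifies \<delta> \<epsilon> (image_mset (\<lambda>j. (Mid j, [], Bot (\<tau> j))) (mset_set {..<s}) +
      rename_ends bottom_to_middle P) 1
      (rename_ends (connect {..<s} (\<lambda>j. Bot (\<tau> j))) (rename_ends bottom_to_middle P))"
    by (intro connect_all) simp_all
  moreover have "rename_ends top_to_middle ?P2 = image_mset (\<lambda>j. (Mid j, [], Bot (\<tau> j))) (mset_set {..<s})"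
    by (simp add: rename_ends_def image_mset.compositionality comp_def)
  moreover have "depicts id ((`) (vmap id \<tau>) ` E, map (mark_map (vmap id \<tau>)) ms)
      (rename_ends (connect {..<s} (\<lambda>j. Bot (\<tau> j))) (rename_ends bottom_to_middle P))"
    unfolding rename_ends_compose
  proof (rule depicts_rename[OF P inj_vmap[OF inj_on_id \<tau>]])
    show "connect {..<s} (\<lambda>j. Bot (\<tau> j)) (bottom_to_middle v) = vmap id \<tau> v" if "v \<in># ends P" for v
      using that by (auto simp: ends vertices_def connect_def)
  qed
  ultimately show ?thesis unfolding composition_yields_def using P2 P
    by (intro exI[of _ P] exI[of _ ?P2] exI[of _ id]
        exI[of _ "rename_ends (connect {..<s} (\<lambda>j. Bot (\<tau> j))) (rename_ends bottom_to_middle P)"])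
      (simp add: add.commute)
qed

section \<open>Orthogonal pairs\<close>

context super_form
begin

lemma form_add_left: "b (x + y) z = b x z + b y z" and form_scale_left: "b (scale c x) z = c * b x z"
  using linear_left[of z] by (simp_all add: linear_form_iff)

lemma form_add_right: "b z (x + y) = b z x + b z y" and form_scale_right: "b z (scale c x) = c * b z x"
  using linear_right[of z] by (simp_all add: linear_form_iff)

lemma form_0_left [simp]: "b 0 z = 0" and form_0_right [simp]: "b z 0 = 0"
  using form_scale_left[of 0 0 z] form_scale_right[of z 0 0] by simp_all

lemma form_diff_left: "b (x - y) z = b x z - b y z"
  using form_add_left[of "x - y" y z] by simp

lemma form_diff_right: "b z (x - y) = b z x - b z y"
  using form_add_right[of z "x - y" y] by simp

lemma form_zero_sym:
  assumes "x \<in> V p" "y \<in> V q"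
  shows "b x y = 0 \<longleftrightarrow> b y x = 0"
  using symmetric[OF assms] by simp

lemma orthogonal_span:
  assumes "u \<in> span S" "\<And>s. s \<in> S \<Longrightarrow> b z s = 0"
  shows "b z u = 0"
  using assms(1)
proof (rule span_induct_alt)
  show "b z 0 = 0" by simp
  show "b z (scale c x + y) = 0" if "x \<in> S" "b z y = 0" for c x y
    using that assms(2) by (simp add: form_add_right form_scale_right)
qed

text \<open>At most one component of \<open>w\<close> has the degree that can pair with
  \<open>x\<close>. Its value is then the whole of \<open>b w x\<close>, and the other component
  gives 0 by homogeneity.\<close>

lemma orthogonal_proj:
  assumes x: "x \<in> V q" and wx: "b w x = 0"
  shows "b (grade_proj V p w) x = 0"
proof (cases "p + q = \<beta>")
  case True
  have "b (grade_proj V (p + 1) w) x = 0"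
    by (rule homogeneous[OF V.proj_mem(1)[OF UNIV_I] x]) (use True in \<open>cases p; cases q; simp\<close>)
  moreover have "w = grade_proj V p w + grade_proj V (p + 1) w"
    using V.proj_sum[OF UNIV_I, of w] by (cases p) (simp_all add: add.commute)
  ultimately show ?thesis using wx form_add_left[of "grade_proj V p w" "grade_proj V (p + 1) w" x] by simp
next
  case False
  thus ?thesis by (intro homogeneous[OF V.proj_mem(1)[OF UNIV_I] x])
qed

text \<open>A homogeneous vector orthogonal to \<open>S\<close> pairs nontrivially with another one because the
  complement of \<open>S\<close> represents all vectors modulo the span of \<open>S\<close>.\<close>

lemma orthogonal_step:
  assumes S: "\<forall>s\<in>S. \<exists>p. s \<in> V p"
    and proj: "\<And>u. \<exists>w. u - w \<in> span S \<and> (\<forall>s\<in>S. b w s = 0)"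
    and u: "u \<notin> span S"
  shows "\<exists>p q x y. x \<in> V p \<and> y \<in> V q \<and> b x y \<noteq> 0 \<and> (\<forall>s\<in>S. b x s = 0 \<and> b y s = 0) \<and>
    (\<forall>u. \<exists>w. u - w \<in> span (insert x (insert y S)) \<and> (\<forall>s\<in>insert x (insert y S). b w s = 0))"
proof -
  obtain w where w: "u - w \<in> span S" "\<forall>s\<in>S. b w s = 0" using proj by blast
  have "w \<noteq> 0" using w(1) u by auto
  hence "grade_proj V 0 w \<noteq> 0 \<or> grade_proj V 1 w \<noteq> 0"
    using V.proj_sum[of w] by auto
  then obtain p where p: "grade_proj V p w \<noteq> 0" by blast
  \<comment> \<open>Passing to a component keeps orthogonality to \<open>S\<close>, since all
    members of \<open>S\<close> are homogeneous.\<close>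
  define x where "x = grade_proj V p w"
  have x: "x \<in> V p" "x \<noteq> 0" and xS: "\<forall>s\<in>S. b x s = 0"
    using p V.proj_mem(1) orthogonal_proj w(2) S unfolding x_def by blast+
  have ex: "\<exists>q y. y \<in> V q \<and> b x y \<noteq> 0 \<and> (\<forall>s\<in>S. b y s = 0)"
  proof -
    obtain u' where u': "b x u' \<noteq> 0" using nondegenerate[OF x(2)] by blast
    \<comment> \<open>\<open>x\<close> is orthogonal to \<open>S\<close>, so replacing
      \<open>u'\<close> by its representative orthogonal to \<open>S\<close> does not change the
      pairing with \<open>x\<close>.\<close>
    obtain w' where w': "u' - w' \<in> span S" "\<forall>s\<in>S. b w' s = 0" using proj by blast
    have "b x (u' - w') = 0" by (rule orthogonal_span[OF w'(1)]) (use xS in blast)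
    hence "b x w' \<noteq> 0" using u' by (simp add: form_diff_right)
    hence "b x (grade_proj V 0 w') \<noteq> 0 \<or> b x (grade_proj V 1 w') \<noteq> 0"
      using V.proj_sum[of w'] form_add_right[of x "grade_proj V 0 w'" "grade_proj V 1 w'"] by auto
    moreover have "\<forall>s\<in>S. b (grade_proj V q w') s = 0" for q
      using orthogonal_proj w'(2) S by blast
    moreover have "grade_proj V q w' \<in> V q" for q by (simp add: V.proj_mem)
    ultimately show ?thesis by blast
  qed
  \<comment> \<open>If \<open>x\<close> is not isotropic it serves as its own partner. Otherwise
    \<open>b x x = 0\<close>, and the equations solved below for the new complement are
    triangular.\<close>
  have "\<exists>q y. y \<in> V q \<and> b x y \<noteq> 0 \<and> (\<forall>s\<in>S. b y s = 0) \<and> (y = x \<or> b x x = 0)"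
  proof (cases "b x x = 0")
    case True
    thus ?thesis using ex by simp
  next
    case False
    thus ?thesis using x xS by (intro exI[of _ p] exI[of _ x]) simp
  qed
  then obtain q y where y: "y \<in> V q" "b x y \<noteq> 0" "\<forall>s\<in>S. b y s = 0" and xx: "y = x \<or> b x x = 0"
    by (elim exE conjE)
  have yx: "b y x \<noteq> 0" using form_zero_sym[OF x(1) y(1)] y(2) by simp
  have "\<exists>w. u - w \<in> span (insert x (insert y S)) \<and> (\<forall>s\<in>insert x (insert y S). b w s = 0)" for u
  proof -
    obtain w where w: "u - w \<in> span S" "\<forall>s\<in>S. b w s = 0" using proj by blast
    \<comment> \<open>Solve \<open>b ?w x = 0\<close> and \<open>b ?w y = 0\<close> for the
      coefficients of \<open>y\<close> and \<open>x\<close>. As \<open>b x x = 0\<close> unless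
      \<open>y = x\<close>, the first equation determines \<alpha> alone, the second then gives
      \<gamma>. If \<open>y = x\<close> there is a single equation and \<gamma> is set to 0.\<close>
    define \<alpha> where "\<alpha> = b w x / b y x"
    define \<gamma> where "\<gamma> = (if y = x then 0 else (b w y - \<alpha> * b y y) / b x y)"
    let ?w = "w - scale \<alpha> y - scale \<gamma> x"
    have "b ?w x = 0" "b ?w y = 0"
      using xx y(2) yx by (auto simp: form_diff_left form_scale_left \<alpha>_def \<gamma>_def)
    moreover have "\<forall>s\<in>S. b ?w s = 0" using w(2) y(3) xS by (simp add: form_diff_left form_scale_left)
    moreover have "u - ?w \<in> span (insert x (insert y S))"
    proof -
      have "u - ?w = (u - w) + (scale \<alpha> y + scale \<gamma> x)" by (simp add: algebra_simps)
      moreover have "u - w \<in> span (insert x (insert y S))" using w(1) span_mono[of S "insert x (insert y S)"] by blast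
      moreover have "x \<in> span (insert x (insert y S))" "y \<in> span (insert x (insert y S))"
        by (simp_all add: span_base)
      ultimately show ?thesis by (simp only: span_add span_scale)
    qed
    ultimately show ?thesis by blast
  qed
  moreover have "\<forall>s\<in>S. b x s = 0 \<and> b y s = 0" using xS y(3) by blast
  ultimately show ?thesis using x(1) y(1,2) by (intro exI[of _ p] exI[of _ q] exI[of _ x] exI[of _ y]) simp
qed

text \<open>The last conjunct is the invariant that keeps the construction going: modulo the chosen
  vectors, every vector is represented by one orthogonal to them. The chosen vectors number at most
  twice the pairs, since \<open>x k = y k\<close> may occur, and hence do not span until
  \<open>card B\<close> is reached.\<close>

lemma orthogonal_pairs:
  assumes "2 * N \<le> card B" "independent B"
  shows "\<exists>x y :: nat \<Rightarrow> 'v. (\<forall>k<N. (\<exists>p. x k \<in> V p) \<and> (\<exists>q. y k \<in> V q) \<and> b (x k) (y k) \<noteq> 0) \<and>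
    (\<forall>k<N. \<forall>l<N. k \<noteq> l \<longrightarrow> (\<forall>s\<in>{x k, y k}. \<forall>t\<in>{x l, y l}. b s t = 0)) \<and>
    (\<forall>u. \<exists>w. u - w \<in> span (x ` {..<N} \<union> y ` {..<N}) \<and> (\<forall>s\<in>x ` {..<N} \<union> y ` {..<N}. b w s = 0))"
  using assms(1)
proof (induction N)
  case 0
  show ?case by (auto intro: exI[of _ u for u])
next
  case (Suc N)
  hence "2 * N \<le> card B" by simp
  from Suc.IH[OF this] obtain x y
    where homog: "\<forall>k<N. (\<exists>p. x k \<in> V p) \<and> (\<exists>q. y k \<in> V q) \<and> b (x k) (y k) \<noteq> 0"
    and orth: "\<forall>k<N. \<forall>l<N. k \<noteq> l \<longrightarrow> (\<forall>s\<in>{x k, y k}. \<forall>t\<in>{x l, y l}. b s t = 0)"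
    and proj: "\<forall>u. \<exists>w. u - w \<in> span (x ` {..<N} \<union> y ` {..<N}) \<and> (\<forall>s\<in>x ` {..<N} \<union> y ` {..<N}. b w s = 0)"
    by (elim exE conjE)
  let ?S = "x ` {..<N} \<union> y ` {..<N}"
  have "card ?S \<le> card (x ` {..<N}) + card (y ` {..<N})" by (rule card_Un_le)
  also have "\<dots> \<le> N + N" by (intro add_mono) (metis card_image_le card_lessThan finite_lessThan)+
  finally have "card ?S < card B" using Suc.prems by simp
  hence "\<not> B \<subseteq> span ?S" using independent_span_bound[of ?S B] assms(2) by fastforce
  then obtain u where u: "u \<notin> span ?S" by blast
  have homS: "\<forall>s\<in>?S. \<exists>p. s \<in> V p" using homog by auto
  obtain p q x' y' where xy: "x' \<in> V p" "y' \<in> V q" "b x' y' \<noteq> 0" "\<forall>s\<in>?S. b x' s = 0 \<and> b y' s = 0"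
    and proj': "\<forall>u. \<exists>w. u - w \<in> span (insert x' (insert y' ?S)) \<and> (\<forall>s\<in>insert x' (insert y' ?S). b w s = 0)"
    using orthogonal_step[OF homS proj[rule_format] u] by (elim exE conjE)
  let ?x = "x(N := x')" and ?y = "y(N := y')"
  have S: "?x ` {..<Suc N} \<union> ?y ` {..<Suc N} = insert x' (insert y' ?S)"
    by (auto simp: lessThan_Suc)
  \<comment> \<open>Orthogonality was obtained with the new vectors on the left; for homogeneous
    vectors it is symmetric.\<close>
  have sym: "b s x' = 0 \<and> b s y' = 0" if "s \<in> ?S" for s
    using bspec[OF homS that] bspec[OF xy(4) that] form_zero_sym[OF xy(1)] form_zero_sym[OF xy(2)] by blast
  show ?case
  proof (rule exI[of _ ?x], rule exI[of _ ?y], intro conjI)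
    show "\<forall>k<Suc N. (\<exists>p. ?x k \<in> V p) \<and> (\<exists>q. ?y k \<in> V q) \<and> b (?x k) (?y k) \<noteq> 0"
      using homog xy(1-3) by (auto simp: less_Suc_eq)
    show "\<forall>k<Suc N. \<forall>l<Suc N. k \<noteq> l \<longrightarrow> (\<forall>s\<in>{?x k, ?y k}. \<forall>t\<in>{?x l, ?y l}. b s t = 0)"
    proof (intro allI impI)
      fix k l assume kl: "k < Suc N" "l < Suc N" "k \<noteq> l"
      consider "k < N" "l < N" | "k = N" "l < N" | "k < N" "l = N" using kl by linarith
      thus "\<forall>s\<in>{?x k, ?y k}. \<forall>t\<in>{?x l, ?y l}. b s t = 0"
      proof cases
        case 1
        thus ?thesis using orth kl by simp
      next
        case 2
        thus ?thesis using xy(4) by simp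
      next
        case 3
        thus ?thesis using sym[of "x k"] sym[of "y k"] by simp
      qed
    qed
    show "\<forall>u. \<exists>w. u - w \<in> span (?x ` {..<Suc N} \<union> ?y ` {..<Suc N}) \<and>
        (\<forall>s\<in>?x ` {..<Suc N} \<union> ?y ` {..<Suc N}. b w s = 0)"
      unfolding S by (rule proj')
  qed
qed

subsection \<open>Evaluation of tensors on products of the form\<close>

text \<open>The product of the forms \<open>b _ w\<close> over the entries of the first argument,
  taken without any signs.\<close>

definition pair :: "'v list \<Rightarrow> 'v list \<Rightarrow> complex" where
  "pair w vs = prod_list (map2 b vs w)"

lemma pair_append: "length vs = length w \<Longrightarrow> pair (w @ w') (vs @ vs') = pair w vs * pair w' vs'"
  by (simp add: pair_def)

lemma pair_simps [simp]: "pair [] [] = 1" "pair (w # ws) (v # vs) = b v w * pair ws vs"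
  by (simp_all add: pair_def)

lemma mform_pair:
  assumes "length w = s"
  shows "mform s (pair w)"
proof -
  have "pair w (vs[i := x]) = pair (take i w) (take i vs) * (b x (w ! i) * pair (drop (Suc i) w) (drop (Suc i) vs))"
    if "length vs = s" "i < s" for vs i x
  proof -
    have "pair w (vs[i := x]) = pair (take i w @ w ! i # drop (Suc i) w) (take i vs @ x # drop (Suc i) vs)"
      using that assms by (simp add: upd_conv_take_nth_drop Cons_nth_drop_Suc)
    also have "\<dots> = pair (take i w) (take i vs) * (b x (w ! i) * pair (drop (Suc i) w) (drop (Suc i) vs))"
      using that assms by (subst pair_append) simp_all
    finally show ?thesis .
  qed
  thus ?thesis unfolding mform_iff by (simp add: form_add_left form_scale_left algebra_simps)
qed

end

fun vec :: "'v list \<Rightarrow> 'v::zero list \<Rightarrow> vertex \<Rightarrow> 'v" where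
  "vec v w (Top i) = v ! i"
| "vec v w (Mid i) = 0"
| "vec v w (Bot i) = w ! i"

section \<open>The functor on diagrams\<close>

locale brauer_setting = super_form scale V m n b \<beta>
  for scale :: "complex \<Rightarrow> 'v::ab_group_add \<Rightarrow> 'v" and V m n b \<beta> +
  fixes e e' :: "nat \<Rightarrow> 'v" and F
  assumes basis: "homogeneous_basis scale V (m + n) e" and basis': "homogeneous_basis scale V (m + n) e'"
    and dual: "\<And>i j. i < m + n \<Longrightarrow> j < m + n \<Longrightarrow> b (e i) (e' j) = (if i = j then 1 else 0)"
    and functoriality: "brauer_functor scale V b (of_nat m - of_nat n) (psgn \<beta>) (m + n) e e' F"
begin

definition FD :: "nat \<Rightarrow> nat \<Rightarrow> mdiagram \<Rightarrow> 'v tensor \<Rightarrow> 'v tensor" where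
  "FD r s D = F r s (diagram_class (psgn \<beta>) r s D)"

lemmas functor_conjuncts = functoriality[unfolded brauer_functor_def]

lemma F_lincomb:
  assumes "x \<in> diagram_span r s" "y \<in> diagram_span r s"
  shows "F r s (brauer_class (psgn \<beta>) r s (fscale a x + fscale c y)) t =
    fscale a (F r s (brauer_class (psgn \<beta>) r s x) t) + fscale c (F r s (brauer_class (psgn \<beta>) r s y) t)"
  by (rule functor_conjuncts[THEN conjunct2, THEN conjunct1, rule_format, OF assms])

lemma FD_compose:
  assumes "D1 \<in> marked_diagrams r s" "D2 \<in> marked_diagrams s u" "D \<in> marked_diagrams r u"
    and "composition_yields (of_nat m - of_nat n) (psgn \<beta>) D1 D2 1 D"
  shows "FD s u D2 (FD r s D1 t) = FD r u D t"
proof -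
  have "F s u (diagram_class (psgn \<beta>) s u D2) (F r s (diagram_class (psgn \<beta>) r s D1) t) =
      fscale 1 (F r u (diagram_class (psgn \<beta>) r u D) t)"
    by (rule functor_conjuncts[THEN conjunct2, THEN conjunct2, THEN conjunct1, rule_format, OF assms])
  thus ?thesis by (simp add: FD_def)
qed

lemma FD_tensor:
  assumes "D1 \<in> marked_diagrams r s" "D2 \<in> marked_diagrams r' s'"
  shows "FD (r + r') (s + s') (tensor_diagram r s D1 D2) = tensor_map scale V r s r' (FD r s D1) (FD r' s' D2)"
  unfolding FD_def by (rule functor_conjuncts[THEN conjunct2, THEN conjunct2, THEN conjunct2, THEN conjunct1, rule_format, OF assms])

lemma FD_id: "t \<in> T r \<Longrightarrow> FD r r (id_diagram r) t = t"
  unfolding FD_def by (rule functor_conjuncts[THEN conjunct2, THEN conjunct2, THEN conjunct2, THEN conjunct2, THEN conjunct1, rule_format])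

lemma FD_cross: "v \<in> V p \<Longrightarrow> w \<in> V q \<Longrightarrow>
    FD 2 2 cross_diagram (pur [v, w]) = fscale (psgn (p * q)) (pur [w, v])"
  unfolding FD_def by (rule functor_conjuncts[THEN conjunct2, THEN conjunct2, THEN conjunct2, THEN conjunct2, THEN conjunct2, THEN conjunct1, rule_format])

lemma FD_cup: "FD 2 0 cup_diagram (pur [v, w]) = fscale (b v w) (pur [])"
  unfolding FD_def by (rule functor_conjuncts[THEN conjunct2, THEN conjunct2, THEN conjunct2, THEN conjunct2, THEN conjunct2, THEN conjunct2, THEN conjunct1, rule_format])

lemma FD_cap: "FD 0 2 cap_diagram (pur []) = (\<Sum>i<m + n. fscale (psgn (degree_of V (e i))) (pur [e i, e' i]))"
  unfolding FD_def by (rule functor_conjuncts[THEN conjunct2, THEN conjunct2, THEN conjunct2, THEN conjunct2, THEN conjunct2, THEN conjunct2, THEN conjunct2, rule_format])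

section \<open>Linearity of the functor on classes of diagrams\<close>

lemma single_in_span: "D \<in> marked_diagrams r s \<Longrightarrow> single D \<in> diagram_span r s"
  unfolding diagram_span_def by (intro cfun.span_base imageI)

lemma linear_on_FD:
  assumes "D \<in> marked_diagrams r s"
  shows "linear_on r s (FD r s D)"
proof -
  have "diagram_class (psgn \<beta>) r s D \<in> brauer_space (psgn \<beta>) r s"
    unfolding diagram_class_def brauer_space_def using single_in_span[OF assms] by blast
  moreover have "F r s ` brauer_space (psgn \<beta>) r s \<subseteq> equivariant_Hom scale V b r s"
    by (rule functor_conjuncts[THEN conjunct1, THEN spec, THEN spec])
  ultimately have "FD r s D \<in> tensor_Hom scale r s"
    unfolding FD_def equivariant_Hom_def by blast
  thus ?thesis by (simp add: tensor_Hom_def linear_on_def)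
qed

lemma brauer_class_cong:
  assumes "x - y \<in> diagram_relations \<epsilon> r s"
  shows "brauer_class \<epsilon> r s x = brauer_class \<epsilon> r s y"
proof -
  have "z - x \<in> diagram_relations \<epsilon> r s \<longleftrightarrow> z - y \<in> diagram_relations \<epsilon> r s" for z
  proof
    assume "z - x \<in> diagram_relations \<epsilon> r s"
    hence "(z - x) + (x - y) \<in> diagram_relations \<epsilon> r s"
      using assms by (rule cfun.subspace_add[OF relations_subspace])
    thus "z - y \<in> diagram_relations \<epsilon> r s" by simp
  next
    assume "z - y \<in> diagram_relations \<epsilon> r s"
    hence "(z - y) - (x - y) \<in> diagram_relations \<epsilon> r s"
      using assms by (rule cfun.subspace_diff[OF relations_subspace])
    thus "z - x \<in> diagram_relations \<epsilon> r s" by simp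
  qed
  thus ?thesis by (simp add: brauer_class_def)
qed

lemma FD_class_eq:
  assumes "class_eq (psgn \<beta>) r s D D'" "D' \<in> marked_diagrams r s"
  shows "\<exists>c. c \<noteq> 0 \<and> (\<forall>t. FD r s D t = fscale c (FD r s D' t))"
proof -
  obtain c where c: "c \<noteq> 0" "single D - fscale c (single D') \<in> diagram_relations (psgn \<beta>) r s"
    using assms(1) by (auto simp: class_eq_def)
  have "brauer_class (psgn \<beta>) r s (single D) =
      brauer_class (psgn \<beta>) r s (fscale c (single D') + fscale 0 (single D'))"
    using brauer_class_cong[OF c(2)] by simp
  hence "FD r s D t = fscale c (FD r s D' t)" for t
    using F_lincomb[OF single_in_span[OF assms(2)] single_in_span[OF assms(2)], of c 0 t]
    by (simp add: FD_def diagram_class_def)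
  with c(1) show ?thesis by blast
qed

text \<open>An edge has no direction, so it is tested in both orders. For homogeneous vectors the
  two conditions are equivalent.\<close>

definition nonzero_on :: "'v list \<Rightarrow> 'v list \<Rightarrow> vertex set set \<Rightarrow> bool" where
  "nonzero_on v w E \<longleftrightarrow> (\<forall>x y. {x, y} \<in> E \<longrightarrow> b (vec v w x) (vec v w y) \<noteq> 0)"

text \<open>Recording only when values vanish avoids all signs.\<close>

definition good :: "nat \<Rightarrow> nat \<Rightarrow> vertex set set \<Rightarrow> bool" where
  "good r s E \<longleftrightarrow> (\<forall>ms v w. (E, ms) \<in> marked_diagrams r s \<longrightarrow> length v = r \<longrightarrow> length w = s \<longrightarrow>
     homs v \<longrightarrow> homs w \<longrightarrow> (FD r s (E, ms) (pur v) (pair w) \<noteq> 0 \<longleftrightarrow> nonzero_on v w E))"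

lemma goodD:
  assumes "good r s E" "(E, ms) \<in> marked_diagrams r s" "length v = r" "length w = s" "homs v" "homs w"
  shows "FD r s (E, ms) (pur v) (pair w) \<noteq> 0 \<longleftrightarrow> nonzero_on v w E"
  using assms unfolding good_def by blast

text \<open>One marking suffices, because any other one changes the class of the diagram by a
  nonzero factor.\<close>

lemma goodI:
  assumes ms: "(E, ms) \<in> marked_diagrams r s"
    and *: "\<And>v w. length v = r \<Longrightarrow> length w = s \<Longrightarrow> homs v \<Longrightarrow> homs w \<Longrightarrow>
      FD r s (E, ms) (pur v) (pair w) \<noteq> 0 \<longleftrightarrow> nonzero_on v w E"
  shows "good r s E"
  unfolding good_def
proof (intro allI impI)
  fix ms' v w
  assume ms': "(E, ms') \<in> marked_diagrams r s" and vw: "length v = r" "length w = s" "homs v" "homs w"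
  have "class_eq (psgn \<beta>) r s (E, ms') (E, ms)"
    using class_eq_markings[of E "[]" ms' r s ms] ms ms' by simp
  then obtain c where "c \<noteq> 0" "\<forall>t. FD r s (E, ms') t = fscale c (FD r s (E, ms) t)"
    using FD_class_eq ms by blast
  thus "FD r s (E, ms') (pur v) (pair w) \<noteq> 0 \<longleftrightarrow> nonzero_on v w E"
    using *[OF vw] by (simp add: fscale_def)
qed

subsection \<open>Transpositions\<close>

definition flip :: "nat \<Rightarrow> nat \<Rightarrow> nat" where
  "flip i j = (if j = i then Suc i else if j = Suc i then i else j)"

lemma flip_flip [simp]: "flip i (flip i j) = j"
  by (simp add: flip_def)

lemma inj_flip: "inj (flip i)"
  by (metis flip_flip injI)

lemma flip_less: "Suc i < r \<Longrightarrow> flip i j < r \<longleftrightarrow> j < r"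
  by (auto simp: flip_def)

lemma flip_image:
  assumes "Suc i < r"
  shows "flip i ` {..<r} = {..<r}"
proof (intro equalityI subsetI)
  show "j \<in> flip i ` {..<r}" if "j \<in> {..<r}" for j
    using that flip_less[OF assms] by (intro image_eqI[of _ _ "flip i j"]) simp_all
qed (use flip_less[OF assms] in auto)

lemma nth_flip: "(us @ [c, a] @ vs) ! j = (us @ [a, c] @ vs) ! flip (length us) j"
  by (auto simp: flip_def nth_append nth_Cons split: nat.splits)

lemma id_diagram_marked: "id_diagram r \<in> marked_diagrams r r"
proof -
  let ?E = "(\<lambda>i. {Top i, Bot i}) ` {..<r}"
  have "brauer_diagram r r ?E"
    unfolding brauer_diagram_def by (intro conjI partition_onI) (auto simp: vertices_def disjnt_def)
  moreover have "cups ?E = {}" "caps ?E = {}" by (auto simp: cups_def caps_def)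
  ultimately show ?thesis by (simp add: id_diagram_def marked_diagrams_def)
qed

lemma vertices_small: "vertices 2 2 = {Top 0, Top 1, Bot 0, Bot 1}" "vertices 2 0 = {Top 0, Top 1}"
  "vertices 0 2 = {Bot 0, Bot 1}" "vertices 1 1 = {Top 0, Bot 0}"
  by (auto simp: vertices_def lessThan_Suc numeral_2_eq_2)

lemma cross_diagram_marked: "cross_diagram \<in> marked_diagrams 2 2"
proof -
  let ?E = "{{Top 0, Bot 1}, {Top 1, Bot 0}}"
  have "brauer_diagram 2 2 ?E"
    unfolding brauer_diagram_def vertices_small by (intro conjI partition_onI) (auto simp: disjnt_def)
  moreover have "cups ?E = {}" "caps ?E = {}" by (auto simp: cups_def caps_def)
  ultimately show ?thesis by (simp add: cross_diagram_def marked_diagrams_def)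
qed

definition flip_diagram :: "nat \<Rightarrow> nat \<Rightarrow> mdiagram" where
  "flip_diagram r i = ((\<lambda>j. {Top j, Bot (flip i j)}) ` {..<r}, [])"

text \<open>Exhibits an adjacent transposition as a tensor product of identities and the crossing,
  the pieces whose images are prescribed.\<close>

lemma flip_diagram_eq:
  "tensor_diagram i i (id_diagram i) (tensor_diagram 2 2 cross_diagram (id_diagram k)) =
     flip_diagram (i + (2 + k)) i"
proof -
  have less: "{..<i + (2 + k)} = {..<i} \<union> {i, Suc i} \<union> (\<lambda>j. i + (2 + j)) ` {..<k}"
  proof (rule set_eqI)
    show "j \<in> {..<i + (2 + k)} \<longleftrightarrow> j \<in> {..<i} \<union> {i, Suc i} \<union> (\<lambda>j. i + (2 + j)) ` {..<k}" for j
      by (auto simp: image_iff intro: bexI[of _ "j - i - 2"])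
  qed
  have "(\<lambda>j. {Top j, Bot (flip i j)}) ` {..<i} = (\<lambda>j. {Top j, Bot j}) ` {..<i}"
    by (rule image_cong) (auto simp: flip_def)
  moreover have "(\<lambda>j. {Top j, Bot (flip i j)}) ` (\<lambda>j. i + (2 + j)) ` {..<k} =
      (\<lambda>j. {Top (i + (2 + j)), Bot (i + (2 + j))}) ` {..<k}"
    unfolding image_image by (rule image_cong) (auto simp: flip_def)
  ultimately show ?thesis
    unfolding flip_diagram_def less image_Un
    by (simp add: tensor_diagram_def id_diagram_def cross_diagram_def image_image flip_def Un_assoc)
qed

lemma tensor_marked:
  "D \<in> marked_diagrams r s \<Longrightarrow> D' \<in> marked_diagrams r' s' \<Longrightarrow>
    tensor_diagram r s D D' \<in> marked_diagrams (r + r') (s + s')"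
  using tensor_diagram_marked by (cases D; cases D') blast

lemma tensor_cross_marked: "tensor_diagram 2 2 cross_diagram (id_diagram k) \<in> marked_diagrams (2 + k) (2 + k)"
  by (intro tensor_marked cross_diagram_marked id_diagram_marked)

lemma flip_diagram_marked: "Suc i < r \<Longrightarrow> flip_diagram r i \<in> marked_diagrams r r"
proof -
  assume "Suc i < r"
  hence r: "r = i + (2 + (r - i - 2))" by simp
  show ?thesis
    by (subst r, subst (2 3) r, unfold flip_diagram_eq[symmetric])
      (intro tensor_marked tensor_cross_marked id_diagram_marked)
qed

text \<open>The case of a first factor that preserves degrees at the given tensor: nothing odd is
  moved past \<open>vs\<close> and the sign disappears.\<close>

lemma tensor_map_even:
  assumes f: "linear_on r s f" and g: "linear_on r' s' g"
    and us: "length us = r" "pur us \<in> G r p" "f (pur us) \<in> G s p"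
    and vs: "length vs = r'" "homs vs"
  shows "tensor_map scale V r s r' f g (pur (us @ vs)) = tensor_mult scale (f (pur us)) (g (pur vs))"
proof -
  obtain q where q: "pur vs \<in> G r' q" using homs_grade[OF vs(2)] vs(1) by blast
  have "psgn ((p + p) * q) = 1" by (cases p) simp_all
  thus ?thesis using tensor_map_pure[OF f g us vs(1) q] by simp
qed

lemma FD_flip:
  assumes us: "homs us" and vs: "homs vs" and a: "a \<in> V p" and c: "c \<in> V q"
    and r: "r = length us + (2 + length vs)"
  shows "FD r r (flip_diagram r (length us)) (pur (us @ [a, c] @ vs)) =
    fscale (psgn (p * q)) (pur (us @ [c, a] @ vs))"
proof -
  let ?i = "length us" and ?k = "length vs"
  let ?X = "tensor_diagram 2 2 cross_diagram (id_diagram ?k)"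
  have ac: "pur [a, c] \<in> G 2 (p + q)" "pur [c, a] \<in> G 2 (p + q)"
    using grade_pure[of "[a, c]" "[p, q]"] grade_pure[of "[c, a]" "[q, p]"] a c
    by (simp_all add: numeral_2_eq_2 add.commute del: add_bit_eq_xor)
  have X: "FD 2 2 cross_diagram (pur [a, c]) = fscale (psgn (p * q)) (pur [c, a])"
    by (rule FD_cross[OF a c])
  have "FD 2 2 cross_diagram (pur [a, c]) \<in> G 2 (p + q)"
    unfolding X by (rule cfun.subspace_scale[OF TG.grade_subspace ac(2)])
  hence "tensor_map scale V 2 2 ?k (FD 2 2 cross_diagram) (FD ?k ?k (id_diagram ?k)) (pur ([a, c] @ vs)) =
      tensor_mult scale (fscale (psgn (p * q)) (pur [c, a])) (FD ?k ?k (id_diagram ?k) (pur vs))"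
    using tensor_map_even[OF linear_on_FD[OF cross_diagram_marked] linear_on_FD[OF id_diagram_marked] _ ac(1) _ HOL.refl vs]
    by (simp add: X)
  hence inner: "FD (2 + ?k) (2 + ?k) ?X (pur ([a, c] @ vs)) = fscale (psgn (p * q)) (pur ([c, a] @ vs))"
    unfolding FD_tensor[OF cross_diagram_marked id_diagram_marked]
    using FD_id[of "pur vs" ?k] tensor_mult_pure[of "[c, a]" vs] by (simp add: tensor_mult_scale_left)
  obtain p' where p': "pur us \<in> G ?i p'" using homs_grade[OF us] by blast
  have "FD r r (flip_diagram r ?i) (pur (us @ ([a, c] @ vs))) =
      tensor_map scale V ?i ?i (2 + ?k) (FD ?i ?i (id_diagram ?i)) (FD (2 + ?k) (2 + ?k) ?X) (pur (us @ ([a, c] @ vs)))"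
    unfolding r flip_diagram_eq[symmetric] FD_tensor[OF id_diagram_marked tensor_cross_marked] ..
  also have "\<dots> = tensor_mult scale (FD ?i ?i (id_diagram ?i) (pur us)) (FD (2 + ?k) (2 + ?k) ?X (pur ([a, c] @ vs)))"
    by (rule tensor_map_even[OF linear_on_FD[OF id_diagram_marked] linear_on_FD[OF tensor_cross_marked] HOL.refl p'])
      (use p' vs a c in \<open>auto simp: FD_id\<close>)
  also have "\<dots> = tensor_mult scale (pur us) (fscale (psgn (p * q)) (pur ([c, a] @ vs)))"
    unfolding inner by (simp add: FD_id)
  also have "\<dots> = fscale (psgn (p * q)) (pur (us @ [c, a] @ vs))"
    using tensor_mult_scale_right[of "pur us" ?i "pur ([c, a] @ vs)" "2 + ?k"] tensor_mult_pure[of us "[c, a] @ vs"] by simp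
  finally show ?thesis .
qed


lemma split_two:
  assumes "length v = r" "Suc i < r"
  shows "v = take i v @ [v ! i, v ! Suc i] @ drop (Suc (Suc i)) v"
  using assms by (metis Cons_nth_drop_Suc Suc_lessD append_Cons append_Nil append_take_drop_id)

lemma vmap_flip_flip: "vmap (flip i) id (vmap (flip i) id x) = x" "vmap id (flip i) (vmap id (flip i) x) = x"
  by (cases x; simp)+

lemma nonzero_on_image:
  assumes "\<And>x. vec v' w' x = vec v w (\<rho> x)" "inj \<rho>"
  shows "nonzero_on v w ((`) \<rho> ` E) \<longleftrightarrow> nonzero_on v' w' E"
proof -
  have key: "{x, y} \<in> (`) \<rho> ` E \<longleftrightarrow> (\<exists>x' y'. x = \<rho> x' \<and> y = \<rho> y' \<and> {x', y'} \<in> E)" for x y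
  proof
    assume "{x, y} \<in> (`) \<rho> ` E"
    then obtain f where f: "f \<in> E" "{x, y} = \<rho> ` f" by (elim imageE)
    have "x \<in> \<rho> ` f" "y \<in> \<rho> ` f" unfolding f(2)[symmetric] by simp_all
    then obtain x' y' where xy: "x = \<rho> x'" "y = \<rho> y'" by (elim imageE)
    have "\<rho> ` {x', y'} = \<rho> ` f" using f(2) xy by simp
    hence "{x', y'} = f" by (rule inj_image_eq_iff[OF assms(2), THEN iffD1])
    thus "\<exists>x' y'. x = \<rho> x' \<and> y = \<rho> y' \<and> {x', y'} \<in> E" using f(1) xy by auto
  next
    assume "\<exists>x' y'. x = \<rho> x' \<and> y = \<rho> y' \<and> {x', y'} \<in> E"
    then obtain x' y' where "x = \<rho> x'" "y = \<rho> y'" "{x', y'} \<in> E" by (elim exE conjE)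
    thus "{x, y} \<in> (`) \<rho> ` E" using imageI[of "{x', y'}" E "(`) \<rho>"] by (simp only: image_insert image_empty)
  qed
  show ?thesis
    unfolding nonzero_on_def assms(1)
  proof (intro iffI allI impI)
    fix x y assume *: "\<forall>x y. {x, y} \<in> (`) \<rho> ` E \<longrightarrow> b (vec v w x) (vec v w y) \<noteq> 0" "{x, y} \<in> E"
    have "{\<rho> x, \<rho> y} \<in> (`) \<rho> ` E" using imageI[OF *(2), of "(`) \<rho>"] by simp
    thus "b (vec v w (\<rho> x)) (vec v w (\<rho> y)) \<noteq> 0" by (rule *(1)[rule_format])
  next
    fix x y assume *: "\<forall>x y. {x, y} \<in> E \<longrightarrow> b (vec v w (\<rho> x)) (vec v w (\<rho> y)) \<noteq> 0" "{x, y} \<in> (`) \<rho> ` E"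
    obtain x' y' where xy: "x = \<rho> x'" "y = \<rho> y'" "{x', y'} \<in> E"
      using key[THEN iffD1, OF *(2)] by (elim exE conjE)
    show "b (vec v w x) (vec v w y) \<noteq> 0" unfolding xy(1,2) by (rule *(1)[rule_format, OF xy(3)])
  qed
qed

lemma vertices_flip:
  "Suc i < r \<Longrightarrow> vmap (flip i) id ` vertices r s = vertices r s"
  "Suc i < s \<Longrightarrow> vmap id (flip i) ` vertices r s = vertices r s"
proof -
  have flip: "(\<lambda>j. c (flip i j)) ` {..<k} = c ` {..<k}" if "Suc i < k" for c :: "nat \<Rightarrow> vertex" and k
    using arg_cong[OF flip_image[OF that], of "(`) c"] by (simp only: image_image)
  show "vmap (flip i) id ` vertices r s = vertices r s" if "Suc i < r"
    by (simp add: vertices_def image_Un image_image flip[OF that])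
  show "vmap id (flip i) ` vertices r s = vertices r s" if "Suc i < s"
    by (simp add: vertices_def image_Un image_image flip[OF that])
qed

text \<open>Reindexing along the involution brings the diagram into the shape used in
  \<open>composition_permute_top\<close>.\<close>

lemma flip_diagram_top:
  assumes "Suc i < r"
  shows "flip_diagram r i = ((\<lambda>j. {Top (flip i j), Bot j}) ` {..<r}, [])"
proof -
  have "(\<lambda>j. {Top (flip i j), Bot j}) ` {..<r} = (\<lambda>j. {Top (flip i j), Bot j}) ` flip i ` {..<r}"
    by (simp add: flip_image[OF assms])
  thus ?thesis unfolding flip_diagram_def image_image by simp
qed

text \<open>Composing with the transposition on top exchanges two adjacent entries of the pure input
  tensor up to sign, which matches the exchange of the vectors at the two vertices.\<close>

lemma good_flip_top:
  assumes E: "good r s E" "brauer_diagram r s E" and i: "Suc i < r"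
  shows "good r s ((`) (vmap (flip i) id) ` E)"
proof -
  let ?\<rho> = "vmap (flip i) id"
  obtain ms where ms: "(E, ms) \<in> marked_diagrams r s" using exists_marking[OF E(2)] by blast
  have marked: "((`) ?\<rho> ` E, map (mark_map ?\<rho>) ms) \<in> marked_diagrams r s"
    using marked_on_image[OF _ inj_flip inj_on_id, of E ms "vertices r s" i] ms vertices_flip(1)[OF i]
    by (simp add: marked_diagrams_eq)
  show ?thesis
  proof (rule goodI[OF marked])
    fix v w assume v: "length v = r" "length w = s" "homs v" "homs w"
    define us a c vs where "us = take i v" and "a = v ! i" and "c = v ! Suc i" and "vs = drop (Suc (Suc i)) v"
    have split: "v = us @ [a, c] @ vs" unfolding us_def a_def c_def vs_def by (rule split_two[OF v(1) i])
    have len: "length us = i" "r = length us + (2 + length vs)" using v(1) i by (simp_all add: us_def vs_def)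
    have hom: "homs us" "homs vs" "\<exists>p. a \<in> V p" "\<exists>q. c \<in> V q" using v(3) unfolding split by simp_all
    then obtain p q where pq: "a \<in> V p" "c \<in> V q" by blast
    let ?v = "us @ [c, a] @ vs"
    have "FD r s ((`) ?\<rho> ` E, map (mark_map ?\<rho>) ms) (pur v) = FD r s (E, ms) (FD r r (flip_diagram r i) (pur v))"
      using FD_compose[OF flip_diagram_marked[OF i] ms marked] composition_permute_top[OF E(2) inj_flip, of _ _ i ms]
      unfolding flip_diagram_top[OF i] by simp
    also have "\<dots> = FD r s (E, ms) (fscale (psgn (p * q)) (pur ?v))"
      using FD_flip[OF hom(1,2) pq len(2)] unfolding split len(1) by simp
    also have "\<dots> = fscale (psgn (p * q)) (FD r s (E, ms) (pur ?v))"
      by (rule linear_onD(3)[OF linear_on_FD[OF ms]]) (use len in simp)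
    finally have "FD r s ((`) ?\<rho> ` E, map (mark_map ?\<rho>) ms) (pur v) (pair w) \<noteq> 0 \<longleftrightarrow>
        FD r s (E, ms) (pur ?v) (pair w) \<noteq> 0" by (simp add: fscale_def)
    also have "\<dots> \<longleftrightarrow> nonzero_on ?v w E"
      by (rule goodD[OF E(1) ms]) (use v len hom in auto)
    also have "\<dots> \<longleftrightarrow> nonzero_on v w ((`) ?\<rho> ` E)"
    proof (rule nonzero_on_image[symmetric, OF _ inj_vmap[OF inj_flip inj_on_id]])
      show "vec ?v w x = vec v w (?\<rho> x)" for x
        unfolding split using nth_flip[of us c a vs] len(1) by (cases x) simp_all
    qed
    finally show "FD r s ((`) ?\<rho> ` E, map (mark_map ?\<rho>) ms) (pur v) (pair w) \<noteq> 0 \<longleftrightarrow>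
        nonzero_on v w ((`) ?\<rho> ` E)" .
  qed
qed

text \<open>The sign of a transposition can be read off from the test vectors, because a factor
  \<open>b x y\<close> vanishes unless the degrees of \<open>x\<close> and \<open>y\<close> add up to \<open>\<beta>\<close>.\<close>

lemma FD_flip_pair:
  assumes t: "t \<in> T s" and us: "homs us" and vs: "homs vs" and a: "a \<in> V p" and c: "c \<in> V q"
    and s: "s = length us + (2 + length vs)"
  shows "FD s s (flip_diagram s (length us)) t (pair (us @ [a, c] @ vs)) =
    psgn ((p + \<beta>) * (q + \<beta>)) * t (pair (us @ [c, a] @ vs))"
proof -
  have i: "Suc (length us) < s" using s by simp
  note lin = linear_on_FD[OF flip_diagram_marked[OF i]]
  have pure_case: "FD s s (flip_diagram s (length us)) (pur v) (pair (us @ [a, c] @ vs)) =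
      psgn ((p + \<beta>) * (q + \<beta>)) * pur v (pair (us @ [c, a] @ vs))" if v: "length v = s" "homs v" for v
  proof -
    define us' a' c' vs' where "us' = take (length us) v" and "a' = v ! length us"
      and "c' = v ! Suc (length us)" and "vs' = drop (Suc (Suc (length us))) v"
    have split: "v = us' @ [a', c'] @ vs'"
      unfolding us'_def a'_def c'_def vs'_def by (rule split_two[OF v(1) i])
    have len: "length us' = length us" "length vs' = length vs" using v(1) s by (simp_all add: us'_def vs'_def)
    have hom: "homs us'" "homs vs'" "\<exists>p. a' \<in> V p" "\<exists>q. c' \<in> V q" using v(2) unfolding split by simp_all
    then obtain p' q' where pq: "a' \<in> V p'" "c' \<in> V q'" by blast
    have m: "mform (length (us' @ [x, y] @ vs')) (pair (us @ [z, w] @ vs))" for x y z w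
      by (rule mform_pair) (simp add: len)
    have "FD s s (flip_diagram s (length us)) (pur v) = fscale (psgn (p' * q')) (pur (us' @ [c', a'] @ vs'))"
      using FD_flip[OF hom(1,2) pq, of s] s len unfolding split by simp
    hence "FD s s (flip_diagram s (length us)) (pur v) (pair (us @ [a, c] @ vs)) =
        psgn (p' * q') * pair (us @ [a, c] @ vs) (us' @ [c', a'] @ vs')"
      by (simp only: fscale_def pure_mform[OF m])
    also have "\<dots> = psgn ((p + \<beta>) * (q + \<beta>)) * pair (us @ [c, a] @ vs) (us' @ [a', c'] @ vs')"
    \<comment> \<open>The factors \<open>b c' a\<close> and \<open>b a' c\<close> occur on both
      sides. If one vanishes, both sides are 0; otherwise the degrees satisfy
      \<open>p' = q + \<beta>\<close> and \<open>q' = p + \<beta>\<close>, so the signs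
      agree.\<close>
    proof (cases "b c' a = 0 \<or> b a' c = 0")
      case True
      thus ?thesis by (auto simp: pair_append len)
    next
      case False
      hence "q' + p = \<beta>" "p' + q = \<beta>"
        using homogeneous[OF pq(2) a] homogeneous[OF pq(1) c] by blast+
      hence "psgn (p' * q') = psgn ((p + \<beta>) * (q + \<beta>))"
        by (cases p; cases q; cases p'; cases q'; cases \<beta>) auto
      thus ?thesis by (simp add: pair_append len)
    qed
    also have "\<dots> = psgn ((p + \<beta>) * (q + \<beta>)) * pur v (pair (us @ [c, a] @ vs))"
      unfolding split by (simp only: pure_mform[OF m])
    finally show ?thesis .
  qed
  \<comment> \<open>The sign no longer involves the degrees of the entries of \<open>v\<close>, so
    the identity extends linearly to all tensors.\<close>
  have "t \<in> cfun.span {pur v | v. length v = s \<and> homs v}" using t T_span_homs by blast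
  hence "t \<in> T s \<and> FD s s (flip_diagram s (length us)) t (pair (us @ [a, c] @ vs)) =
    psgn ((p + \<beta>) * (q + \<beta>)) * t (pair (us @ [c, a] @ vs))"
  proof (rule cfun.span_induct_alt)
    show "0 \<in> T s \<and> FD s s (flip_diagram s (length us)) 0 (pair (us @ [a, c] @ vs)) =
        psgn ((p + \<beta>) * (q + \<beta>)) * (0 :: 'v tensor) (pair (us @ [c, a] @ vs))"
      using linear_on_0[OF lin] by simp
  next
    fix k x y
    assume "x \<in> {pur v | v. length v = s \<and> homs v}"
      and y: "y \<in> T s \<and> FD s s (flip_diagram s (length us)) y (pair (us @ [a, c] @ vs)) =
        psgn ((p + \<beta>) * (q + \<beta>)) * y (pair (us @ [c, a] @ vs))"
    then obtain v where v: "x = pur v" "length v = s" "homs v" by blast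
    have x: "x \<in> T s" "fscale k x \<in> T s" using v by auto
    have "FD s s (flip_diagram s (length us)) (fscale k x + y) =
        fscale k (FD s s (flip_diagram s (length us)) x) + FD s s (flip_diagram s (length us)) y"
      using linear_onD(2)[OF lin x(2)] linear_onD(3)[OF lin x(1)] y by simp
    thus "fscale k x + y \<in> T s \<and> FD s s (flip_diagram s (length us)) (fscale k x + y) (pair (us @ [a, c] @ vs)) =
        psgn ((p + \<beta>) * (q + \<beta>)) * (fscale k x + y) (pair (us @ [c, a] @ vs))"
      using y x pure_case[OF v(2,3)] T_add[OF x(2), of y] v(1) by (simp add: fscale_apply algebra_simps)
  qed
  thus ?thesis ..
qed

text \<open>Here the transposition acts on the output of the functor, which need not be a pure
  tensor. \<open>FD_flip_pair\<close> moves it over to the test form.\<close>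

lemma good_flip_bottom:
  assumes E: "good r s E" "brauer_diagram r s E" and i: "Suc i < s"
  shows "good r s ((`) (vmap id (flip i)) ` E)"
proof -
  let ?\<rho> = "vmap id (flip i)"
  obtain ms where ms: "(E, ms) \<in> marked_diagrams r s" using exists_marking[OF E(2)] by blast
  have marked: "((`) ?\<rho> ` E, map (mark_map ?\<rho>) ms) \<in> marked_diagrams r s"
    using marked_on_image[OF _ inj_on_id inj_flip, of E ms "vertices r s" i] ms vertices_flip(2)[OF i]
    by (simp add: marked_diagrams_eq)
  show ?thesis
  proof (rule goodI[OF marked])
    fix v w assume v: "length v = r" "length w = s" "homs v" "homs w"
    define us a c vs where "us = take i w" and "a = w ! i" and "c = w ! Suc i" and "vs = drop (Suc (Suc i)) w"
    have split: "w = us @ [a, c] @ vs" unfolding us_def a_def c_def vs_def by (rule split_two[OF v(2) i])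
    have len: "length us = i" "s = length us + (2 + length vs)" using v(2) i by (simp_all add: us_def vs_def)
    have hom: "homs us" "homs vs" "\<exists>p. a \<in> V p" "\<exists>q. c \<in> V q" using v(4) unfolding split by simp_all
    then obtain p q where pq: "a \<in> V p" "c \<in> V q" by blast
    let ?w = "us @ [c, a] @ vs"
    have t: "FD r s (E, ms) (pur v) \<in> T s"
      by (rule linear_onD(1)[OF linear_on_FD[OF ms]]) (use v in simp)
    have "FD r s ((`) ?\<rho> ` E, map (mark_map ?\<rho>) ms) (pur v) = FD s s (flip_diagram s i) (FD r s (E, ms) (pur v))"
      using FD_compose[OF ms flip_diagram_marked[OF i] marked] composition_permute_bottom[OF E(2) inj_flip, of _ _ ms i]
      unfolding flip_diagram_def by simp
    hence "FD r s ((`) ?\<rho> ` E, map (mark_map ?\<rho>) ms) (pur v) (pair w) =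
        psgn ((p + \<beta>) * (q + \<beta>)) * FD r s (E, ms) (pur v) (pair ?w)"
      using FD_flip_pair[OF t hom(1,2) pq len(2)] unfolding split len(1) by simp
    hence "FD r s ((`) ?\<rho> ` E, map (mark_map ?\<rho>) ms) (pur v) (pair w) \<noteq> 0 \<longleftrightarrow>
        FD r s (E, ms) (pur v) (pair ?w) \<noteq> 0" by simp
    also have "\<dots> \<longleftrightarrow> nonzero_on v ?w E"
      by (rule goodD[OF E(1) ms]) (use v len hom in auto)
    also have "\<dots> \<longleftrightarrow> nonzero_on v w ((`) ?\<rho> ` E)"
    proof (rule nonzero_on_image[symmetric, OF _ inj_vmap[OF inj_on_id inj_flip]])
      show "vec v ?w x = vec v w (?\<rho> x)" for x
        unfolding split using nth_flip[of us c a vs] len(1) by (cases x) simp_all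
    qed
    finally show "FD r s ((`) ?\<rho> ` E, map (mark_map ?\<rho>) ms) (pur v) (pair w) \<noteq> 0 \<longleftrightarrow>
        nonzero_on v w ((`) ?\<rho> ` E)" .
  qed
qed


section \<open>Splitting off the leftmost edge\<close>

lemma nonzero_on_insert:
  "nonzero_on v w (insert e0 E) \<longleftrightarrow> nonzero_on v w {e0} \<and> nonzero_on v w E"
  unfolding nonzero_on_def by auto

lemma nonzero_on_edge:
  assumes "vec v w x \<in> V p" "vec v w y \<in> V q"
  shows "nonzero_on v w {{x, y}} \<longleftrightarrow> b (vec v w x) (vec v w y) \<noteq> 0"
  using form_zero_sym[OF assms] unfolding nonzero_on_def by (auto simp: doubleton_eq_iff)

lemma nonzero_on_cong:
  assumes "\<And>x. x \<in> \<Union>E \<Longrightarrow> vec v w x = vec v' w' x"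
  shows "nonzero_on v w E \<longleftrightarrow> nonzero_on v' w' E"
proof -
  have "b (vec v w x) (vec v w y) = b (vec v' w' x) (vec v' w' y)" if "{x, y} \<in> E" for x y
    using assms[OF UnionI[OF that]] by simp
  thus ?thesis unfolding nonzero_on_def by simp
qed

text \<open>Both the tensor and the test form factor, so the value is, up to sign, a product.
  \<open>homog\<close> is required because the sign rule of \<open>tensor_map\<close> refers to the
  degree of the first output.\<close>

lemma good_tensor:
  assumes small: "({vertices r1 s1}, m0) \<in> marked_diagrams r1 s1" "good r1 s1 {vertices r1 s1}"
    and homog: "\<And>u. length u = r1 \<Longrightarrow> homs u \<Longrightarrow> \<exists>p. FD r1 s1 ({vertices r1 s1}, m0) (pur u) \<in> G s1 p"
    and E: "good r s E" "brauer_diagram r s E"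
  shows "good (r1 + r) (s1 + s) (insert (vertices r1 s1) ((`) (shift_vertex r1 s1) ` E))"
proof -
  let ?e = "vertices r1 s1" and ?\<rho> = "shift_vertex r1 s1"
  obtain ms where ms: "(E, ms) \<in> marked_diagrams r s" using exists_marking[OF E(2)] by blast
  let ?D = "tensor_diagram r1 s1 ({?e}, m0) (E, ms)"
  have D: "?D = (insert ?e ((`) ?\<rho> ` E), snd ?D)" by (simp add: tensor_diagram_def)
  have marked: "(insert ?e ((`) ?\<rho> ` E), snd ?D) \<in> marked_diagrams (r1 + r) (s1 + s)"
    using tensor_diagram_marked[OF small(1) ms] D by simp
  show ?thesis
  proof (rule goodI[OF marked])
    fix v w assume v: "length v = r1 + r" "length w = s1 + s" "homs v" "homs w"
    define v1 v2 w1 w2 where "v1 = take r1 v" and "v2 = drop r1 v" and "w1 = take s1 w" and "w2 = drop s1 w"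
    have split: "v = v1 @ v2" "w = w1 @ w2" by (simp_all add: v1_def v2_def w1_def w2_def)
    have len: "length v1 = r1" "length v2 = r" "length w1 = s1" "length w2 = s"
      using v by (simp_all add: v1_def v2_def w1_def w2_def)
    have hom: "homs v1" "homs v2" "homs w1" "homs w2" using v(3,4) unfolding split by simp_all
    obtain p where p: "pur v1 \<in> G r1 p" using homs_grade[OF hom(1)] len(1) by blast
    obtain q where q: "pur v2 \<in> G r q" using homs_grade[OF hom(2)] len(2) by blast
    obtain p' where p': "FD r1 s1 ({?e}, m0) (pur v1) \<in> G s1 p'" using homog[OF len(1) hom(1)] by blast
    let ?A = "FD r1 s1 ({?e}, m0) (pur v1)" and ?B = "FD r s (E, ms) (pur v2)"
    have "FD (r1 + r) (s1 + s) ?D (pur (v1 @ v2)) =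
        fscale (psgn ((p' + p) * q)) (tensor_mult scale ?A ?B)"
      unfolding FD_tensor[OF small(1) ms]
      by (rule tensor_map_pure[OF linear_on_FD[OF small(1)] linear_on_FD[OF ms] len(1) p p' len(2) q])
    moreover have "tensor_mult scale ?A ?B (pair (w1 @ w2)) = ?A (pair w1) * ?B (pair w2)"
    proof (rule tensor_mult_form)
      show "?A \<in> T s1" using p' grade_in_T by blast
      show "?B \<in> T s" by (rule linear_onD(1)[OF linear_on_FD[OF ms]]) (use len in simp)
    qed (use len in \<open>simp_all add: mform_pair pair_append\<close>)
    ultimately have "FD (r1 + r) (s1 + s) ?D (pur v) (pair w) \<noteq> 0 \<longleftrightarrow> ?A (pair w1) \<noteq> 0 \<and> ?B (pair w2) \<noteq> 0"
      unfolding split by (simp add: fscale_apply)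
    also have "\<dots> \<longleftrightarrow> nonzero_on v1 w1 {?e} \<and> nonzero_on v2 w2 E"
      unfolding goodD[OF small(2,1) len(1,3) hom(1,3)] goodD[OF E(1) ms len(2,4) hom(2,4)] ..
    also have "nonzero_on v1 w1 {?e} \<longleftrightarrow> nonzero_on v w {?e}"
      by (rule nonzero_on_cong) (auto simp: split len vertices_def nth_append)
    also have "nonzero_on v2 w2 E \<longleftrightarrow> nonzero_on (v1 @ v2) (w1 @ w2) ((`) ?\<rho> ` E)"
    proof (rule nonzero_on_image[symmetric, OF _ inj_shift_vertex])
      show "vec v2 w2 x = vec (v1 @ v2) (w1 @ w2) (?\<rho> x)" for x
        by (cases x) (simp_all flip: len(1,3))
    qed
    finally have "FD (r1 + r) (s1 + s) ?D (pur v) (pair w) \<noteq> 0 \<longleftrightarrow>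
        nonzero_on v w (insert ?e ((`) ?\<rho> ` E))"
      unfolding nonzero_on_insert[of _ _ _ "(`) ?\<rho> ` E"] split .
    thus "FD (r1 + r) (s1 + s) (insert ?e ((`) ?\<rho> ` E), snd ?D) (pur v) (pair w) \<noteq> 0 \<longleftrightarrow>
        nonzero_on v w (insert ?e ((`) ?\<rho> ` E))"
      by (simp only: D[symmetric])
  qed
qed

lemma brauer_small:
  assumes "card (vertices r s) = 2"
  shows "brauer_diagram r s {vertices r s}"
proof -
  have "vertices r s \<noteq> {}" using assms by auto
  thus ?thesis using assms partition_on_space by (simp add: brauer_diagram_def)
qed

lemma cup_diagram_marked: "cup_diagram \<in> marked_diagrams 2 0" "cup_diagram = ({vertices 2 0}, [BeadOn {Top 0, Top 1}])"
proof -
  have "brauer_diagram 2 0 {vertices 2 0}" by (rule brauer_small) (simp add: vertices_small)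
  thus "cup_diagram \<in> marked_diagrams 2 0"
    by (auto simp: marked_diagrams_def cup_diagram_def vertices_small cups_def caps_def)
qed (simp add: cup_diagram_def vertices_small)

lemma cap_diagram_marked: "cap_diagram \<in> marked_diagrams 0 2" "cap_diagram = ({vertices 0 2}, [ArrowOn (Bot 0) (Bot 1)])"
proof -
  have "brauer_diagram 0 2 {vertices 0 2}" by (rule brauer_small) (simp add: vertices_small)
  thus "cap_diagram \<in> marked_diagrams 0 2"
    by (auto simp: marked_diagrams_def cap_diagram_def vertices_small cups_def caps_def)
qed (simp add: cap_diagram_def vertices_small)

lemma id_diagram_1: "id_diagram 1 = ({vertices 1 1}, [])"
  unfolding id_diagram_def vertices_small by (simp add: lessThan_Suc)

lemma pure_pair: "length v = length w \<Longrightarrow> pur v (pair w) = pair w v"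
  by (rule pure_mform) (simp add: mform_pair)

lemma length_2_conv: "length v = 2 \<longleftrightarrow> (\<exists>a c. v = [a, c])" and length_1_conv: "length v = 1 \<longleftrightarrow> (\<exists>a. v = [a])"
  by (auto simp: numeral_2_eq_2 length_Suc_conv)

lemma good_cup: "good 2 0 {vertices 2 0}"
proof (rule goodI[OF cup_diagram_marked(1)[unfolded cup_diagram_marked(2)]])
  fix v w assume vw: "length v = 2" "length w = 0" "homs v" "homs w"
  then obtain a c where v: "v = [a, c]" by (auto simp: length_2_conv)
  then obtain p q where "a \<in> V p" "c \<in> V q" using vw by auto
  hence "nonzero_on v w {vertices 2 0} \<longleftrightarrow> b a c \<noteq> 0"
    unfolding vertices_small using nonzero_on_edge[of v w "Top 0" p "Top 1" q] v by simp
  thus "FD 2 0 ({vertices 2 0}, [BeadOn {Top 0, Top 1}]) (pur v) (pair w) \<noteq> 0 \<longleftrightarrow> nonzero_on v w {vertices 2 0}"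
    using vw(2) unfolding cup_diagram_marked(2)[symmetric] v FD_cup by (simp add: fscale_apply pure_pair)
qed

lemma good_id: "good 1 1 {vertices 1 1}"
proof (rule goodI[OF id_diagram_marked[of 1, unfolded id_diagram_1]])
  fix v w assume vw: "length v = 1" "length w = 1" "homs v" "homs w"
  then obtain a c where v: "v = [a]" "w = [c]" unfolding length_1_conv by blast
  then obtain p q where "a \<in> V p" "c \<in> V q" using vw by auto
  hence "nonzero_on v w {vertices 1 1} \<longleftrightarrow> b a c \<noteq> 0"
    unfolding vertices_small using nonzero_on_edge[of v w "Top 0" p "Bot 0" q] v by simp
  thus "FD 1 1 ({vertices 1 1}, []) (pur v) (pair w) \<noteq> 0 \<longleftrightarrow> nonzero_on v w {vertices 1 1}"
    unfolding id_diagram_1[symmetric] using v FD_id[of "pur v" 1] by (simp add: pure_pair)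
qed

lemma basis_degree: "i < m + n \<Longrightarrow> e i \<in> V (degree_of V (e i))"
proof -
  assume i: "i < m + n"
  then obtain p where p: "e i \<in> V p" using basis by (auto simp: homogeneous_basis_def)
  have nz: "e i \<noteq> 0" using dual[OF i i] by auto
  have "q = p" if q: "e i \<in> V q" for q
  proof (rule ccontr)
    assume "q \<noteq> p"
    hence "grade_proj V q (e i) = 0" unfolding V.proj_graded[OF p] by (rule if_not_P)
    moreover have "grade_proj V q (e i) = e i" unfolding V.proj_graded[OF q] by simp
    ultimately show False using nz by simp
  qed
  hence "degree_of V (e i) = p" unfolding degree_of_def using p by (intro the_equality)
  thus ?thesis using p by simp
qed

text \<open>Pairing an expansion of \<open>w\<close> in the dual basis with \<open>e i\<close>
  isolates the coefficient of \<open>e' i\<close>.\<close>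

lemma dual_expansion: "(\<Sum>i<m + n. scale (b (e i) w) (e' i)) = w"
proof -
  have inj: "inj_on e' {..<m + n}" and "span (e' ` {..<m + n}) = UNIV"
    using basis' by (auto simp: homogeneous_basis_def)
  hence "w \<in> span (e' ` {..<m + n})" by simp
  then obtain u where u: "w = (\<Sum>v\<in>e' ` {..<m + n}. scale (u v) v)"
    using span_finite[of "e' ` {..<m + n}"] by auto
  hence w: "w = (\<Sum>i<m + n. scale (u (e' i)) (e' i))"
    by (simp add: sum.reindex[OF inj] comp_def)
  have sum: "b z (\<Sum>i\<in>I. f i) = (\<Sum>i\<in>I. b z (f i))" for z and f :: "nat \<Rightarrow> 'v" and I
    by (induction I rule: infinite_finite_induct) (simp_all add: form_add_right)
  have "b (e i) w = u (e' i)" if i: "i < m + n" for i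
  proof -
    have "b (e i) w = (\<Sum>j<m + n. u (e' j) * b (e i) (e' j))"
      by (subst w) (simp add: sum form_scale_right)
    also have "\<dots> = (\<Sum>j<m + n. if j = i then u (e' j) else 0)"
      by (rule sum.cong) (use i dual in auto)
    also have "\<dots> = u (e' i)" using i by simp
    finally show ?thesis .
  qed
  hence "(\<Sum>i<m + n. scale (b (e i) w) (e' i)) = (\<Sum>i<m + n. scale (u (e' i)) (e' i))"
    by (intro sum.cong) simp_all
  with w show ?thesis by (simp only:)
qed

text \<open>A term survives only if \<open>e i\<close> has degree \<open>\<beta> + p\<close>, where
  \<open>p\<close> is the degree of the first test vector. Hence the signs in the cap are constant
  on all surviving terms and can be pulled out; the rest is the dual expansion of \<open>a\<close>,
  paired with \<open>c\<close>.\<close>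

lemma good_cap: "good 0 2 {vertices 0 2}"
proof (rule goodI[OF cap_diagram_marked(1)[unfolded cap_diagram_marked(2)]])
  fix v w assume vw: "length v = 0" "length w = 2" "homs v" "homs w"
  then obtain a c where w: "w = [a, c]" by (auto simp: length_2_conv)
  then obtain p q where pq: "a \<in> V p" "c \<in> V q" using vw by auto
  hence nz: "nonzero_on v w {vertices 0 2} \<longleftrightarrow> b a c \<noteq> 0"
    unfolding vertices_small using nonzero_on_edge[of v w "Bot 0" p "Bot 1" q] w by simp
  have sum: "b (\<Sum>i\<in>I. f i) z = (\<Sum>i\<in>I. b (f i) z)" for z and f :: "nat \<Rightarrow> 'v" and I
    by (induction I rule: infinite_finite_induct) (simp_all add: form_add_left)
  have sum': "(\<Sum>i\<in>I. f i) \<phi> = (\<Sum>i\<in>I. f i \<phi>)" for \<phi> and f :: "nat \<Rightarrow> 'v tensor" and I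
    by (induction I rule: infinite_finite_induct) simp_all
  have "FD 0 2 cap_diagram (pur []) (pair w) =
      (\<Sum>i<m + n. psgn (degree_of V (e i)) * (b (e i) a * b (e' i) c))"
    unfolding FD_cap sum' by (simp add: fscale_apply pure_pair w)
  also have "\<dots> = (\<Sum>i<m + n. psgn (\<beta> + p) * (b (e i) a * b (e' i) c))"
  proof (rule sum.cong)
    fix i assume "i \<in> {..<m + n}"
    hence "e i \<in> V (degree_of V (e i))" using basis_degree by simp
    hence "b (e i) a = 0 \<or> degree_of V (e i) + p = \<beta>" using homogeneous[OF _ pq(1)] by blast
    moreover have "degree_of V (e i) = \<beta> + p" if "degree_of V (e i) + p = \<beta>"
      using that by (cases p; cases "degree_of V (e i)") auto
    ultimately show "psgn (degree_of V (e i)) * (b (e i) a * b (e' i) c) = psgn (\<beta> + p) * (b (e i) a * b (e' i) c)"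
      by auto
  qed simp
  also have "\<dots> = psgn (\<beta> + p) * b (\<Sum>i<m + n. scale (b (e i) a) (e' i)) c"
    by (simp add: sum_distrib_left sum form_scale_left del: add_bit_eq_xor)
  also have "\<dots> = psgn (\<beta> + p) * b a c" by (simp only: dual_expansion)
  finally have "FD 0 2 cap_diagram (pur []) (pair w) \<noteq> 0 \<longleftrightarrow> b a c \<noteq> 0" by simp
  thus "FD 0 2 ({vertices 0 2}, [ArrowOn (Bot 0) (Bot 1)]) (pur v) (pair w) \<noteq> 0 \<longleftrightarrow> nonzero_on v w {vertices 0 2}"
    using vw(1) nz unfolding cap_diagram_marked(2)[symmetric] by simp
qed

text \<open>\<open>b (e i) (e' i) = 1\<close> forces the degrees of \<open>e i\<close> and
  \<open>e' i\<close> to add up to \<beta>.\<close>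

lemma cap_graded: "FD 0 2 cap_diagram (pur []) \<in> G 2 \<beta>"
  unfolding FD_cap
proof (intro cfun.subspace_sum[OF TG.grade_subspace] cfun.subspace_scale[OF TG.grade_subspace])
  fix i assume "i \<in> {..<m + n}"
  hence i: "i < m + n" by simp
  obtain q where q: "e' i \<in> V q" using basis' i by (auto simp: homogeneous_basis_def)
  have "degree_of V (e i) + q = \<beta>"
    using homogeneous[OF basis_degree[OF i] q] dual[OF i i] by (metis zero_neq_one)
  thus "pur [e i, e' i] \<in> G 2 \<beta>"
    using grade_pure[of "[e i, e' i]" "[degree_of V (e i), q]"] basis_degree[OF i] q
    by (simp add: numeral_2_eq_2 del: add_bit_eq_xor)
qed

lemma good_cup_tensor:
  assumes "good r s E" "brauer_diagram r s E"
  shows "good (2 + r) s (insert (vertices 2 0) ((`) (shift_vertex 2 0) ` E))"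
proof -
  have "\<exists>p. FD 2 0 cup_diagram (pur u) \<in> G 0 p" if u2: "length u = 2" for u
  proof -
    obtain a c where u: "u = [a, c]" using u2 by (auto simp: length_2_conv)
    have "pur [] \<in> G 0 0" using grade_pure[of "[]" "[]"] by simp
    thus ?thesis unfolding u FD_cup using cfun.subspace_scale[OF TG.grade_subspace] by blast
  qed
  thus ?thesis
    using good_tensor[OF cup_diagram_marked(1)[unfolded cup_diagram_marked(2)] good_cup _ assms]
    unfolding cup_diagram_marked(2) by simp
qed

lemma good_cap_tensor:
  assumes "good r s E" "brauer_diagram r s E"
  shows "good r (2 + s) (insert (vertices 0 2) ((`) (shift_vertex 0 2) ` E))"
  using good_tensor[OF cap_diagram_marked(1)[unfolded cap_diagram_marked(2)] good_cap _ assms] cap_graded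
  unfolding cap_diagram_marked(2) by auto

lemma good_id_tensor:
  assumes "good r s E" "brauer_diagram r s E"
  shows "good (1 + r) (1 + s) (insert (vertices 1 1) ((`) (shift_vertex 1 1) ` E))"
proof -
  have "\<exists>p. FD 1 1 (id_diagram 1) (pur u) \<in> G 1 p" if "length u = 1" "homs u" for u
    using homs_grade[OF that(2)] that(1) FD_id[of "pur u" 1] by simp
  thus ?thesis
    using good_tensor[OF id_diagram_marked[of 1, unfolded id_diagram_1] good_id _ assms]
    unfolding id_diagram_1 by simp
qed


section \<open>Induction on the number of vertices\<close>

lemma good_peel:
  "vertices 2 0 \<in> E \<Longrightarrow> brauer_diagram (2 + r) s E \<Longrightarrow> (\<And>E'. brauer_diagram r s E' \<Longrightarrow> good r s E') \<Longrightarrow> good (2 + r) s E"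
  "vertices 0 2 \<in> E \<Longrightarrow> brauer_diagram r (2 + s) E \<Longrightarrow> (\<And>E'. brauer_diagram r s E' \<Longrightarrow> good r s E') \<Longrightarrow> good r (2 + s) E"
  "vertices 1 1 \<in> E \<Longrightarrow> brauer_diagram (1 + r) (1 + s) E \<Longrightarrow> (\<And>E'. brauer_diagram r s E' \<Longrightarrow> good r s E') \<Longrightarrow> good (1 + r) (1 + s) E"
  using brauer_peel[of 2 r 0 s E] brauer_peel[of 0 r 2 s E] brauer_peel[of 1 r 1 s E]
    good_cup_tensor good_cap_tensor good_id_tensor by auto

lemma brauer_of_flip:
  assumes E: "brauer_diagram r s E" and \<rho>: "\<rho> = vmap (flip i) id \<and> Suc i < r \<or> \<rho> = vmap id (flip i) \<and> Suc i < s"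
  shows "brauer_diagram r s ((`) \<rho> ` E)"
  using \<rho> brauer_image[OF E inj_flip inj_on_id] brauer_image[OF E inj_on_id inj_flip] vertices_flip by blast

text \<open>A transposition is an involution, so the property can be pulled back from the transposed
  diagram.\<close>

lemma good_of_flip:
  assumes E: "brauer_diagram r s E" and \<rho>: "\<rho> = vmap (flip i) id \<and> Suc i < r \<or> \<rho> = vmap id (flip i) \<and> Suc i < s"
    and good: "good r s ((`) \<rho> ` E)"
  shows "good r s E"
proof -
  have "good r s ((`) \<rho> ` (`) \<rho> ` E)"
    using \<rho> good brauer_of_flip[OF E \<rho>] good_flip_top good_flip_bottom by blast
  moreover have "(`) \<rho> ` (`) \<rho> ` E = E"
    using \<rho> by (auto simp: image_image vmap_flip_flip)
  ultimately show ?thesis by simp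
qed

lemma edge_vertices:
  assumes "brauer_diagram r s E" "{x, y} \<in> E"
  shows "x \<in> vertices r s" "y \<in> vertices r s" "x \<noteq> y"
proof -
  have "\<Union>E = vertices r s" "card {x, y} = 2" using assms by (auto simp: brauer_diagram_def partition_on_def)
  thus "x \<in> vertices r s" "y \<in> vertices r s" "x \<noteq> y" using assms(2) by auto
qed

text \<open>Each transposition moves the right end of the cup one place to the left. At
  \<open>j = 0\<close> the two ends are neighbours, the cup occupies \<open>vertices 2 0\<close> and
  splits off.\<close>

lemma good_cup_edge:
  assumes IH: "\<And>r' s' E. r' + s' < r + s \<Longrightarrow> brauer_diagram r' s' E \<Longrightarrow> good r' s' E"
  shows "brauer_diagram r s E \<Longrightarrow> {Top 0, Top (Suc j)} \<in> E \<Longrightarrow> good r s E"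
proof (induction j arbitrary: E)
  case 0
  hence "Suc 0 < r" using edge_vertices(2)[of r s E "Top 0" "Top (Suc 0)"] by (auto simp: vertices_def)
  then obtain r' where r: "r = 2 + r'" using less_imp_add_positive by (metis Suc_leI le_Suc_ex numeral_2_eq_2)
  have "vertices 2 0 \<in> E" using 0 by (simp add: vertices_small)
  thus ?case using good_peel(1) 0(1) IH unfolding r by simp
next
  case (Suc j)
  have "Suc (Suc j) < r" using edge_vertices(2)[OF Suc.prems] by (auto simp: vertices_def)
  hence \<rho>: "vmap (flip (Suc j)) id = vmap (flip (Suc j)) id \<and> Suc (Suc j) < r \<or>
      vmap (flip (Suc j)) id = vmap id (flip (Suc j)) \<and> Suc (Suc j) < s" by simp
  show ?case
  proof (rule good_of_flip[OF Suc.prems(1) \<rho>], rule Suc.IH[OF brauer_of_flip[OF Suc.prems(1) \<rho>]])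
    show "{Top 0, Top (Suc j)} \<in> (`) (vmap (flip (Suc j)) id) ` E"
      using imageI[OF Suc.prems(2), of "(`) (vmap (flip (Suc j)) id)"] by (simp add: flip_def)
  qed
qed

lemma good_cap_edge:
  assumes IH: "\<And>r' s' E. r' + s' < r + s \<Longrightarrow> brauer_diagram r' s' E \<Longrightarrow> good r' s' E"
  shows "brauer_diagram r s E \<Longrightarrow> {Bot 0, Bot (Suc j)} \<in> E \<Longrightarrow> good r s E"
proof (induction j arbitrary: E)
  case 0
  hence "Suc 0 < s" using edge_vertices(2)[of r s E "Bot 0" "Bot (Suc 0)"] by (auto simp: vertices_def)
  then obtain s' where s: "s = 2 + s'" by (metis Suc_leI le_Suc_ex numeral_2_eq_2)
  have "vertices 0 2 \<in> E" using 0 by (simp add: vertices_small)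
  thus ?case using good_peel(2) 0(1) IH unfolding s by simp
next
  case (Suc j)
  have "Suc (Suc j) < s" using edge_vertices(2)[OF Suc.prems] by (auto simp: vertices_def)
  hence \<rho>: "vmap id (flip (Suc j)) = vmap (flip (Suc j)) id \<and> Suc (Suc j) < r \<or>
      vmap id (flip (Suc j)) = vmap id (flip (Suc j)) \<and> Suc (Suc j) < s" by simp
  show ?case
  proof (rule good_of_flip[OF Suc.prems(1) \<rho>], rule Suc.IH[OF brauer_of_flip[OF Suc.prems(1) \<rho>]])
    show "{Bot 0, Bot (Suc j)} \<in> (`) (vmap id (flip (Suc j))) ` E"
      using imageI[OF Suc.prems(2), of "(`) (vmap id (flip (Suc j)))"] by (simp add: flip_def)
  qed
qed

text \<open>Only the bottom end has to travel. The string splits off once it reaches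
  \<open>Bot 0\<close>.\<close>

lemma good_through_edge:
  assumes IH: "\<And>r' s' E. r' + s' < r + s \<Longrightarrow> brauer_diagram r' s' E \<Longrightarrow> good r' s' E"
  shows "brauer_diagram r s E \<Longrightarrow> {Top 0, Bot j} \<in> E \<Longrightarrow> good r s E"
proof (induction j arbitrary: E)
  case 0
  hence "0 < r" "0 < s" using edge_vertices(1,2)[of r s E "Top 0" "Bot 0"] by (auto simp: vertices_def)
  then obtain r' s' where rs: "r = 1 + r'" "s = 1 + s'" by (metis Suc_eq_plus1_left gr0_implies_Suc)
  have "vertices 1 1 \<in> E" using 0 unfolding vertices_small by simp
  thus ?case using good_peel(3) 0(1) IH unfolding rs by simp
next
  case (Suc j)
  have "Suc j < s" using edge_vertices(2)[OF Suc.prems] by (auto simp: vertices_def)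
  hence \<rho>: "vmap id (flip j) = vmap (flip j) id \<and> Suc j < r \<or>
      vmap id (flip j) = vmap id (flip j) \<and> Suc j < s" by simp
  show ?case
  proof (rule good_of_flip[OF Suc.prems(1) \<rho>], rule Suc.IH[OF brauer_of_flip[OF Suc.prems(1) \<rho>]])
    show "{Top 0, Bot j} \<in> (`) (vmap id (flip j)) ` E"
      using imageI[OF Suc.prems(2), of "(`) (vmap id (flip j))"] by (simp add: flip_def)
  qed
qed

lemma edge_at:
  assumes "brauer_diagram r s E" "x \<in> vertices r s"
  shows "\<exists>y. {x, y} \<in> E"
proof -
  obtain f where f: "f \<in> E" "x \<in> f" using assms by (auto simp: brauer_diagram_def partition_on_def)
  hence "card f = 2" using assms(1) by (simp add: brauer_diagram_def)
  then obtain a c where "f = {a, c}" by (auto simp: card_2_iff)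
  hence "f = {x, a} \<or> f = {x, c}" using f(2) by auto
  thus ?thesis using f(1) by blast
qed

lemma good_empty: "good 0 0 {}"
proof -
  have id: "id_diagram 0 = ({}, [])" by (simp add: id_diagram_def)
  show ?thesis
  proof (rule goodI[OF id_diagram_marked[of 0, unfolded id]])
    fix v w :: "'v list" assume "length v = 0" "length w = 0"
    thus "FD 0 0 ({}, []) (pur v) (pair w) \<noteq> 0 \<longleftrightarrow> nonzero_on v w {}"
      unfolding id[symmetric] using FD_id[of "pur []" 0] by (simp add: pure_pair nonzero_on_def)
  qed
qed

text \<open>The edge to be split off is the one at the first top vertex, or at the first bottom
  vertex if the top row is empty; in the latter case it must be a cap.\<close>

lemma all_good: "brauer_diagram r s E \<Longrightarrow> good r s E"
proof (induction "r + s" arbitrary: r s E rule: less_induct)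
  case less
  note IH = less.hyps
  show ?case
  proof (cases "0 < r")
    case True
    then obtain y where y: "{Top 0, y} \<in> E" using edge_at[OF less.prems, of "Top 0"] by (auto simp: vertices_def)
    hence y': "y \<in> vertices r s" "Top 0 \<noteq> y" using edge_vertices[OF less.prems] by blast+
    show ?thesis
    proof (cases y)
      case (Top j)
      then obtain j' where "y = Top (Suc j')" using y'(2) by (cases j) auto
      thus ?thesis using good_cup_edge[OF IH less.prems] y by blast
    next
      case (Bot j)
      thus ?thesis using good_through_edge[OF IH less.prems] y by blast
    qed (use y' in \<open>auto simp: vertices_def\<close>)
  next
    case False
    show ?thesis
    proof (cases "0 < s")
      case True
      then obtain y where y: "{Bot 0, y} \<in> E" using edge_at[OF less.prems, of "Bot 0"] by (auto simp: vertices_def)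
      hence y': "y \<in> vertices r s" "Bot 0 \<noteq> y" using edge_vertices[OF less.prems] by blast+
      then obtain j where "y = Bot j" using False by (auto simp: vertices_def)
      then obtain j' where "y = Bot (Suc j')" using y'(2) by (cases j) auto
      thus ?thesis using good_cap_edge[OF IH less.prems] y by blast
    next
      case s: False
      hence "E = {}" using less.prems False by (simp add: brauer_diagram_def vertices_def partition_on_empty)
      thus ?thesis using good_empty False s by simp
    qed
  qed
qed

subsection \<open>Separating diagrams\<close>

lemma card_brauer:
  assumes "brauer_diagram r s E"
  shows "2 * card E = r + s"
proof -
  have E: "finite E" "\<And>e. e \<in> E \<Longrightarrow> card e = 2" "partition_on (vertices r s) E"
    using assms brauer_finite by (auto simp: brauer_diagram_def)
  have "card (\<Union>E) = 2 * card E"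
  proof (rule card_partition[symmetric])
    show "c1 \<inter> c2 = {}" if "c1 \<in> E" "c2 \<in> E" "c1 \<noteq> c2" for c1 c2
      using pairwiseD[OF partition_onD2[OF E(3)] that] by (simp add: disjnt_def)
  qed (use E partition_onD1[OF E(3), symmetric] in auto)
  moreover have "card (vertices r s) = r + s"
    unfolding vertices_def by (subst card_Un_disjoint) (auto simp: card_image inj_on_def)
  ultimately show ?thesis using partition_onD1[OF E(3)] by simp
qed

lemma brauer_edge_unique:
  assumes "brauer_diagram r s E" "e1 \<in> E" "e2 \<in> E" "x \<in> e1" "x \<in> e2"
  shows "e1 = e2"
proof (rule ccontr)
  assume "e1 \<noteq> e2"
  hence "disjnt e1 e2"
    using assms pairwiseD[of disjnt E e1 e2] by (simp add: brauer_diagram_def partition_on_def)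
  thus False using assms(4,5) by (auto simp: disjnt_def)
qed

text \<open>All diagrams of the same type have equally many edges, so an inclusion between two of
  them is an equality.\<close>

lemma brauer_not_subset:
  assumes E: "brauer_diagram r s E" and E0: "brauer_diagram r s E0" and "E \<noteq> E0"
  shows "\<exists>e\<in>E. e \<notin> E0"
proof (rule ccontr)
  assume "\<not> (\<exists>e\<in>E. e \<notin> E0)"
  hence sub: "E \<subseteq> E0" by blast
  have "card E = card E0" using card_brauer[OF E] card_brauer[OF E0] by simp
  hence "E = E0" using card_subset_eq[OF brauer_finite[OF E0] sub] by simp
  thus False using assms(3) by simp
qed

text \<open>The edges of \<open>E0\<close> are numbered, and the ends of edge \<open>k\<close> carry
  \<open>x k\<close> and \<open>y k\<close>. An edge outside \<open>E0\<close> joins ends of two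
  different edges of \<open>E0\<close>, hence carries orthogonal vectors, and every diagram other
  than \<open>E0\<close> has such an edge.\<close>

lemma separating_vectors:
  assumes E0: "brauer_diagram r s E0" and rs: "r + s \<le> m + n"
  shows "\<exists>v w. length v = r \<and> length w = s \<and> homs v \<and> homs w \<and>
    (\<forall>E. brauer_diagram r s E \<longrightarrow> (nonzero_on v w E \<longleftrightarrow> E = E0))"
proof -
  have fin: "finite E0" by (rule brauer_finite[OF E0])
  let ?N = "card E0"
  have basis: "independent (e ` {..<m + n})" "card (e ` {..<m + n}) = m + n"
    using basis by (simp_all add: homogeneous_basis_def card_image)
  have "2 * ?N \<le> card (e ` {..<m + n})" using rs card_brauer[OF E0] basis(2) by simp
  from orthogonal_pairs[OF this basis(1)] obtain x y where xy: "\<forall>k<?N. (\<exists>p. x k \<in> V p) \<and> (\<exists>q. y k \<in> V q) \<and> b (x k) (y k) \<noteq> 0"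
    and orth: "\<forall>k<?N. \<forall>l<?N. k \<noteq> l \<longrightarrow> (\<forall>s\<in>{x k, y k}. \<forall>t\<in>{x l, y l}. b s t = 0)"
    by (elim exE conjE)
  obtain h where h: "bij_betw h E0 {..<?N}" using ex_bij_betw_finite_nat[OF fin] by (auto simp: atLeast0LessThan)
  have h_less: "h f < ?N" if "f \<in> E0" for f using bij_betwE[OF h] that by blast
  have "\<forall>f\<in>E0. \<exists>u w. f = {u, w} \<and> u \<noteq> w"
    using E0 by (simp add: brauer_diagram_def card_2_iff)
  then obtain u u' where u: "\<And>f. f \<in> E0 \<Longrightarrow> f = {u f, u' f} \<and> u f \<noteq> u' f" by metis
  have "\<forall>z\<in>vertices r s. \<exists>f\<in>E0. z \<in> f"
    using E0 by (auto simp: brauer_diagram_def partition_on_def)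
  then obtain ed where ed: "\<And>z. z \<in> vertices r s \<Longrightarrow> ed z \<in> E0 \<and> z \<in> ed z" by metis
  \<comment> \<open>\<open>ed z\<close> is the edge of \<open>E0\<close> through \<open>z\<close>,
    \<open>h\<close> its number, and \<open>u\<close> selects the end that receives the first vector
    of the pair.\<close>
  define g where "g z = (if z = u (ed z) then x (h (ed z)) else y (h (ed z)))" for z
  define v where "v = map (\<lambda>i. g (Top i)) [0..<r]"
  define w where "w = map (\<lambda>i. g (Bot i)) [0..<s]"
  have vec: "vec v w z = g z" if "z \<in> vertices r s" for z
    using that by (auto simp: vertices_def v_def w_def)
  have g_hom: "\<exists>p. g z \<in> V p" if "z \<in> vertices r s" for z
    using xy h_less[of "ed z"] ed[OF that] unfolding g_def by simp
  have v: "length v = r" "length w = s" by (simp_all add: v_def w_def)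
  have hom: "homs v" "homs w"
    using g_hom by (auto simp: homs_def v_def w_def vertices_def)
  have "nonzero_on v w E \<longleftrightarrow> E = E0" if E: "brauer_diagram r s E" for E
  proof
    assume nz: "nonzero_on v w E"
    show "E = E0"
    proof (rule ccontr)
      assume "E \<noteq> E0"
      then obtain f where f: "f \<in> E" "f \<notin> E0" using brauer_not_subset[OF E E0] by blast
      then obtain z z' where zz: "f = {z, z'}" using E by (auto simp: brauer_diagram_def card_2_iff)
      have mem: "z \<in> vertices r s" "z' \<in> vertices r s" "z \<noteq> z'"
        using edge_vertices[OF E] f(1) unfolding zz by blast+
      \<comment> \<open>Were \<open>z\<close> and \<open>z'\<close> on the same edge of
        \<open>E0\<close>, this two-element edge would be \<open>f\<close> itself.\<close>
      have "ed z \<noteq> ed z'"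
      proof
        assume eq: "ed z = ed z'"
        have "{z, z'} \<subseteq> ed z" using ed[OF mem(1)] ed[OF mem(2)] eq by simp
        moreover have "card (ed z) = 2" using ed[OF mem(1)] E0 by (simp add: brauer_diagram_def)
        moreover from this have "finite (ed z)" by (simp add: card_ge_0_finite)
        ultimately have "f = ed z" using card_subset_eq[of "ed z" "{z, z'}"] mem(3) unfolding zz by simp
        thus False using f(2) ed[OF mem(1)] by simp
      qed
      hence "h (ed z) \<noteq> h (ed z')"
        using bij_betw_imp_inj_on[OF h] ed[OF mem(1)] ed[OF mem(2)] by (simp add: inj_on_eq_iff)
      hence "b (g z) (g z') = 0"
        using orth h_less[of "ed z"] h_less[of "ed z'"] ed[OF mem(1)] ed[OF mem(2)] by (simp add: g_def)
      moreover have "b (vec v w z) (vec v w z') \<noteq> 0"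
        using nz[unfolded nonzero_on_def, rule_format] f(1) unfolding zz by blast
      ultimately show False using vec[OF mem(1)] vec[OF mem(2)] by simp
    qed
  next
    assume "E = E0"
    show "nonzero_on v w E"
      unfolding nonzero_on_def
    proof (intro allI impI)
      fix z z' assume zz: "{z, z'} \<in> E"
      note mem = edge_vertices[OF E zz]
      have "ed z = {z, z'}" "ed z' = {z, z'}"
        using brauer_edge_unique[OF E0, of _ "{z, z'}"] ed[OF mem(1)] ed[OF mem(2)] zz \<open>E = E0\<close> by auto
      moreover have "{z, z'} = {u {z, z'}, u' {z, z'}}" "u {z, z'} \<noteq> u' {z, z'}"
        using u zz \<open>E = E0\<close> by auto
      hence "z = u {z, z'} \<and> z' \<noteq> u {z, z'} \<or> z' = u {z, z'} \<and> z \<noteq> u {z, z'}"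
        using mem(3) by (metis doubleton_eq_iff)
      moreover obtain p q where pq: "x (h {z, z'}) \<in> V p" "y (h {z, z'}) \<in> V q" "b (x (h {z, z'})) (y (h {z, z'})) \<noteq> 0"
        using xy h_less[of "{z, z'}"] zz \<open>E = E0\<close> by blast
      moreover have "b (y (h {z, z'})) (x (h {z, z'})) \<noteq> 0" using form_zero_sym[OF pq(1,2)] pq(3) by simp
      ultimately show "b (vec v w z) (vec v w z') \<noteq> 0"
        unfolding vec[OF mem(1)] vec[OF mem(2)] g_def by auto
    qed
  qed
  thus ?thesis using v hom by blast
qed

subsection \<open>Injectivity\<close>

lemma finite_brauer: "finite {E. brauer_diagram r s E}"
proof (rule finite_subset)
  show "{E. brauer_diagram r s E} \<subseteq> Pow (Pow (vertices r s))"
    by (auto simp: brauer_diagram_def partition_on_def)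
qed simp

definition std :: "nat \<Rightarrow> nat \<Rightarrow> vertex set set \<Rightarrow> mdiagram" where
  "std r s E = (E, SOME ms. (E, ms) \<in> marked_diagrams r s)"

lemma std_marked: "brauer_diagram r s E \<Longrightarrow> std r s E \<in> marked_diagrams r s"
  unfolding std_def by (rule someI_ex[OF exists_marking])

lemma single_std:
  assumes "D \<in> marked_diagrams r s"
  shows "\<exists>c. single D - fscale c (single (std r s (fst D))) \<in> diagram_relations (psgn \<beta>) r s"
proof -
  obtain E ms where D: "D = (E, ms)" by fastforce
  have "std r s E \<in> marked_diagrams r s" using assms D brauer_marked std_marked by blast
  hence "class_eq (psgn \<beta>) r s (E, ms) (std r s E)"
    using class_eq_markings[of E "[]" ms r s "snd (std r s E)"] assms D by (simp add: std_def)
  thus ?thesis by (auto simp: class_eq_def D)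
qed

text \<open>Modulo the relations each marked diagram is a multiple of the chosen marking of its
  Brauer diagram, so linear combinations indexed by Brauer diagrams reach every class.\<close>

lemma span_normal_form:
  assumes "x \<in> diagram_span r s"
  shows "\<exists>a. x - (\<Sum>E | brauer_diagram r s E. fscale (a E) (single (std r s E))) \<in> diagram_relations (psgn \<beta>) r s"
    (is "?P x")
  using assms unfolding diagram_span_def
proof (rule cfun.span_induct_alt)
  have "(\<Sum>E | brauer_diagram r s E. fscale 0 (single (std r s E))) = 0"
    by (intro sum.neutral ballI fscale_0_left)
  thus "?P 0" using cfun.subspace_0[OF relations_subspace] by (intro exI[of _ "\<lambda>_. 0"]) (simp only: diff_zero)
next
  fix k x y
  assume "x \<in> single ` marked_diagrams r s" and "?P y"
  then obtain D a where D: "x = single D" "D \<in> marked_diagrams r s"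
    and a: "y - (\<Sum>E | brauer_diagram r s E. fscale (a E) (single (std r s E))) \<in> diagram_relations (psgn \<beta>) r s"
    by blast
  obtain c where c: "single D - fscale c (single (std r s (fst D))) \<in> diagram_relations (psgn \<beta>) r s"
    using single_std[OF D(2)] by blast
  let ?E = "fst D"
  let ?s = "\<lambda>a. (\<Sum>E | brauer_diagram r s E. fscale (a E) (single (std r s E)))"
  have E: "brauer_diagram r s ?E" using D(2) brauer_marked by (metis prod.collapse)
  \<comment> \<open>Adding \<open>k\<close> times the diagram \<open>D\<close> changes just the
    coefficient at its underlying Brauer diagram, by \<open>k * c\<close>.\<close>
  have "?s (a(?E := a ?E + k * c)) = ?s a + fscale (k * c) (single (std r s ?E))"
  proof -
    have "?s (a(?E := a ?E + k * c)) =
        (\<Sum>E | brauer_diagram r s E. fscale (a E) (single (std r s E)) +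
          (if E = ?E then fscale (k * c) (single (std r s ?E)) else 0))"
      by (rule sum.cong) (auto simp: fscale_def fun_eq_iff algebra_simps)
    also have "\<dots> = ?s a + fscale (k * c) (single (std r s ?E))"
      using E finite_brauer by (simp add: sum.distrib)
    finally show ?thesis .
  qed
  hence "fscale k x + y - ?s (a(?E := a ?E + k * c)) =
      fscale k (single D - fscale c (single (std r s ?E))) + (y - ?s a)"
    by (simp add: D(1) fscale_diff algebra_simps)
  moreover have "\<dots> \<in> diagram_relations (psgn \<beta>) r s"
    by (intro cfun.subspace_add[OF relations_subspace] cfun.subspace_scale[OF relations_subspace] c a)
  ultimately show "?P (fscale k x + y)" by (intro exI[of _ "a(?E := a ?E + k * c)"]) (simp only:)
qed

lemma F_sum:
  assumes "finite S" "\<And>E. E \<in> S \<Longrightarrow> brauer_diagram r s E"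
  shows "(\<Sum>E\<in>S. fscale (a E) (single (std r s E))) \<in> diagram_span r s \<and>
    F r s (brauer_class (psgn \<beta>) r s (\<Sum>E\<in>S. fscale (a E) (single (std r s E)))) t =
      (\<Sum>E\<in>S. fscale (a E) (FD r s (std r s E) t))"
  using assms
proof (induction S rule: finite_induct)
  case empty
  have "0 \<in> diagram_span r s" unfolding diagram_span_def by (rule cfun.span_zero)
  moreover from this have "F r s (brauer_class (psgn \<beta>) r s 0) t = 0"
    using F_lincomb[of 0 r s 0 0 0 t] by simp
  ultimately show ?case by (simp add: zero_fun_def)
next
  case (insert E S)
  let ?x = "\<Sum>E\<in>S. fscale (a E) (single (std r s E))"
  have x: "?x \<in> diagram_span r s" and s: "single (std r s E) \<in> diagram_span r s"
    using insert single_in_span[OF std_marked] by auto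
  have "F r s (brauer_class (psgn \<beta>) r s (fscale (a E) (single (std r s E)) + ?x)) t =
      fscale (a E) (FD r s (std r s E) t) + (\<Sum>E\<in>S. fscale (a E) (FD r s (std r s E) t))"
    using F_lincomb[OF s x, of "a E" 1 t] insert by (simp add: FD_def diagram_class_def)
  moreover have "fscale (a E) (single (std r s E)) + ?x \<in> diagram_span r s"
    using x s unfolding diagram_span_def by (intro cfun.span_add cfun.span_scale)
  ultimately show ?case unfolding sum.insert[OF insert.hyps] by (intro conjI)
qed

text \<open>Write \<open>x\<close> in normal form and evaluate its image, which is 0, on the vectors
  separating \<open>E0\<close>: only the term of \<open>E0\<close> remains, with a nonzero value, so
  its coefficient is 0. With all coefficients gone, \<open>x\<close> is itself a relation.\<close>

lemma kernel_trivial: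
  assumes x: "x \<in> diagram_span r s" and rs: "r + s \<le> m + n"
    and F0: "\<And>t. F r s (brauer_class (psgn \<beta>) r s x) t = 0"
  shows "x \<in> diagram_relations (psgn \<beta>) r s"
proof -
  let ?B = "{E. brauer_diagram r s E}"
  obtain a where a: "x - (\<Sum>E\<in>?B. fscale (a E) (single (std r s E))) \<in> diagram_relations (psgn \<beta>) r s"
    using span_normal_form[OF x] by (elim exE)
  have "F r s (brauer_class (psgn \<beta>) r s x) t = (\<Sum>E\<in>?B. fscale (a E) (FD r s (std r s E) t))" for t
    unfolding brauer_class_cong[OF a] by (rule F_sum[OF finite_brauer, THEN conjunct2]) simp
  hence zero: "(\<Sum>E\<in>?B. fscale (a E) (FD r s (std r s E) t)) = 0" for t
    unfolding F0 by (rule sym)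
  have "a E0 = 0" if E0: "brauer_diagram r s E0" for E0
  proof -
    obtain v w where vw: "length v = r" "length w = s" "homs v" "homs w"
      and nz: "\<forall>E. brauer_diagram r s E \<longrightarrow> (nonzero_on v w E \<longleftrightarrow> E = E0)"
      using separating_vectors[OF E0 rs] by (elim exE conjE)
    have val: "FD r s (std r s E) (pur v) (pair w) \<noteq> 0 \<longleftrightarrow> E = E0" if E: "brauer_diagram r s E" for E
      using goodD[OF all_good[OF E] std_marked[OF E, unfolded std_def] vw] nz E by (simp add: std_def)
    have sum: "(\<Sum>i\<in>I. f i) \<phi> = (\<Sum>i\<in>I. f i \<phi>)" for \<phi> and f :: "vertex set set \<Rightarrow> 'v tensor" and I
      by (induction I rule: infinite_finite_induct) simp_all
    have "0 = (\<Sum>E\<in>?B. a E * FD r s (std r s E) (pur v) (pair w))"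
      using arg_cong[OF zero[of "pur v"], of "\<lambda>t. t (pair w)"] by (simp add: sum fscale_apply)
    also have "\<dots> = (\<Sum>E\<in>?B. if E = E0 then a E0 * FD r s (std r s E0) (pur v) (pair w) else 0)"
      by (rule sum.cong) (use val in auto)
    also have "\<dots> = a E0 * FD r s (std r s E0) (pur v) (pair w)"
      using E0 finite_brauer by simp
    finally show ?thesis using val[OF E0] by simp
  qed
  hence "(\<Sum>E\<in>?B. fscale (a E) (single (std r s E))) = 0" by (intro sum.neutral) simp
  thus ?thesis using a by simp
qed

lemma F_inj:
  assumes rs: "r + s \<le> m + n"
  shows "inj_on (F r s) (brauer_space (psgn \<beta>) r s)"
proof (rule inj_onI)
  fix X Y assume "X \<in> brauer_space (psgn \<beta>) r s" "Y \<in> brauer_space (psgn \<beta>) r s" and eq: "F r s X = F r s Y"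
  then obtain x y where x: "x \<in> diagram_span r s" "X = brauer_class (psgn \<beta>) r s x"
    and y: "y \<in> diagram_span r s" "Y = brauer_class (psgn \<beta>) r s y"
    unfolding brauer_space_def by blast
  have minus: "fscale 1 x + fscale (-1) y = x - y" by (simp add: fscale_def fun_eq_iff)
  have "x - y \<in> diagram_relations (psgn \<beta>) r s"
  proof (rule kernel_trivial[OF _ rs])
    show "x - y \<in> diagram_span r s"
      using x(1) y(1) unfolding diagram_span_def by (rule cfun.span_diff)
    show "F r s (brauer_class (psgn \<beta>) r s (x - y)) t = 0" for t
      using F_lincomb[OF x(1) y(1), of 1 "-1" t] eq unfolding minus x(2) y(2)
      by (simp add: fscale_def fun_eq_iff)
  qed
  thus "X = Y" unfolding x(2) y(2) by (rule brauer_class_cong)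
qed

end

theorem theorem5p4p1:
  fixes scale :: "complex \<Rightarrow> 'v::ab_group_add \<Rightarrow> 'v"
    and V :: "bit \<Rightarrow> 'v set"
    and m n r s :: nat
    and b :: "'v \<Rightarrow> 'v \<Rightarrow> complex"
    and \<beta> :: bit
    and e e' :: "nat \<Rightarrow> 'v"
    and F :: "nat \<Rightarrow> nat \<Rightarrow> (mdiagram \<Rightarrow> complex) set \<Rightarrow> 'v tensor \<Rightarrow> 'v tensor"
  assumes "super_form scale V m n b \<beta>"
    and "homogeneous_basis scale V (m + n) e"
    and "homogeneous_basis scale V (m + n) e'"
    and "\<And>i j. i < m + n \<Longrightarrow> j < m + n \<Longrightarrow> b (e i) (e' j) = (if i = j then 1 else 0)"
    and "brauer_functor scale V b (of_nat m - of_nat n) (psgn \<beta>) (m + n) e e' F"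
  shows "(\<beta> = 0 \<longrightarrow> real (r + s) \<le> real m + real n / 2 \<longrightarrow>
            inj_on (F r s) (brauer_space (psgn \<beta>) r s)) \<and>
         (\<beta> = 1 \<longrightarrow> r + s \<le> m + n \<longrightarrow>
            inj_on (F r s) (brauer_space (psgn \<beta>) r s))"
proof -
  interpret brauer_setting scale V m n b \<beta> e e' F
    using assms by (simp add: brauer_setting_def brauer_setting_axioms_def)
  show ?thesis
  proof (intro conjI impI)
    assume "real (r + s) \<le> real m + real n / 2"
    \<comment> \<open>The even case enters the common bound through n/2 \<le> n.\<close>
    hence "real (r + s) \<le> real (m + n)" by simp
    hence "r + s \<le> m + n" by (simp only: of_nat_le_iff)
    thus "inj_on (F r s) (brauer_space (psgn \<beta>) r s)" by (rule F_inj)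
  next
    assume "r + s \<le> m + n"
    thus "inj_on (F r s) (brauer_space (psgn \<beta>) r s)" by (rule F_inj)
  qed
qed

end
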